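(* (Relativity.) Let $A,B:\mathcal{U}$. The map \[ \mathsf{bridgetorel} := \lambda C.\,\lambda\langle a,b\rangle.\,\mathsf{Bridge}_{\mathbf{x}.C\,\mathbf{x}}(a,b) \;:\; \mathsf{Bridge}_{\mathcal{U}}(A,B) \to (A\times B \to \mathcal{U}) \] is an equivalence; that is, the type $\mathsf{isEquiv}(\mathsf{bridgetorel})$ is inhabited. In particular $\mathsf{Bridge}_{\mathcal{U}}(A,B)\simeq (A\times B\to\mathcal{U})$.
   Context: We work in parametric cubical type theory: Martin-Löf type theory with $\Sigma$-types, $\Pi$-types (with $\eta$) and a universe $\mathcal{U}$ of Kan types, extended by two sorts of dimension variables. Path dimensions $r$ are path variables $x,y,z,\dots$ or constants $0,1$ and are structural. For a type $A$ depending on a path variable $x$ and $M_\varepsilon:A[\varepsilon/x]$, the type $\mathsf{Path}_{x.A}(M_0,M_1)$ has elements $\langle x\rangle P$ with $P[\varepsilon/x]=M_\varepsilon$, application $Q@r$, and $\beta,\eta$; write $\mathsf{Path}_A$ when $A$ is constant. All types are Kan (they support coercion and homogeneous composition along path dimensions), so paths behave like identity types of homotopy type theory; function extensionality and univalence hold for paths, and contractibility, propositions, equivalences $A\simeq B$ and $\mathsf{isEquiv}$ are defined via $\mathsf{Path}$ as in homotopy type theory. Bridge dimensions $\mathbf{r}$ are bridge variables $\mathbf{x},\mathbf{y},\dots$ or constants $\mathbf{0},\mathbf{1}$; they are substructural (weakening and exchange, but no contraction: no substitution identifies two distinct bridge variables). For a type $A$ depending on a fresh bridge variable $\mathbf{x}$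 and $M_{\boldsymbol\varepsilon}:A[\boldsymbol\varepsilon/\mathbf{x}]$, the type $\mathsf{Bridge}_{\mathbf{x}.A}(M_{\mathbf{0}},M_{\mathbf{1}})$ has elements $\lambda^{\mathbf{x}}P$ with $P:A$ (in the context extended by $\mathbf{x}$) and $P[\boldsymbol\varepsilon/\mathbf{x}]=M_{\boldsymbol\varepsilon}$; application $Q\,\mathbf{r}$ is allowed only when $Q$ does not depend on $\mathbf{r}$, with rules $(\lambda^{\mathbf{x}}P)\,\mathbf{r}=P[\mathbf{r}/\mathbf{x}]$, $Q\,\boldsymbol\varepsilon=M_{\boldsymbol\varepsilon}$, $Q=\lambda^{\mathbf{y}}(Q\,\mathbf{y})$; write $\mathsf{Bridge}_A$ when $A$ is constant in $\mathbf{x}$. Gel-types: for a bridge dimension $\mathbf{r}$ and types $A,B$ and a type family $R(a,b)$ ($a:A,b:B$) not depending on $\mathbf{r}$, there is a type $\mathsf{Gel}_{\mathbf{r}}(A,B,a.b.R)$ with $\mathsf{Gel}_{\mathbf{0}}(\dots)=A$, $\mathsf{Gel}_{\mathbf{1}}(\dots)=B$, elements $\mathsf{gel}_{\mathbf{r}}(M,N,P)$ for $M:A,N:B,P:R(M,N)$ (with $\mathsf{gel}_{\mathbf{0}}(M,N,P)=M$, $\mathsf{gel}_{\mathbf{1}}(M,N,P)=N$), and for $Q:\mathsf{Gel}_{\mathbf{x}}(A,B,a.b.R)$ with $\mathbf{x}$ fresh an element $\mathsf{ungel}(\mathbf{x}.Q):R(Q[\mathbf{0}/\mathbf{x}],Q[\mathbf{1}/\mathbf{x}])$,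 with $\beta$ and $\eta$ rules. The universe $\mathcal{U}$ is closed under all these type formers. The theory also has an $\mathsf{extent}$ operator: for $M:A[\mathbf{r}/\mathbf{x}]$, $\mathsf{extent}_{\mathbf{r}}(M;a.N;a'.P;a.a'.c.Q)$ (with $N$ over $A[\mathbf{0}/\mathbf{x}]$, $P$ over $A[\mathbf{1}/\mathbf{x}]$, $Q$ a bridge between $N$ and $P$ depending on $c:\mathsf{Bridge}_{\mathbf{x}.A}(a,a')$, none mentioning $\mathbf{r}$) computes to $N[M/a]$ at $\mathbf{0}$, $P[M/a']$ at $\mathbf{1}$, and to $Q[M[\mathbf{0}/\mathbf{x}]/a,M[\mathbf{1}/\mathbf{x}]/a',\lambda^{\mathbf{x}}M/c]\,\mathbf{r}$ at a variable. Pattern notation: $\lambda\langle a,b\rangle.M$ abbreviates $\lambda t.M[\mathsf{fst}\,t/a,\mathsf{snd}\,t/b]$. *)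

theory Defs
  imports Main
begin

text \<open>
  Parametric cubical type theory as a deductive system over raw de Bruijn syntax. Term variables,
  path variables and bridge variables share one index space. Which of the three an index denotes is
  determined by the context.
\<close>

datatype dkind = Pth | Brg

datatype tm =
    Var nat
  | Zero dkind | One dkind
  | U
  | Pi tm tm \<comment> \<open>binds one term variable in the second argument\<close>
  | Lam tm | App tm tm
  | Sig tm tm | Pair tm tm | Fst tm | Snd tm
  | Path tm tm tm \<comment> \<open>binds a path variable in the first argument\<close>
  | PLam tm | PApp tm tm
  | Coe tm tm tm tm \<comment> \<open>\<open>Coe A r s M\<close> binds a path variable in \<open>A\<close>\<close>
  | HCom tm tm tm tm "(dkind \<times> tm \<times> tm \<times> tm) list"
      \<comment> \<open>\<open>HCom A r s M fs\<close>: composition in \<open>A\<close> from \<open>r\<close> to \<open>s\<close> with base \<open>M\<close>. An entry \<open>(k, q, t, N)\<close>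
         of \<open>fs\<close> is a tube \<open>N\<close>, binding a path variable, on the face \<open>q = t\<close>\<close>
  | Univalence tm tm tm
  | Bridge tm tm tm \<comment> \<open>binds a bridge variable in the first argument\<close>
  | BLam tm | BApp tm tm
  | Gel tm tm tm tm \<comment> \<open>\<open>Gel r A B R\<close> binds \<open>a\<close> (index 1) and \<open>b\<close> (index 0) in \<open>R\<close>\<close>
  | MkGel tm tm tm tm
  | Ungel tm \<comment> \<open>binds a bridge variable\<close>
  | Extent tm tm tm tm tm
      \<comment> \<open>\<open>Extent r M N P Q\<close> binds \<open>a\<close> in \<open>N\<close>, \<open>a'\<close> in \<open>P\<close>, and \<open>a, a', c\<close> (indices 2, 1, 0) in \<open>Q\<close>\<close>

abbreviation scons :: "'a \<Rightarrow> (nat \<Rightarrow> 'a) \<Rightarrow> nat \<Rightarrow> 'a" (infixr "\<bullet>" 65)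
  where "x \<bullet> \<sigma> \<equiv> case_nat x \<sigma>"

definition upr :: "(nat \<Rightarrow> nat) \<Rightarrow> nat \<Rightarrow> nat" where
  "upr \<rho> = 0 \<bullet> (\<lambda>n. Suc (\<rho> n))"

fun ren :: "(nat \<Rightarrow> nat) \<Rightarrow> tm \<Rightarrow> tm" where
  "ren \<rho> (Var n) = Var (\<rho> n)"
| "ren \<rho> (Zero k) = Zero k"
| "ren \<rho> (One k) = One k"
| "ren \<rho> U = U"
| "ren \<rho> (Pi A B) = Pi (ren \<rho> A) (ren (upr \<rho>) B)"
| "ren \<rho> (Lam M) = Lam (ren (upr \<rho>) M)"
| "ren \<rho> (App M N) = App (ren \<rho> M) (ren \<rho> N)"
| "ren \<rho> (Sig A B) = Sig (ren \<rho> A) (ren (upr \<rho>) B)"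
| "ren \<rho> (Pair M N) = Pair (ren \<rho> M) (ren \<rho> N)"
| "ren \<rho> (Fst M) = Fst (ren \<rho> M)"
| "ren \<rho> (Snd M) = Snd (ren \<rho> M)"
| "ren \<rho> (Path A M N) = Path (ren (upr \<rho>) A) (ren \<rho> M) (ren \<rho> N)"
| "ren \<rho> (PLam M) = PLam (ren (upr \<rho>) M)"
| "ren \<rho> (PApp M r) = PApp (ren \<rho> M) (ren \<rho> r)"
| "ren \<rho> (Coe A r s M) = Coe (ren (upr \<rho>) A) (ren \<rho> r) (ren \<rho> s) (ren \<rho> M)"
| "ren \<rho> (HCom A r s M fs) = HCom (ren \<rho> A) (ren \<rho> r) (ren \<rho> s) (ren \<rho> M)
     (map (\<lambda>(k, q, t, N). (k, ren \<rho> q, ren \<rho> t, ren (upr \<rho>) N)) fs)"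
| "ren \<rho> (Univalence A B H) = Univalence (ren \<rho> A) (ren \<rho> B) (ren \<rho> H)"
| "ren \<rho> (Bridge A M N) = Bridge (ren (upr \<rho>) A) (ren \<rho> M) (ren \<rho> N)"
| "ren \<rho> (BLam M) = BLam (ren (upr \<rho>) M)"
| "ren \<rho> (BApp M r) = BApp (ren \<rho> M) (ren \<rho> r)"
| "ren \<rho> (Gel r A B R) = Gel (ren \<rho> r) (ren \<rho> A) (ren \<rho> B) (ren (upr (upr \<rho>)) R)"
| "ren \<rho> (MkGel r M N P) = MkGel (ren \<rho> r) (ren \<rho> M) (ren \<rho> N) (ren \<rho> P)"
| "ren \<rho> (Ungel M) = Ungel (ren (upr \<rho>) M)"
| "ren \<rho> (Extent r M N P Q) =
     Extent (ren \<rho> r) (ren \<rho> M) (ren (upr \<rho>) N) (ren (upr \<rho>) P) (ren (upr (upr (upr \<rho>))) Q)"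

abbreviation wk :: "tm \<Rightarrow> tm" where "wk \<equiv> ren Suc"

definition ups :: "(nat \<Rightarrow> tm) \<Rightarrow> nat \<Rightarrow> tm" where
  "ups \<sigma> = Var 0 \<bullet> (\<lambda>n. wk (\<sigma> n))"

fun sub :: "(nat \<Rightarrow> tm) \<Rightarrow> tm \<Rightarrow> tm" where
  "sub \<sigma> (Var n) = \<sigma> n"
| "sub \<sigma> (Zero k) = Zero k"
| "sub \<sigma> (One k) = One k"
| "sub \<sigma> U = U"
| "sub \<sigma> (Pi A B) = Pi (sub \<sigma> A) (sub (ups \<sigma>) B)"
| "sub \<sigma> (Lam M) = Lam (sub (ups \<sigma>) M)"
| "sub \<sigma> (App M N) = App (sub \<sigma> M) (sub \<sigma> N)"
| "sub \<sigma> (Sig A B) = Sig (sub \<sigma> A) (sub (ups \<sigma>) B)"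
| "sub \<sigma> (Pair M N) = Pair (sub \<sigma> M) (sub \<sigma> N)"
| "sub \<sigma> (Fst M) = Fst (sub \<sigma> M)"
| "sub \<sigma> (Snd M) = Snd (sub \<sigma> M)"
| "sub \<sigma> (Path A M N) = Path (sub (ups \<sigma>) A) (sub \<sigma> M) (sub \<sigma> N)"
| "sub \<sigma> (PLam M) = PLam (sub (ups \<sigma>) M)"
| "sub \<sigma> (PApp M r) = PApp (sub \<sigma> M) (sub \<sigma> r)"
| "sub \<sigma> (Coe A r s M) = Coe (sub (ups \<sigma>) A) (sub \<sigma> r) (sub \<sigma> s) (sub \<sigma> M)"
| "sub \<sigma> (HCom A r s M fs) = HCom (sub \<sigma> A) (sub \<sigma> r) (sub \<sigma> s) (sub \<sigma> M)
     (map (\<lambda>(k, q, t, N). (k, sub \<sigma> q, sub \<sigma> t, sub (ups \<sigma>) N)) fs)"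
| "sub \<sigma> (Univalence A B H) = Univalence (sub \<sigma> A) (sub \<sigma> B) (sub \<sigma> H)"
| "sub \<sigma> (Bridge A M N) = Bridge (sub (ups \<sigma>) A) (sub \<sigma> M) (sub \<sigma> N)"
| "sub \<sigma> (BLam M) = BLam (sub (ups \<sigma>) M)"
| "sub \<sigma> (BApp M r) = BApp (sub \<sigma> M) (sub \<sigma> r)"
| "sub \<sigma> (Gel r A B R) = Gel (sub \<sigma> r) (sub \<sigma> A) (sub \<sigma> B) (sub (ups (ups \<sigma>)) R)"
| "sub \<sigma> (MkGel r M N P) = MkGel (sub \<sigma> r) (sub \<sigma> M) (sub \<sigma> N) (sub \<sigma> P)"
| "sub \<sigma> (Ungel M) = Ungel (sub (ups \<sigma>) M)"
| "sub \<sigma> (Extent r M N P Q) =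
     Extent (sub \<sigma> r) (sub \<sigma> M) (sub (ups \<sigma>) N) (sub (ups \<sigma>) P) (sub (ups (ups (ups \<sigma>))) Q)"

definition inst :: "tm \<Rightarrow> tm \<Rightarrow> tm" ("_\<langle>_\<rangle>" [1000, 0] 1000) where
  "B\<langle>N\<rangle> = sub (N \<bullet> Var) B"

definition inst2 :: "tm \<Rightarrow> tm \<Rightarrow> tm \<Rightarrow> tm" ("_\<langle>_,_\<rangle>" [1000, 0, 0] 1000) where
  "R\<langle>M,N\<rangle> = sub (N \<bullet> M \<bullet> Var) R"

definition Arr :: "tm \<Rightarrow> tm \<Rightarrow> tm" where
  "Arr A B = Pi A (wk B)"

definition Times :: "tm \<Rightarrow> tm \<Rightarrow> tm" where
  "Times A B = Sig A (wk B)"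

definition PathC :: "tm \<Rightarrow> tm \<Rightarrow> tm \<Rightarrow> tm" where
  "PathC A M N = Path (wk A) M N"

definition BridgeC :: "tm \<Rightarrow> tm \<Rightarrow> tm \<Rightarrow> tm" where
  "BridgeC A M N = Bridge (wk A) M N"

definition isContr :: "tm \<Rightarrow> tm" where
  "isContr A = Sig A (Pi (wk A) (PathC (wk (wk A)) (Var 1) (Var 0)))"

definition Fiber :: "tm \<Rightarrow> tm \<Rightarrow> tm \<Rightarrow> tm \<Rightarrow> tm" where
  "Fiber A B F b = Sig A (PathC (wk B) (App (wk F) (Var 0)) (wk b))"

definition isEquiv :: "tm \<Rightarrow> tm \<Rightarrow> tm \<Rightarrow> tm" where
  "isEquiv A B F = Pi B (isContr (Fiber (wk A) (wk B) (wk F) (Var 0)))"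

definition Equiv :: "tm \<Rightarrow> tm \<Rightarrow> tm" where
  "Equiv A B = Sig (Arr A B) (isEquiv (wk A) (wk B) (Var 0))"

text \<open>
  The canonical map \<open>Path\<^sub>U(A, B) \<rightarrow> A \<simeq> B\<close>: transport of the identity equivalence, where \<open>H\<close> is a
  proof that the identity on \<open>A\<close> is an equivalence.
\<close>

definition pathtoequiv :: "tm \<Rightarrow> tm \<Rightarrow> tm" where
  "pathtoequiv A H =
     Lam (Coe (Equiv (wk (wk A)) (PApp (Var 1) (Var 0))) (Zero Pth) (One Pth)
            (Pair (Lam (Var 0)) (wk H)))"

text \<open>
  A context lists its most recent entry first, and each entry is relative to the entries after it
  in the list. A constraint \<open>Con\<close> binds no index. \<open>Dead\<close> takes up an index that cannot be used: the
  restriction of \<open>\<Gamma>\<close> by a bridge variable \<open>x\<close> (the part of \<open>\<Gamma>\<close> that is apart from \<open>x\<close>) replaces \<open>x\<close>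
  and all later term variables by \<open>Dead\<close> and deletes the constraints on \<open>x\<close>, so that terms over the
  restricted context need no renumbering. Later dimension variables are apart from \<open>x\<close> and stay.
\<close>

datatype entry = TmVar tm | DimVar dkind | Dead | Con dkind tm tm

type_synonym ctx = "entry list"

fun wk_entry :: "entry \<Rightarrow> entry" where
  "wk_entry (TmVar A) = TmVar (wk A)"
| "wk_entry (DimVar k) = DimVar k"
| "wk_entry Dead = Dead"
| "wk_entry (Con k r s) = Con k (wk r) (wk s)"

fun lookup :: "ctx \<Rightarrow> nat \<Rightarrow> entry option" where
  "lookup [] n = None"
| "lookup (Con k r s # \<Gamma>) n = lookup \<Gamma> n"
| "lookup (e # \<Gamma>) 0 = Some (wk_entry e)"
| "lookup (e # \<Gamma>) (Suc n) = map_option wk_entry (lookup \<Gamma> n)"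

fun constraints :: "ctx \<Rightarrow> (dkind \<times> tm \<times> tm) set" where
  "constraints [] = {}"
| "constraints (Con k r s # \<Gamma>) = insert (k, r, s) (constraints \<Gamma>)"
| "constraints (e # \<Gamma>) = (\<lambda>(k, r, s). (k, wk r, wk s)) ` constraints \<Gamma>"

fun kill :: "nat \<Rightarrow> ctx \<Rightarrow> ctx" where
  "kill n [] = []"
| "kill n (Con k r s # \<Gamma>) =
     (if r = Var n \<or> s = Var n then kill n \<Gamma> else Con k r s # kill n \<Gamma>)"
| "kill 0 (e # \<Gamma>) = Dead # \<Gamma>"
| "kill (Suc n) (e # \<Gamma>) = (case e of TmVar A \<Rightarrow> Dead | _ \<Rightarrow> e) # kill n \<Gamma>"

fun restr :: "ctx \<Rightarrow> tm \<Rightarrow> ctx" where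
  "restr \<Gamma> (Var n) = kill n \<Gamma>"
| "restr \<Gamma> r = \<Gamma>"

datatype size = Small | Large

text \<open>
  Judgements are partial equivalence relations: \<open>A\<close> is a type if it is equal to itself as a type, and
  similarly for the other forms. Thus every formation, introduction and elimination rule below is
  stated as its congruence rule. \<open>TyEq Small\<close> is equality of elements of the universe.
  \<open>SubEq \<sigma> \<tau> \<Gamma>\<close> states that \<open>\<sigma>\<close> and \<open>\<tau>\<close> are equal substitutions into the current context for the
  variables of \<open>\<Gamma>\<close>. \<open>ExtentCases A C N P Q N' P' Q'\<close> collects the premises of the \<open>extent\<close> rules other
  than its principal argument; \<open>C\<close> is the motive, over \<open>x\<close> (index 1) and \<open>d : A\<close> (index 0).
\<close>

datatype jdg =
    Wf
  | DimEq dkind tm tm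
  | TyEq size tm tm
  | TmEq tm tm tm ("_ \<doteq> _ \<Ztypecolon> _" [50, 50, 50] 45)
  | SubEq "nat \<Rightarrow> tm" "nat \<Rightarrow> tm" ctx
  | ExtentCases tm tm tm tm tm tm tm tm

abbreviation Dim :: "dkind \<Rightarrow> tm \<Rightarrow> jdg" where "Dim k r \<equiv> DimEq k r r"
abbreviation Ty :: "size \<Rightarrow> tm \<Rightarrow> jdg" where "Ty l A \<equiv> TyEq l A A"
abbreviation TmOf :: "tm \<Rightarrow> tm \<Rightarrow> jdg" ("_ \<Ztypecolon> _" [50, 50] 45) where "M \<Ztypecolon> A \<equiv> M \<doteq> M \<Ztypecolon> A"

inductive derivable :: "ctx \<Rightarrow> jdg \<Rightarrow> bool" (infix "\<turnstile>" 42) where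

  wf_nil: "[] \<turnstile> Wf"
| wf_tm: "\<lbrakk>\<Gamma> \<turnstile> Wf; \<Gamma> \<turnstile> Ty Large A\<rbrakk> \<Longrightarrow> TmVar A # \<Gamma> \<turnstile> Wf"
| wf_dim: "\<Gamma> \<turnstile> Wf \<Longrightarrow> DimVar k # \<Gamma> \<turnstile> Wf"
| wf_dead: "\<Gamma> \<turnstile> Wf \<Longrightarrow> Dead # \<Gamma> \<turnstile> Wf"
| wf_con: "\<lbrakk>\<Gamma> \<turnstile> Wf; \<Gamma> \<turnstile> Dim k r; \<Gamma> \<turnstile> Dim k s; k = Brg \<longrightarrow> s \<in> {Zero Brg, One Brg}\<rbrakk>
    \<Longrightarrow> Con k r s # \<Gamma> \<turnstile> Wf"

| dim_zero: "\<Gamma> \<turnstile> Dim k (Zero k)"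
| dim_one: "\<Gamma> \<turnstile> Dim k (One k)"
| dim_var: "lookup \<Gamma> n = Some (DimVar k) \<Longrightarrow> \<Gamma> \<turnstile> Dim k (Var n)"
| dim_con: "(k, r, s) \<in> constraints \<Gamma> \<Longrightarrow> \<Gamma> \<turnstile> DimEq k r s"
| dim_sym: "\<Gamma> \<turnstile> DimEq k r s \<Longrightarrow> \<Gamma> \<turnstile> DimEq k s r"
| dim_trans: "\<lbrakk>\<Gamma> \<turnstile> DimEq k r s; \<Gamma> \<turnstile> DimEq k s t\<rbrakk> \<Longrightarrow> \<Gamma> \<turnstile> DimEq k r t"

| ty_sym: "\<Gamma> \<turnstile> TyEq l A B \<Longrightarrow> \<Gamma> \<turnstile> TyEq l B A"
| ty_trans: "\<lbrakk>\<Gamma> \<turnstile> TyEq l A B; \<Gamma> \<turnstile> TyEq l B C\<rbrakk> \<Longrightarrow> \<Gamma> \<turnstile> TyEq l A C"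
| tm_sym: "\<Gamma> \<turnstile> M \<doteq> N \<Ztypecolon> A \<Longrightarrow> \<Gamma> \<turnstile> N \<doteq> M \<Ztypecolon> A"
| tm_trans: "\<lbrakk>\<Gamma> \<turnstile> M \<doteq> N \<Ztypecolon> A; \<Gamma> \<turnstile> N \<doteq> P \<Ztypecolon> A\<rbrakk> \<Longrightarrow> \<Gamma> \<turnstile> M \<doteq> P \<Ztypecolon> A"
| tm_conv: "\<lbrakk>\<Gamma> \<turnstile> M \<doteq> N \<Ztypecolon> A; \<Gamma> \<turnstile> TyEq Large A B\<rbrakk> \<Longrightarrow> \<Gamma> \<turnstile> M \<doteq> N \<Ztypecolon> B"
| tm_var: "lookup \<Gamma> n = Some (TmVar A) \<Longrightarrow> \<Gamma> \<turnstile> Var n \<Ztypecolon> A"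

\<comment> \<open>In a context with contradictory constraints any two types, and any two elements, are equal.\<close>
| ty_absurd: "\<lbrakk>\<Gamma> \<turnstile> DimEq k (Zero k) (One k); \<Gamma> \<turnstile> Ty l A; \<Gamma> \<turnstile> Ty l B\<rbrakk> \<Longrightarrow> \<Gamma> \<turnstile> TyEq l A B"
| tm_absurd: "\<lbrakk>\<Gamma> \<turnstile> DimEq k (Zero k) (One k); \<Gamma> \<turnstile> M \<Ztypecolon> A; \<Gamma> \<turnstile> N \<Ztypecolon> A\<rbrakk> \<Longrightarrow> \<Gamma> \<turnstile> M \<doteq> N \<Ztypecolon> A"

\<comment> \<open>Substitution. The dimension substituted for a bridge variable must be apart from everything
   substituted for the earlier variables, which excludes contraction of bridge variables.\<close>
| sub_nil: "\<Delta> \<turnstile> SubEq \<sigma> \<tau> []"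
| sub_tm: "\<lbrakk>\<Delta> \<turnstile> SubEq (\<sigma> \<circ> Suc) (\<tau> \<circ> Suc) \<Gamma>; \<Delta> \<turnstile> \<sigma> 0 \<doteq> \<tau> 0 \<Ztypecolon> sub (\<sigma> \<circ> Suc) A\<rbrakk>
    \<Longrightarrow> \<Delta> \<turnstile> SubEq \<sigma> \<tau> (TmVar A # \<Gamma>)"
| sub_path: "\<lbrakk>\<Delta> \<turnstile> SubEq (\<sigma> \<circ> Suc) (\<tau> \<circ> Suc) \<Gamma>; \<Delta> \<turnstile> DimEq Pth (\<sigma> 0) (\<tau> 0)\<rbrakk>
    \<Longrightarrow> \<Delta> \<turnstile> SubEq \<sigma> \<tau> (DimVar Pth # \<Gamma>)"
| sub_bridge: "\<lbrakk>restr \<Delta> (\<sigma> 0) \<turnstile> SubEq (\<sigma> \<circ> Suc) (\<tau> \<circ> Suc) \<Gamma>;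
     restr \<Delta> (\<tau> 0) \<turnstile> SubEq (\<sigma> \<circ> Suc) (\<tau> \<circ> Suc) \<Gamma>; \<Delta> \<turnstile> DimEq Brg (\<sigma> 0) (\<tau> 0)\<rbrakk>
    \<Longrightarrow> \<Delta> \<turnstile> SubEq \<sigma> \<tau> (DimVar Brg # \<Gamma>)"
| sub_dead: "\<Delta> \<turnstile> SubEq (\<sigma> \<circ> Suc) (\<tau> \<circ> Suc) \<Gamma> \<Longrightarrow> \<Delta> \<turnstile> SubEq \<sigma> \<tau> (Dead # \<Gamma>)"
| sub_con: "\<lbrakk>\<Delta> \<turnstile> SubEq \<sigma> \<tau> \<Gamma>; \<Delta> \<turnstile> DimEq k (sub \<sigma> r) (sub \<sigma> s)\<rbrakk>
    \<Longrightarrow> \<Delta> \<turnstile> SubEq \<sigma> \<tau> (Con k r s # \<Gamma>)"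
| ty_sub: "\<lbrakk>\<Gamma> \<turnstile> Wf; \<Delta> \<turnstile> SubEq \<sigma> \<tau> \<Gamma>; \<Gamma> \<turnstile> TyEq l A B\<rbrakk> \<Longrightarrow> \<Delta> \<turnstile> TyEq l (sub \<sigma> A) (sub \<tau> B)"
| tm_sub: "\<lbrakk>\<Gamma> \<turnstile> Wf; \<Delta> \<turnstile> SubEq \<sigma> \<tau> \<Gamma>; \<Gamma> \<turnstile> M \<doteq> N \<Ztypecolon> A\<rbrakk>
    \<Longrightarrow> \<Delta> \<turnstile> sub \<sigma> M \<doteq> sub \<tau> N \<Ztypecolon> sub \<sigma> A"

| univ_form: "\<Gamma> \<turnstile> Ty Large U"
| univ_intro: "\<Gamma> \<turnstile> TyEq Small A B \<Longrightarrow> \<Gamma> \<turnstile> A \<doteq> B \<Ztypecolon> U"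
| univ_elim: "\<Gamma> \<turnstile> A \<doteq> B \<Ztypecolon> U \<Longrightarrow> \<Gamma> \<turnstile> TyEq Small A B"
| univ_large: "\<Gamma> \<turnstile> TyEq Small A B \<Longrightarrow> \<Gamma> \<turnstile> TyEq Large A B"

| pi_form: "\<lbrakk>\<Gamma> \<turnstile> TyEq l A A'; TmVar A # \<Gamma> \<turnstile> TyEq l B B'\<rbrakk> \<Longrightarrow> \<Gamma> \<turnstile> TyEq l (Pi A B) (Pi A' B')"
| pi_intro: "\<lbrakk>\<Gamma> \<turnstile> Ty Large A; TmVar A # \<Gamma> \<turnstile> M \<doteq> M' \<Ztypecolon> B\<rbrakk> \<Longrightarrow> \<Gamma> \<turnstile> Lam M \<doteq> Lam M' \<Ztypecolon> Pi A B"
| pi_elim: "\<lbrakk>\<Gamma> \<turnstile> M \<doteq> M' \<Ztypecolon> Pi A B; \<Gamma> \<turnstile> N \<doteq> N' \<Ztypecolon> A\<rbrakk> \<Longrightarrow> \<Gamma> \<turnstile> App M N \<doteq> App M' N' \<Ztypecolon> B\<langle>N\<rangle>"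
| pi_beta: "\<lbrakk>TmVar A # \<Gamma> \<turnstile> M \<Ztypecolon> B; \<Gamma> \<turnstile> N \<Ztypecolon> A\<rbrakk> \<Longrightarrow> \<Gamma> \<turnstile> App (Lam M) N \<doteq> M\<langle>N\<rangle> \<Ztypecolon> B\<langle>N\<rangle>"
| pi_eta: "\<Gamma> \<turnstile> M \<Ztypecolon> Pi A B \<Longrightarrow> \<Gamma> \<turnstile> M \<doteq> Lam (App (wk M) (Var 0)) \<Ztypecolon> Pi A B"

| sig_form: "\<lbrakk>\<Gamma> \<turnstile> TyEq l A A'; TmVar A # \<Gamma> \<turnstile> TyEq l B B'\<rbrakk> \<Longrightarrow> \<Gamma> \<turnstile> TyEq l (Sig A B) (Sig A' B')"
| sig_intro: "\<lbrakk>TmVar A # \<Gamma> \<turnstile> Ty Large B; \<Gamma> \<turnstile> M \<doteq> M' \<Ztypecolon> A; \<Gamma> \<turnstile> N \<doteq> N' \<Ztypecolon> B\<langle>M\<rangle>\<rbrakk>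
    \<Longrightarrow> \<Gamma> \<turnstile> Pair M N \<doteq> Pair M' N' \<Ztypecolon> Sig A B"
| sig_fst: "\<Gamma> \<turnstile> M \<doteq> M' \<Ztypecolon> Sig A B \<Longrightarrow> \<Gamma> \<turnstile> Fst M \<doteq> Fst M' \<Ztypecolon> A"
| sig_snd: "\<Gamma> \<turnstile> M \<doteq> M' \<Ztypecolon> Sig A B \<Longrightarrow> \<Gamma> \<turnstile> Snd M \<doteq> Snd M' \<Ztypecolon> B\<langle>Fst M\<rangle>"
| sig_beta_fst: "\<lbrakk>\<Gamma> \<turnstile> M \<Ztypecolon> A; \<Gamma> \<turnstile> N \<Ztypecolon> B\<rbrakk> \<Longrightarrow> \<Gamma> \<turnstile> Fst (Pair M N) \<doteq> M \<Ztypecolon> A"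
| sig_beta_snd: "\<lbrakk>\<Gamma> \<turnstile> M \<Ztypecolon> A; \<Gamma> \<turnstile> N \<Ztypecolon> B\<rbrakk> \<Longrightarrow> \<Gamma> \<turnstile> Snd (Pair M N) \<doteq> N \<Ztypecolon> B"
| sig_eta: "\<Gamma> \<turnstile> M \<Ztypecolon> Sig A B \<Longrightarrow> \<Gamma> \<turnstile> M \<doteq> Pair (Fst M) (Snd M) \<Ztypecolon> Sig A B"

| path_form: "\<lbrakk>DimVar Pth # \<Gamma> \<turnstile> TyEq l A A'; \<Gamma> \<turnstile> M \<doteq> M' \<Ztypecolon> A\<langle>Zero Pth\<rangle>; \<Gamma> \<turnstile> N \<doteq> N' \<Ztypecolon> A\<langle>One Pth\<rangle>\<rbrakk>
    \<Longrightarrow> \<Gamma> \<turnstile> TyEq l (Path A M N) (Path A' M' N')"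
| path_intro: "\<lbrakk>DimVar Pth # \<Gamma> \<turnstile> P \<doteq> P' \<Ztypecolon> A;
     \<Gamma> \<turnstile> P\<langle>Zero Pth\<rangle> \<doteq> M \<Ztypecolon> A\<langle>Zero Pth\<rangle>; \<Gamma> \<turnstile> P\<langle>One Pth\<rangle> \<doteq> N \<Ztypecolon> A\<langle>One Pth\<rangle>\<rbrakk>
    \<Longrightarrow> \<Gamma> \<turnstile> PLam P \<doteq> PLam P' \<Ztypecolon> Path A M N"
| path_elim: "\<lbrakk>\<Gamma> \<turnstile> Q \<doteq> Q' \<Ztypecolon> Path A M N; \<Gamma> \<turnstile> DimEq Pth r r'\<rbrakk> \<Longrightarrow> \<Gamma> \<turnstile> PApp Q r \<doteq> PApp Q' r' \<Ztypecolon> A\<langle>r\<rangle>"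
| path_zero: "\<Gamma> \<turnstile> Q \<Ztypecolon> Path A M N \<Longrightarrow> \<Gamma> \<turnstile> PApp Q (Zero Pth) \<doteq> M \<Ztypecolon> A\<langle>Zero Pth\<rangle>"
| path_one: "\<Gamma> \<turnstile> Q \<Ztypecolon> Path A M N \<Longrightarrow> \<Gamma> \<turnstile> PApp Q (One Pth) \<doteq> N \<Ztypecolon> A\<langle>One Pth\<rangle>"
| path_beta: "\<lbrakk>DimVar Pth # \<Gamma> \<turnstile> P \<Ztypecolon> A; \<Gamma> \<turnstile> Dim Pth r\<rbrakk> \<Longrightarrow> \<Gamma> \<turnstile> PApp (PLam P) r \<doteq> P\<langle>r\<rangle> \<Ztypecolon> A\<langle>r\<rangle>"
| path_eta: "\<Gamma> \<turnstile> Q \<Ztypecolon> Path A M N \<Longrightarrow> \<Gamma> \<turnstile> Q \<doteq> PLam (PApp (wk Q) (Var 0)) \<Ztypecolon> Path A M N"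

\<comment> \<open>Kan operations, for every type. Only the boundary equations are imposed: the equations that
   evaluate \<open>Coe\<close> and \<open>HCom\<close> at the individual type formers are not part of this system.\<close>
| coe: "\<lbrakk>DimVar Pth # \<Gamma> \<turnstile> TyEq Large A A'; \<Gamma> \<turnstile> DimEq Pth r r'; \<Gamma> \<turnstile> DimEq Pth s s'; \<Gamma> \<turnstile> M \<doteq> M' \<Ztypecolon> A\<langle>r\<rangle>\<rbrakk>
    \<Longrightarrow> \<Gamma> \<turnstile> Coe A r s M \<doteq> Coe A' r' s' M' \<Ztypecolon> A\<langle>s\<rangle>"
| coe_same: "\<lbrakk>DimVar Pth # \<Gamma> \<turnstile> Ty Large A; \<Gamma> \<turnstile> DimEq Pth r s; \<Gamma> \<turnstile> M \<Ztypecolon> A\<langle>r\<rangle>\<rbrakk>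
    \<Longrightarrow> \<Gamma> \<turnstile> Coe A r s M \<doteq> M \<Ztypecolon> A\<langle>s\<rangle>"
| hcom: "\<lbrakk>\<Gamma> \<turnstile> TyEq Large A A'; \<Gamma> \<turnstile> DimEq Pth r r'; \<Gamma> \<turnstile> DimEq Pth s s'; \<Gamma> \<turnstile> M \<doteq> M' \<Ztypecolon> A;
     length fs = length fs';
     \<And>k q t N k' q' t' N'. ((k, q, t, N), (k', q', t', N')) \<in> set (zip fs fs') \<Longrightarrow>
       k = k' \<and> (k = Brg \<longrightarrow> t \<in> {Zero Brg, One Brg} \<and> t' = t) \<and>
       (\<Gamma> \<turnstile> DimEq k q q') \<and> (\<Gamma> \<turnstile> DimEq k t t') \<and>
       (DimVar Pth # Con k q t # \<Gamma> \<turnstile> N \<doteq> N' \<Ztypecolon> wk A) \<and>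
       (Con k q t # \<Gamma> \<turnstile> N\<langle>r\<rangle> \<doteq> M \<Ztypecolon> A);
     \<And>k q t N k' q' t' N'. \<lbrakk>(k, q, t, N) \<in> set fs; (k', q', t', N') \<in> set fs\<rbrakk> \<Longrightarrow>
       DimVar Pth # Con k q t # Con k' q' t' # \<Gamma> \<turnstile> N \<doteq> N' \<Ztypecolon> wk A\<rbrakk>
    \<Longrightarrow> \<Gamma> \<turnstile> HCom A r s M fs \<doteq> HCom A' r' s' M' fs' \<Ztypecolon> A"
| hcom_same: "\<lbrakk>\<Gamma> \<turnstile> HCom A r s M fs \<Ztypecolon> A; \<Gamma> \<turnstile> DimEq Pth r s\<rbrakk> \<Longrightarrow> \<Gamma> \<turnstile> HCom A r s M fs \<doteq> M \<Ztypecolon> A"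
| hcom_tube: "\<lbrakk>\<Gamma> \<turnstile> HCom A r s M fs \<Ztypecolon> A; (k, q, t, N) \<in> set fs; \<Gamma> \<turnstile> DimEq k q t\<rbrakk>
    \<Longrightarrow> \<Gamma> \<turnstile> HCom A r s M fs \<doteq> N\<langle>s\<rangle> \<Ztypecolon> A"

\<comment> \<open>Univalence: \<open>pathtoequiv\<close> is an equivalence. As being an equivalence is a proposition, nothing
   depends on which proof \<open>H\<close> is used for the identity function.\<close>
| univalence: "\<lbrakk>\<Gamma> \<turnstile> TyEq Small A A'; \<Gamma> \<turnstile> TyEq Small B B'; \<Gamma> \<turnstile> H \<doteq> H' \<Ztypecolon> isEquiv A A (Lam (Var 0))\<rbrakk>
    \<Longrightarrow> \<Gamma> \<turnstile> Univalence A B H \<doteq> Univalence A' B' H' \<Ztypecolon>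
          isEquiv (PathC U A B) (Equiv A B) (pathtoequiv A H)"

| bridge_form: "\<lbrakk>DimVar Brg # \<Gamma> \<turnstile> TyEq l A A'; \<Gamma> \<turnstile> M \<doteq> M' \<Ztypecolon> A\<langle>Zero Brg\<rangle>; \<Gamma> \<turnstile> N \<doteq> N' \<Ztypecolon> A\<langle>One Brg\<rangle>\<rbrakk>
    \<Longrightarrow> \<Gamma> \<turnstile> TyEq l (Bridge A M N) (Bridge A' M' N')"
| bridge_intro: "\<lbrakk>DimVar Brg # \<Gamma> \<turnstile> P \<doteq> P' \<Ztypecolon> A;
     \<Gamma> \<turnstile> P\<langle>Zero Brg\<rangle> \<doteq> M \<Ztypecolon> A\<langle>Zero Brg\<rangle>; \<Gamma> \<turnstile> P\<langle>One Brg\<rangle> \<doteq> N \<Ztypecolon> A\<langle>One Brg\<rangle>\<rbrakk>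
    \<Longrightarrow> \<Gamma> \<turnstile> BLam P \<doteq> BLam P' \<Ztypecolon> Bridge A M N"
| bridge_elim: "\<lbrakk>\<Gamma> \<turnstile> Dim Brg r; restr \<Gamma> r \<turnstile> Q \<doteq> Q' \<Ztypecolon> Bridge A M N\<rbrakk>
    \<Longrightarrow> \<Gamma> \<turnstile> BApp Q r \<doteq> BApp Q' r \<Ztypecolon> A\<langle>r\<rangle>"
| bridge_zero: "\<Gamma> \<turnstile> Q \<Ztypecolon> Bridge A M N \<Longrightarrow> \<Gamma> \<turnstile> BApp Q (Zero Brg) \<doteq> M \<Ztypecolon> A\<langle>Zero Brg\<rangle>"
| bridge_one: "\<Gamma> \<turnstile> Q \<Ztypecolon> Bridge A M N \<Longrightarrow> \<Gamma> \<turnstile> BApp Q (One Brg) \<doteq> N \<Ztypecolon> A\<langle>One Brg\<rangle>"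
| bridge_beta: "\<lbrakk>\<Gamma> \<turnstile> Dim Brg r; DimVar Brg # restr \<Gamma> r \<turnstile> P \<Ztypecolon> A\<rbrakk>
    \<Longrightarrow> \<Gamma> \<turnstile> BApp (BLam P) r \<doteq> P\<langle>r\<rangle> \<Ztypecolon> A\<langle>r\<rangle>"
| bridge_eta: "\<Gamma> \<turnstile> Q \<Ztypecolon> Bridge A M N \<Longrightarrow> \<Gamma> \<turnstile> Q \<doteq> BLam (BApp (wk Q) (Var 0)) \<Ztypecolon> Bridge A M N"

| gel_form: "\<lbrakk>\<Gamma> \<turnstile> Dim Brg r; restr \<Gamma> r \<turnstile> TyEq l A A'; restr \<Gamma> r \<turnstile> TyEq l B B';
     TmVar (wk B) # TmVar A # restr \<Gamma> r \<turnstile> TyEq l R R'\<rbrakk>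
    \<Longrightarrow> \<Gamma> \<turnstile> TyEq l (Gel r A B R) (Gel r A' B' R')"
| gel_form_zero: "\<lbrakk>\<Gamma> \<turnstile> Ty l A; \<Gamma> \<turnstile> Ty l B; TmVar (wk B) # TmVar A # \<Gamma> \<turnstile> Ty l R\<rbrakk>
    \<Longrightarrow> \<Gamma> \<turnstile> TyEq l (Gel (Zero Brg) A B R) A"
| gel_form_one: "\<lbrakk>\<Gamma> \<turnstile> Ty l A; \<Gamma> \<turnstile> Ty l B; TmVar (wk B) # TmVar A # \<Gamma> \<turnstile> Ty l R\<rbrakk>
    \<Longrightarrow> \<Gamma> \<turnstile> TyEq l (Gel (One Brg) A B R) B"
| gel_intro: "\<lbrakk>\<Gamma> \<turnstile> Dim Brg r; TmVar (wk B) # TmVar A # restr \<Gamma> r \<turnstile> Ty Large R;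
     restr \<Gamma> r \<turnstile> M \<doteq> M' \<Ztypecolon> A; restr \<Gamma> r \<turnstile> N \<doteq> N' \<Ztypecolon> B; restr \<Gamma> r \<turnstile> P \<doteq> P' \<Ztypecolon> R\<langle>M,N\<rangle>\<rbrakk>
    \<Longrightarrow> \<Gamma> \<turnstile> MkGel r M N P \<doteq> MkGel r M' N' P' \<Ztypecolon> Gel r A B R"
| gel_intro_zero: "\<lbrakk>TmVar (wk B) # TmVar A # \<Gamma> \<turnstile> Ty Large R;
     \<Gamma> \<turnstile> M \<Ztypecolon> A; \<Gamma> \<turnstile> N \<Ztypecolon> B; \<Gamma> \<turnstile> P \<Ztypecolon> R\<langle>M,N\<rangle>\<rbrakk> \<Longrightarrow> \<Gamma> \<turnstile> MkGel (Zero Brg) M N P \<doteq> M \<Ztypecolon> A"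
| gel_intro_one: "\<lbrakk>TmVar (wk B) # TmVar A # \<Gamma> \<turnstile> Ty Large R;
     \<Gamma> \<turnstile> M \<Ztypecolon> A; \<Gamma> \<turnstile> N \<Ztypecolon> B; \<Gamma> \<turnstile> P \<Ztypecolon> R\<langle>M,N\<rangle>\<rbrakk> \<Longrightarrow> \<Gamma> \<turnstile> MkGel (One Brg) M N P \<doteq> N \<Ztypecolon> B"
| gel_elim: "\<lbrakk>\<Gamma> \<turnstile> Ty Large A; \<Gamma> \<turnstile> Ty Large B; TmVar (wk B) # TmVar A # \<Gamma> \<turnstile> Ty Large R;
     DimVar Brg # \<Gamma> \<turnstile> Q \<doteq> Q' \<Ztypecolon> Gel (Var 0) (wk A) (wk B) (ren (upr (upr Suc)) R)\<rbrakk>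
    \<Longrightarrow> \<Gamma> \<turnstile> Ungel Q \<doteq> Ungel Q' \<Ztypecolon> R\<langle>Q\<langle>Zero Brg\<rangle>,Q\<langle>One Brg\<rangle>\<rangle>"
| gel_beta: "\<lbrakk>TmVar (wk B) # TmVar A # \<Gamma> \<turnstile> Ty Large R; \<Gamma> \<turnstile> M \<Ztypecolon> A; \<Gamma> \<turnstile> N \<Ztypecolon> B; \<Gamma> \<turnstile> P \<Ztypecolon> R\<langle>M,N\<rangle>\<rbrakk>
    \<Longrightarrow> \<Gamma> \<turnstile> Ungel (MkGel (Var 0) (wk M) (wk N) (wk P)) \<doteq> P \<Ztypecolon> R\<langle>M,N\<rangle>"
| gel_eta: "\<lbrakk>\<Gamma> \<turnstile> Dim Brg r; restr \<Gamma> r \<turnstile> Ty Large A; restr \<Gamma> r \<turnstile> Ty Large B;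
     TmVar (wk B) # TmVar A # restr \<Gamma> r \<turnstile> Ty Large R;
     DimVar Brg # restr \<Gamma> r \<turnstile> Q \<Ztypecolon> Gel (Var 0) (wk A) (wk B) (ren (upr (upr Suc)) R)\<rbrakk>
    \<Longrightarrow> \<Gamma> \<turnstile> Q\<langle>r\<rangle> \<doteq> MkGel r Q\<langle>Zero Brg\<rangle> Q\<langle>One Brg\<rangle> (Ungel Q) \<Ztypecolon> Gel r A B R"

\<comment> \<open>In the last premise the line of types is \<open>C\<close> at the bridge variable \<open>x\<close> and at \<open>c x\<close>, and the
   endpoints are \<open>N\<close> at \<open>a\<close> and \<open>P\<close> at \<open>a'\<close>.\<close>
| extent_cases: "\<lbrakk>DimVar Brg # \<Gamma> \<turnstile> Ty Large A; TmVar A # DimVar Brg # \<Gamma> \<turnstile> Ty Large C;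
     TmVar A\<langle>Zero Brg\<rangle> # \<Gamma> \<turnstile> N \<doteq> N' \<Ztypecolon> sub (Var 0 \<bullet> Zero Brg \<bullet> (\<lambda>n. Var (n + 1))) C;
     TmVar A\<langle>One Brg\<rangle> # \<Gamma> \<turnstile> P \<doteq> P' \<Ztypecolon> sub (Var 0 \<bullet> One Brg \<bullet> (\<lambda>n. Var (n + 1))) C;
     TmVar (Bridge (ren (upr (\<lambda>n. n + 2)) A) (Var 1) (Var 0)) # TmVar (wk A\<langle>One Brg\<rangle>)
         # TmVar A\<langle>Zero Brg\<rangle> # \<Gamma>
       \<turnstile> Q \<doteq> Q' \<Ztypecolon> Bridge (sub (BApp (Var 1) (Var 0) \<bullet> Var 0 \<bullet> (\<lambda>n. Var (n + 4))) C)
                      (sub (Var 2 \<bullet> (\<lambda>n. Var (n + 3))) N)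
                      (sub (Var 1 \<bullet> (\<lambda>n. Var (n + 3))) P)\<rbrakk>
    \<Longrightarrow> \<Gamma> \<turnstile> ExtentCases A C N P Q N' P' Q'"
| extent: "\<lbrakk>\<Gamma> \<turnstile> Dim Brg r; \<Gamma> \<turnstile> M \<doteq> M' \<Ztypecolon> A\<langle>r\<rangle>; restr \<Gamma> r \<turnstile> ExtentCases A C N P Q N' P' Q'\<rbrakk>
    \<Longrightarrow> \<Gamma> \<turnstile> Extent r M N P Q \<doteq> Extent r M' N' P' Q' \<Ztypecolon> C\<langle>r,M\<rangle>"
| extent_zero: "\<lbrakk>\<Gamma> \<turnstile> M \<Ztypecolon> A\<langle>Zero Brg\<rangle>; \<Gamma> \<turnstile> ExtentCases A C N P Q N P Q\<rbrakk>
    \<Longrightarrow> \<Gamma> \<turnstile> Extent (Zero Brg) M N P Q \<doteq> N\<langle>M\<rangle> \<Ztypecolon> C\<langle>Zero Brg,M\<rangle>"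
| extent_one: "\<lbrakk>\<Gamma> \<turnstile> M \<Ztypecolon> A\<langle>One Brg\<rangle>; \<Gamma> \<turnstile> ExtentCases A C N P Q N P Q\<rbrakk>
    \<Longrightarrow> \<Gamma> \<turnstile> Extent (One Brg) M N P Q \<doteq> P\<langle>M\<rangle> \<Ztypecolon> C\<langle>One Brg,M\<rangle>"
| extent_beta: "\<lbrakk>\<Gamma> \<turnstile> Dim Brg r; DimVar Brg # restr \<Gamma> r \<turnstile> M \<Ztypecolon> A;
     restr \<Gamma> r \<turnstile> ExtentCases A C N P Q N P Q\<rbrakk>
    \<Longrightarrow> \<Gamma> \<turnstile> Extent r M\<langle>r\<rangle> N P Q
          \<doteq> BApp (sub (BLam M \<bullet> M\<langle>One Brg\<rangle> \<bullet> M\<langle>Zero Brg\<rangle> \<bullet> Var) Q) r \<Ztypecolon> C\<langle>r,M\<langle>r\<rangle>\<rangle>"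

text \<open>\<open>\<lambda>C. \<lambda>\<langle>a, b\<rangle>. Bridge\<^bsub>x.C x\<^esub>(a, b)\<close>, where \<open>\<lambda>\<langle>a, b\<rangle>\<close> stands for \<open>\<lambda>t\<close> with projections of \<open>t\<close>.\<close>

definition bridgetorel :: tm where
  "bridgetorel = Lam (Lam (Bridge (BApp (Var 2) (Var 0)) (Fst (Var 0)) (Snd (Var 0))))"

end

theory Submission
  imports Defs
begin

text \<open>
  The candidate inverse sends a relation \<open>R\<close> to the line \<open>x. Gel\<^sub>x(A, B, R)\<close>. Starting from \<open>R\<close>,
  the bridges over this line are \<open>R(a, b)\<close> up to the strict isomorphism \<open>ungel\<close>/\<open>gel\<close>, and
  univalence with function extensionality turns this into a path of relations.

  Starting from a line \<open>C\<close>, put \<open>D x = Gel\<^sub>x(A, B, Bridge\<^sub>C)\<close>. The bridges over \<open>D\<close> and over \<open>C\<close>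
  are strictly isomorphic, and \<open>extent\<close> extends these isomorphisms to an equivalence \<open>D x \<simeq> C x\<close>
  for a fresh bridge variable \<open>x\<close>, which is the identity at both ends. Univalence gives a path
  from \<open>D x\<close> to \<open>C x\<close>, but its ends are the loops of \<open>A\<close> and \<open>B\<close> that univalence assigns to the
  identity, and these need not be reflexivity. The same construction with the identity of \<open>D\<close> has
  the same end loops, so composing one path with the inverse of the other removes them.

  Finally, a function with a quasi-inverse has contractible fibers.
\<close>

section \<open>Substitution\<close>

text \<open>What shapes the proof is the strictness of ends. An element of a path or bridge type has
  its ends fixed up to judgemental equality, whereas univalence is a bare term of an
  \<open>isEquiv\<close> type and computes nothing. A path between lines of types is therefore
  assembled pointwise in the bridge variable, from data whose values at both ends are known
  judgementally. Hence the isomorphisms of bridges are strict, the equivalence between the lines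
  becomes the identity equivalence at the ends including its proof component, and term formers such
  as \<open>equiv_tm\<close> and \<open>ua\<close> must respect equality and commute with
  substitution.

  The need for \<open>extent\<close> comes from the fact that an argument of type \<open>D x\<close>
  may itself mention \<open>x\<close>. A map on bridges says nothing about such an argument until it
  is abstracted to a bridge, and that abstraction is what \<open>extent\<close> performs.

  Coercion and composition satisfy only their boundary equations. Paths are therefore handled by
  coercing along lines of path types and then converting the ends.\<close>

lemma upr_simps [simp]: "upr \<rho> 0 = 0" "upr \<rho> (Suc n) = Suc (\<rho> n)"
  by (simp_all add: upr_def)

lemma ups_simps [simp]: "ups \<sigma> 0 = Var 0" "ups \<sigma> (Suc n) = wk (\<sigma> n)"
  by (simp_all add: ups_def)

lemma ups_upr: "(\<lambda>n. ups \<sigma> (upr \<rho> n)) = ups (\<lambda>n. \<sigma> (\<rho> n))"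
  by (rule ext) (case_tac n; simp)

lemma ups_Var: "ups Var = Var"
  by (simp add: fun_eq_iff ups_def split: nat.split)

lemma Var_upr: "(\<lambda>n. Var (upr \<rho> n)) = ups (\<lambda>n. Var (\<rho> n))"
  by (rule ext) (case_tac n; simp)

lemma sub_Var [simp]: "sub Var M = M"
  by (induction "Var" M rule: sub.induct) (auto simp: ups_Var intro!: map_idI)

lemma ren_as_sub: "ren \<rho> M = sub (\<lambda>n. Var (\<rho> n)) M"
  by (induction \<rho> M rule: ren.induct) (auto simp: Var_upr)

text \<open>The order of the composition laws is dictated by their binder cases: substituting after
  renaming needs only \<open>ups_upr\<close>, renaming after substituting needs the fusion of
  renamings, and \<open>sub_sub\<close> needs both mixed laws.\<close>

lemma sub_ren: "sub \<sigma> (ren \<rho> M) = sub (\<lambda>n. \<sigma> (\<rho> n)) M"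
  by (induction \<rho> M arbitrary: \<sigma> rule: ren.induct) (auto simp: ups_upr)

lemma ren_ren: "ren \<rho> (ren \<rho>' M) = ren (\<lambda>n. \<rho> (\<rho>' n)) M"
  by (simp only: ren_as_sub[of \<rho>] sub_ren, simp add: ren_as_sub)

lemma ren_upr_ups: "(\<lambda>n. ren (upr \<rho>) (ups \<sigma> n)) = ups (\<lambda>n. ren \<rho> (\<sigma> n))"
  by (rule ext) (case_tac n; simp add: ren_ren)

lemma ren_of_sub: "ren \<rho> (sub \<sigma> M) = sub (\<lambda>n. ren \<rho> (\<sigma> n)) M"
  by (induction \<sigma> M arbitrary: \<rho> rule: sub.induct) (auto simp: ren_upr_ups)

lemma sub_ups_ups: "(\<lambda>n. sub (ups \<tau>) (ups \<sigma> n)) = ups (\<lambda>n. sub \<tau> (\<sigma> n))"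
  by (rule ext) (case_tac n; simp add: sub_ren ren_of_sub)

lemma sub_sub: "sub \<tau> (sub \<sigma> M) = sub (\<lambda>n. sub \<tau> (\<sigma> n)) M"
  by (induction \<sigma> M arbitrary: \<tau> rule: sub.induct) (auto simp: sub_ups_ups)

text \<open>Weakening, composition and the embedding of renamings are named constants because
  lambda-terms in their place would be poor left-hand sides for rewriting.\<close>

definition shift :: "nat \<Rightarrow> nat \<Rightarrow> tm" where "shift k = (\<lambda>n. Var (n + k))"

definition sub_comp :: "(nat \<Rightarrow> tm) \<Rightarrow> (nat \<Rightarrow> tm) \<Rightarrow> nat \<Rightarrow> tm" where
  "sub_comp \<sigma> \<tau> = (\<lambda>n. sub \<sigma> (\<tau> n))"

definition of_ren :: "(nat \<Rightarrow> nat) \<Rightarrow> nat \<Rightarrow> tm" where "of_ren \<rho> = (\<lambda>n. Var (\<rho> n))"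

lemma shift_app: "shift k 0 = Var k" "shift k (Suc n) = shift (Suc k) n"
  by (simp_all add: shift_def)
lemma shift_0: "shift 0 = Var" by (simp add: shift_def fun_eq_iff)
lemma sub_shift_0: "sub (shift 0) M = M" by (simp add: shift_0)
lemma sub_sub_comp: "sub \<sigma> (sub \<tau> M) = sub (sub_comp \<sigma> \<tau>) M" by (simp add: sub_sub sub_comp_def)
lemma ren_eq_sub: "ren \<rho> M = sub (of_ren \<rho>) M" by (simp add: ren_as_sub of_ren_def)

lemma of_ren_simps:
  "of_ren Suc = shift (Suc 0)" "of_ren (\<lambda>n. Suc (Suc n)) = shift (Suc (Suc 0))"
  "of_ren (upr \<rho>) = ups (of_ren \<rho>)"
  by (simp_all add: of_ren_def shift_def Var_upr)

lemma Var_shift: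
  "(\<lambda>n. Var (Suc n)) = shift (Suc 0)"
  "(\<lambda>n. Var (Suc (Suc n))) = shift (Suc (Suc 0))"
  "(\<lambda>n. Var (Suc (Suc (Suc n)))) = shift (Suc (Suc (Suc 0)))"
  "(\<lambda>n. Var (Suc (Suc (Suc (Suc n))))) = shift (Suc (Suc (Suc (Suc 0))))"
  by (simp_all add: shift_def)

lemma scons_Var: "x \<bullet> Var = x \<bullet> shift 0" by (simp add: shift_0)

text \<open>The eta law of explicit substitutions: a head that merely continues its tail is
  absorbed, so that normal forms can be compared syntactically.\<close>

lemma scons_shift: "Var k \<bullet> shift (Suc k) = shift k"
  by (simp add: fun_eq_iff shift_def split: nat.split)

text \<open>The last equation serves the constant tail \<open>U\<close> of the substitution behind
  \<open>qinv\<close>.\<close>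

lemma sub_comp_simps:
  "sub_comp \<sigma> (x \<bullet> \<tau>) = sub \<sigma> x \<bullet> sub_comp \<sigma> \<tau>"
  "sub_comp \<sigma> (shift 0) = \<sigma>"
  "sub_comp (x \<bullet> \<sigma>) (shift (Suc k)) = sub_comp \<sigma> (shift k)"
  "sub_comp (shift j) (shift k) = shift (k + j)"
  "sub_comp \<sigma> (\<lambda>_. M) = (\<lambda>_. sub \<sigma> M)"
  by (simp_all add: sub_comp_def shift_def fun_eq_iff split: nat.split)

lemma ups_sub_comp: "ups \<sigma> = Var 0 \<bullet> sub_comp (shift (Suc 0)) \<sigma>"
  by (simp add: fun_eq_iff sub_comp_def ups_def shift_def ren_as_sub split: nat.split)

text \<open>
  Simplification with \<open>sub_norm\<close> turns renamings into substitutions and every substitution into a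
  list of terms ending in a shift. This decides the equations between substituted terms that occur
  as side conditions below.
\<close>

lemmas sub_norm = sub_shift_0 sub_sub_comp ren_eq_sub of_ren_simps Var_shift scons_Var scons_shift
  sub_comp_simps
  ups_sub_comp inst_def inst2_def shift_app
  Arr_def Times_def PathC_def BridgeC_def isContr_def Fiber_def isEquiv_def Equiv_def
    eval_nat_numeral
  sub.simps

text \<open>The attribute \<open>simplified\<close> with arguments uses exactly the given rules and
  not the ambient simpset, so arithmetic, case and list rules have to be listed.\<close>

lemmas sub_norm_full = sub_norm plus_nat.simps nat.case list.map prod.case One_nat_def

declare ren.simps [simp del] sub.simps [simp del]

section \<open>Weakening\<close>

text \<open>The number \<open>k\<close> counts the new indices, not the new entries: a constraint binds no index.\<close>

inductive extends :: "nat \<Rightarrow> ctx \<Rightarrow> ctx \<Rightarrow> bool" where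
  extends_refl: "extends 0 \<Gamma> \<Gamma>"
| extends_con: "extends k \<Delta> \<Gamma> \<Longrightarrow> extends k (Con c r s # \<Delta>) \<Gamma>"
| extends_tm: "extends k \<Delta> \<Gamma> \<Longrightarrow> extends (Suc k) (TmVar A # \<Delta>) \<Gamma>"
| extends_dim: "extends k \<Delta> \<Gamma> \<Longrightarrow> extends (Suc k) (DimVar c # \<Delta>) \<Gamma>"
| extends_dead: "extends k \<Delta> \<Gamma> \<Longrightarrow> extends (Suc k) (Dead # \<Delta>) \<Gamma>"

lemma extends_tail:
  assumes "extends k \<Delta> \<Theta>"
  shows "\<Theta> = TmVar A # \<Gamma> \<Longrightarrow> extends (Suc k) \<Delta> \<Gamma>" "\<Theta> = DimVar c # \<Gamma> \<Longrightarrow> extends (Suc k) \<Delta> \<Gamma>"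
    "\<Theta> = Dead # \<Gamma> \<Longrightarrow> extends (Suc k) \<Delta> \<Gamma>" "\<Theta> = Con c r s # \<Gamma> \<Longrightarrow> extends k \<Delta> \<Gamma>"
  using assms by (induction; simp add: extends.intros)+

lemma lookup_extends:
  assumes "extends k \<Delta> \<Gamma>"
  shows "lookup \<Gamma> n = Some (TmVar A) \<Longrightarrow> lookup \<Delta> (n + k) = Some (TmVar (sub (shift k) A))"
    and "lookup \<Gamma> n = Some (DimVar c) \<Longrightarrow> lookup \<Delta> (n + k) = Some (DimVar c)"
  using assms by (induction; auto simp: sub_norm)+

lemma constraints_extends:
  assumes "extends k \<Delta> \<Gamma>" "(c, r, s) \<in> constraints \<Gamma>"
  shows "(c, sub (shift k) r, sub (shift k) s) \<in> constraints \<Delta>"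
  using assms by induction (auto simp: sub_norm image_iff intro!: bexI[rotated])

text \<open>Restricting by the variable at index \<open>k\<close> kills term variables and drops
  constraints above it and leaves everything below untouched. The result still extends the part of
  the context below that variable, which is what \<open>sub_bridge\<close> asks of a
  weakening.\<close>

lemma extends_kill: "extends k \<Delta> \<Theta> \<Longrightarrow> \<Theta> = DimVar c # \<Gamma> \<Longrightarrow> extends (Suc k) (kill k \<Delta>) \<Gamma>"
  by (induction rule: extends.induct) (auto intro: extends.intros)

text \<open>Induction on \<Gamma> with \<Delta> arbitrary: at a bridge variable the remaining
  substitution is required not in \<Delta> but in its restriction, and \<open>extends_kill\<close>
  makes the induction hypothesis applicable there.\<close>

lemma shift_SubEq: "extends k \<Delta> \<Gamma> \<Longrightarrow> \<Delta> \<turnstile> SubEq (shift k) (shift k) \<Gamma>"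
proof (induction \<Gamma> arbitrary: k \<Delta>)
  case Nil
  show ?case by (rule sub_nil)
next
  case (Cons e \<Gamma>)
  have tl: "shift k \<circ> Suc = shift (Suc k)" by (simp add: fun_eq_iff shift_def)
  have IH: "\<Delta> \<turnstile> SubEq (shift k \<circ> Suc) (shift k \<circ> Suc) \<Gamma>" if "extends (Suc k) \<Delta> \<Gamma>" for \<Delta>
    unfolding tl using that by (rule Cons.IH)
  show ?case
  proof (cases e)
    case (TmVar A)
    with Cons.prems have "extends (Suc k) \<Delta> \<Gamma>" by (simp add: extends_tail)
    moreover have "lookup \<Delta> k = Some (TmVar (sub (shift k) (wk A)))"
      using lookup_extends(1)[of k \<Delta> _ 0] Cons.prems TmVar by simp
    ultimately show ?thesis unfolding TmVar
      by (intro sub_tm IH) (simp_all add: tl sub_ren shift_app tm_var)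
  next
    case (DimVar c)
    with Cons.prems have e: "extends (Suc k) \<Delta> \<Gamma>" "extends (Suc k) (kill k \<Delta>) \<Gamma>"
      by (simp_all add: extends_tail extends_kill)
    have d: "\<Delta> \<turnstile> Dim c (Var k)"
      using lookup_extends(2)[of k \<Delta> _ 0] Cons.prems DimVar by (simp add: dim_var)
    show ?thesis
    proof (cases c)
      case Pth
      show ?thesis unfolding DimVar Pth
        by (intro sub_path IH e) (use d Pth in \<open>simp add: shift_app\<close>)
    next
      case Brg
      have "restr \<Delta> (shift k 0) = kill k \<Delta>" by (simp add: shift_app)
      with IH[OF e(2)] have r: "restr \<Delta> (shift k 0) \<turnstile> SubEq (shift k \<circ> Suc) (shift k \<circ> Suc) \<Gamma>"
        by simp
      show ?thesis unfolding DimVar Brg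
        by (rule sub_bridge[OF r r]) (use d in \<open>simp only: shift_app(1) Brg\<close>)
    qed
  next
    case Dead
    with Cons.prems have "extends (Suc k) \<Delta> \<Gamma>" by (simp add: extends_tail)
    then show ?thesis unfolding Dead by (intro sub_dead IH)
  next
    case (Con c r s)
    with Cons.prems have "extends k \<Delta> \<Gamma>" by (simp add: extends_tail)
    moreover have "(c, sub (shift k) r, sub (shift k) s) \<in> constraints \<Delta>"
      by (rule constraints_extends[OF Cons.prems]) (simp add: Con)
    ultimately show ?thesis unfolding Con by (intro sub_con Cons.IH dim_con)
  qed
qed

lemma weaken_tm:
  assumes "\<Gamma> \<turnstile> Wf" "\<Gamma> \<turnstile> M \<doteq> N \<Ztypecolon> A" "extends k \<Delta> \<Gamma>" "A' = sub (shift k) A"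
  shows "\<Delta> \<turnstile> sub (shift k) M \<doteq> sub (shift k) N \<Ztypecolon> A'"
  using tm_sub[OF assms(1) shift_SubEq[OF assms(3)] assms(2)] assms(4) by simp

lemma weaken_ty:
  assumes "\<Gamma> \<turnstile> Wf" "\<Gamma> \<turnstile> TyEq l A B" "extends k \<Delta> \<Gamma>"
  shows "\<Delta> \<turnstile> TyEq l (sub (shift k) A) (sub (shift k) B)"
  using ty_sub[OF assms(1) shift_SubEq[OF assms(3)] assms(2)] by simp

section \<open>Type checking\<close>

lemma tm_type_eq: "\<lbrakk>\<Gamma> \<turnstile> M \<doteq> N \<Ztypecolon> A; A' = A\<rbrakk> \<Longrightarrow> \<Gamma> \<turnstile> M \<doteq> N \<Ztypecolon> A'"
  by simp
lemma var_type_eq: "\<lbrakk>lookup \<Gamma> n = Some (TmVar A); A' = A\<rbrakk> \<Longrightarrow> \<Gamma> \<turnstile> Var n \<Ztypecolon> A'"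
  by (simp add: tm_var)
lemma app_type_eq: "\<lbrakk>\<Gamma> \<turnstile> M \<doteq> M' \<Ztypecolon> Pi A B; \<Gamma> \<turnstile> N \<doteq> N' \<Ztypecolon> A; C = B\<langle>N\<rangle>\<rbrakk> \<Longrightarrow> \<Gamma> \<turnstile> App M N \<doteq> App M' N' \<Ztypecolon> C"
  by (simp add: pi_elim)
lemma papp_type_eq: "\<lbrakk>\<Gamma> \<turnstile> Q \<doteq> Q' \<Ztypecolon> Path A M N; \<Gamma> \<turnstile> DimEq Pth r r'; C = A\<langle>r\<rangle>\<rbrakk> \<Longrightarrow> \<Gamma> \<turnstile> PApp Q r
  \<doteq> PApp Q' r' \<Ztypecolon> C"
  by (simp add: path_elim)
lemma coe_type_eq: "\<lbrakk>DimVar Pth # \<Gamma> \<turnstile> TyEq Large A A'; \<Gamma> \<turnstile> DimEq Pth r r'; \<Gamma> \<turnstile> DimEq Pth s s'; \<Gamma> \<turnstile> M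
  \<doteq> M' \<Ztypecolon> A\<langle>r\<rangle>; C = A\<langle>s\<rangle>\<rbrakk>
    \<Longrightarrow> \<Gamma> \<turnstile> Coe A r s M \<doteq> Coe A' r' s' M' \<Ztypecolon> C"
  by (simp add: coe)
lemma snd_type_eq: "\<lbrakk>\<Gamma> \<turnstile> M \<doteq> M' \<Ztypecolon> Sig A B; C = B\<langle>Fst M\<rangle>\<rbrakk> \<Longrightarrow> \<Gamma> \<turnstile> Snd M \<doteq> Snd M' \<Ztypecolon> C"
  by (simp add: sig_snd)
lemma ty_of_univ: "\<Gamma> \<turnstile> A \<doteq> B \<Ztypecolon> U \<Longrightarrow> \<Gamma> \<turnstile> TyEq l A B"
  by (cases l) (simp_all add: univ_elim univ_large)

lemma tm_refl_left: "\<Gamma> \<turnstile> M \<doteq> N \<Ztypecolon> A \<Longrightarrow> \<Gamma> \<turnstile> M \<Ztypecolon> A"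
  by (blast intro: tm_trans tm_sym)
lemma tm_refl_right: "\<Gamma> \<turnstile> M \<doteq> N \<Ztypecolon> A \<Longrightarrow> \<Gamma> \<turnstile> N \<Ztypecolon> A"
  by (blast intro: tm_trans tm_sym)

text \<open>
  These rules determine the type of a term up to side conditions that \<open>sub_norm\<close> solves, so that
  alternating them with simplification is a type checker. Weakened hypotheses are added as leaves.
\<close>

lemmas typing = univ_form var_type_eq app_type_eq papp_type_eq coe_type_eq snd_type_eq sig_fst
  pi_form pi_intro sig_form sig_intro
  path_form path_intro bridge_form bridge_intro dim_zero dim_one dim_var extends.intros

lemma constraints_absurd: "\<lbrakk>(k, r, Zero k) \<in> constraints \<Gamma>; (k, r, One k) \<in> constraints \<Gamma>\<rbrakk>
  \<Longrightarrow> \<Gamma> \<turnstile> DimEq k (Zero k) (One k)"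
  by (blast intro: dim_trans dim_sym dim_con)

section \<open>Paths\<close>

text \<open>
  A square with sides \<open>y\<close> at \<open>r = 0\<close>, \<open>q @ i\<close> at \<open>r = 1\<close> and \<open>y\<close> at \<open>i = 1\<close>. It contracts
  \<open>\<Sigma>z. Path(z, y)\<close>, and it is the only composition needed; the two tubes meet under contradictory
  constraints. Everything else about paths is obtained by coercion.
\<close>

definition connection :: "tm \<Rightarrow> tm \<Rightarrow> tm \<Rightarrow> tm \<Rightarrow> tm \<Rightarrow> tm" where
  "connection Y y q r i = HCom Y (One Pth) i y
     [(Pth, r, Zero Pth, wk y), (Pth, r, One Pth, PApp (wk q) (Var 0))]"

lemma connection:
  assumes wf: "\<Gamma> \<turnstile> Wf" and Y: "\<Gamma> \<turnstile> Ty Large Y" and y: "\<Gamma> \<turnstile> y \<Ztypecolon> Y"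
    and q: "\<Gamma> \<turnstile> q \<Ztypecolon> PathC Y z y" and r: "\<Gamma> \<turnstile> Dim Pth r" and i: "\<Gamma> \<turnstile> Dim Pth i"
  shows "\<Gamma> \<turnstile> connection Y y q r i \<Ztypecolon> Y"
proof -
  note typing' = typing tm_type_eq[OF q] tm_type_eq[OF y] weaken_tm[OF wf q] weaken_tm[OF wf y]
    weaken_ty[OF wf Y]
  have N0: "\<Delta> \<turnstile> wk y \<Ztypecolon> wk Y" if "extends (Suc 0) \<Delta> \<Gamma>" for \<Delta>
    using weaken_tm[OF wf y that] by (simp add: sub_norm)
  have N1: "\<Delta> \<turnstile> PApp (wk q) (Var 0) \<Ztypecolon> wk Y" if "extends (Suc 0) \<Delta> \<Gamma>"
    "lookup \<Delta> 0 = Some (DimVar Pth)" for \<Delta>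
    using that by (simp add: sub_norm) (rule typing' | simp add: sub_norm | assumption)+
  \<comment> \<open>Where the two tubes meet, \<open>r\<close> equals both ends. The overlap premise
    of \<open>hcom\<close> compares the tubes in either order, hence both orders of the
    constraints.\<close>
  have abs: "DimVar Pth # Con Pth r (One Pth) # Con Pth r (Zero Pth) # \<Gamma> \<turnstile> DimEq Pth (Zero Pth)
    (One Pth)"
     "DimVar Pth # Con Pth r (Zero Pth) # Con Pth r (One Pth) # \<Gamma> \<turnstile> DimEq Pth (Zero Pth) (One Pth)"
    by (rule constraints_absurd[of _ "wk r"]; simp add: sub_norm)+
  have base: "Con Pth r (Zero Pth) # \<Gamma> \<turnstile> (wk y)\<langle>One Pth\<rangle> \<doteq> y \<Ztypecolon> Y"
    "Con Pth r (One Pth) # \<Gamma> \<turnstile> (PApp (wk q) (Var 0))\<langle>One Pth\<rangle> \<doteq> y \<Ztypecolon> Y"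
    using weaken_tm[OF wf y extends_con[OF extends_refl]]
      path_one[OF weaken_tm[OF wf q extends_con[OF extends_refl], unfolded PathC_def sub.simps, OF
        refl]]
    by (simp_all add: sub_norm)
  let ?fs = "[(Pth, r, Zero Pth, wk y), (Pth, r, One Pth, PApp (wk q) (Var 0))]"
  show ?thesis
    unfolding connection_def
  proof (rule hcom[OF Y dim_one i y refl])
    fix k s t N k' s' t' N'
    show "k = k' \<and> (k = Brg \<longrightarrow> t \<in> {Zero Brg, One Brg} \<and> t' = t) \<and>
        (\<Gamma> \<turnstile> DimEq k s s') \<and> (\<Gamma> \<turnstile> DimEq k t t') \<and>
        (DimVar Pth # Con k s t # \<Gamma> \<turnstile> N \<doteq> N' \<Ztypecolon> wk Y) \<and>
        (Con k s t # \<Gamma> \<turnstile> N\<langle>One Pth\<rangle> \<doteq> y \<Ztypecolon> Y)"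
      if "((k, s, t, N), (k', s', t', N')) \<in> set (zip ?fs ?fs)"
      using that base by (auto simp: r dim_zero dim_one N0 N1 extends.intros)
    show "DimVar Pth # Con k s t # Con k' s' t' # \<Gamma> \<turnstile> N \<doteq> N' \<Ztypecolon> wk Y"
      if "(k, s, t, N) \<in> set ?fs" "(k', s', t', N') \<in> set ?fs"
      using that tm_absurd[OF abs(1)] tm_absurd[OF abs(2)] by (auto simp: N0 N1 extends.intros)
  qed
qed

text \<open>The faces at \<open>r = 0\<close> and \<open>r = 1\<close> are the tubes. The face at
  \<open>i = 1\<close> is the base, because the composition starts at \<open>1\<close>.\<close>

lemma connection_boundary:
  assumes wf: "\<Gamma> \<turnstile> Wf" and Y: "\<Gamma> \<turnstile> Ty Large Y" and y: "\<Gamma> \<turnstile> y \<Ztypecolon> Y"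
    and q: "\<Gamma> \<turnstile> q \<Ztypecolon> PathC Y z y"
  shows "\<Gamma> \<turnstile> Dim Pth i \<Longrightarrow> \<Gamma> \<turnstile> connection Y y q (Zero Pth) i \<doteq> y \<Ztypecolon> Y"
    and "\<Gamma> \<turnstile> Dim Pth i \<Longrightarrow> \<Gamma> \<turnstile> connection Y y q (One Pth) i \<doteq> PApp q i \<Ztypecolon> Y"
    and "\<Gamma> \<turnstile> Dim Pth r \<Longrightarrow> \<Gamma> \<turnstile> connection Y y q r (One Pth) \<doteq> y \<Ztypecolon> Y"
proof -
  assume i: "\<Gamma> \<turnstile> Dim Pth i"
  show "\<Gamma> \<turnstile> connection Y y q (Zero Pth) i \<doteq> y \<Ztypecolon> Y"
    using hcom_tube[OF connection[OF assms dim_zero i, unfolded connection_def], of Pth "Zero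
      Pth" "Zero Pth" "wk y"]
    by (simp add: dim_zero connection_def sub_norm)
  show "\<Gamma> \<turnstile> connection Y y q (One Pth) i \<doteq> PApp q i \<Ztypecolon> Y"
    using hcom_tube[OF connection[OF assms dim_one i, unfolded connection_def], of Pth "One
      Pth" "One Pth" "PApp (wk q) (Var 0)"]
    by (simp add: dim_one connection_def sub_norm)
next
  assume r: "\<Gamma> \<turnstile> Dim Pth r"
  show "\<Gamma> \<turnstile> connection Y y q r (One Pth) \<doteq> y \<Ztypecolon> Y"
    using hcom_same[OF connection[OF assms r dim_one, unfolded connection_def] dim_one]
    by (simp add: dim_one connection_def sub_norm)
qed

lemma connection_sub [simp]: "sub \<sigma> (connection Y y q r i) = connection (sub \<sigma> Y) (sub \<sigma> y)
  (sub \<sigma> q) (sub \<sigma> r) (sub \<sigma> i)"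
  by (simp add: connection_def sub_norm)

section \<open>Conversion, composition and reversal of paths\<close>

lemma path_ends:
  assumes "\<Gamma> \<turnstile> u \<doteq> u' \<Ztypecolon> Path A a b"
  shows "\<Gamma> \<turnstile> PApp u (Zero Pth) \<doteq> a \<Ztypecolon> A\<langle>Zero Pth\<rangle>" "\<Gamma> \<turnstile> PApp u (One Pth) \<doteq> b \<Ztypecolon> A\<langle>One Pth\<rangle>"
    "\<Gamma> \<turnstile> a \<Ztypecolon> A\<langle>Zero Pth\<rangle>" "\<Gamma> \<turnstile> b \<Ztypecolon> A\<langle>One Pth\<rangle>"
  using assms by (meson path_zero path_one tm_refl_left tm_refl_right)+

lemma path_conv:
  assumes "\<Gamma> \<turnstile> q \<doteq> q' \<Ztypecolon> Path A M N" "DimVar Pth # \<Gamma> \<turnstile> TyEq Large A A'"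
     "\<Gamma> \<turnstile> M \<doteq> M' \<Ztypecolon> A\<langle>Zero Pth\<rangle>" "\<Gamma> \<turnstile> N \<doteq> N' \<Ztypecolon> A\<langle>One Pth\<rangle>"
  shows "\<Gamma> \<turnstile> q \<doteq> q' \<Ztypecolon> Path A' M' N'"
  using tm_conv[OF assms(1) path_form[OF assms(2-4)]] .

text \<open>Coercing \<open>u\<close> backwards along the line of types
  \<open>Path(a, v @ i)\<close> replaces its right end \<open>b\<close> by \<open>c\<close>. With
  \<open>u\<close> reflexivity this is inversion, and composition follows by inverting
  \<open>v\<close> beforehand.\<close>

lemma path_trans_rev:
  assumes wf: "\<Gamma> \<turnstile> Wf" and T: "\<Gamma> \<turnstile> Ty Large T"
    and u: "\<Gamma> \<turnstile> u \<Ztypecolon> PathC T a b" and v: "\<Gamma> \<turnstile> v \<Ztypecolon> PathC T c b"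
  obtains w where "\<Gamma> \<turnstile> w \<Ztypecolon> PathC T a c"
proof -
  note a = path_ends(3)[OF u[unfolded PathC_def], simplified sub_norm_full]
  note v1 = path_ends[OF v[unfolded PathC_def], simplified sub_norm_full]
  note typing' = typing tm_type_eq[OF u] tm_type_eq[OF v] tm_type_eq[OF a] weaken_tm[OF wf u]
    weaken_tm[OF wf v] weaken_tm[OF wf a]
    weaken_ty[OF wf T]
  let ?L = "Path (wk (wk T)) (wk a) (PApp (wk v) (Var 0))"
  have L: "DimVar Pth # \<Gamma> \<turnstile> Ty Large ?L"
    by (simp add: sub_norm) (rule typing' | simp add: sub_norm)+
  have T': "DimVar Pth # \<Gamma> \<turnstile> Ty Large (wk T)"
    by (simp add: sub_norm) (rule typing' | simp add: sub_norm)+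
  have "\<Gamma> \<turnstile> u \<Ztypecolon> ?L\<langle>One Pth\<rangle>"
    using path_conv[OF u[unfolded PathC_def] T', of a "PApp v (One Pth)"] a v1
    by (simp add: sub_norm tm_sym)
  then have "\<Gamma> \<turnstile> Coe ?L (One Pth) (Zero Pth) u \<Ztypecolon> ?L\<langle>Zero Pth\<rangle>"
    by (intro coe L dim_zero dim_one)
  then have "\<Gamma> \<turnstile> Coe ?L (One Pth) (Zero Pth) u \<Ztypecolon> PathC T a c"
    using path_conv[OF _ T', of _ _ a "PApp v (Zero Pth)" a c] a v1
    by (simp add: sub_norm)
  then show ?thesis by (rule that)
qed

lemma path_refl:
  assumes wf: "\<Gamma> \<turnstile> Wf" and a: "\<Gamma> \<turnstile> a \<doteq> a' \<Ztypecolon> A"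
  shows "\<Gamma> \<turnstile> PLam (wk a) \<doteq> PLam (wk a') \<Ztypecolon> PathC A a a"
proof -
  have a': "\<Gamma> \<turnstile> a' \<doteq> a \<Ztypecolon> A" "\<Gamma> \<turnstile> a \<Ztypecolon> A" using a by (blast intro: tm_sym tm_refl_left)+
  note typing' = typing tm_type_eq[OF a] tm_type_eq[OF a'(1)] tm_type_eq[OF a'(2)]
    weaken_tm[OF wf a]
  show ?thesis by (simp add: sub_norm) (rule typing' | simp add: sub_norm)+
qed

lemma path_trans:
  assumes wf: "\<Gamma> \<turnstile> Wf" and T: "\<Gamma> \<turnstile> Ty Large T"
    and u: "\<Gamma> \<turnstile> u \<Ztypecolon> PathC T a b" and v: "\<Gamma> \<turnstile> v \<Ztypecolon> PathC T b c"
  obtains w where "\<Gamma> \<turnstile> w \<Ztypecolon> PathC T a c"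
proof -
  have "\<Gamma> \<turnstile> c \<Ztypecolon> T" using path_ends(4)[OF v[unfolded PathC_def]] by (simp add: sub_norm)
  from path_trans_rev[OF wf T path_refl[OF wf this] v]
  obtain v' where "\<Gamma> \<turnstile> v' \<Ztypecolon> PathC T c b" .
  from path_trans_rev[OF wf T u this that] show ?thesis .
qed

text \<open>As \<open>r\<close> runs from \<open>0\<close> to \<open>1\<close>, the corner at
  \<open>i = 0\<close> together with this path moves from \<open>y\<close> with reflexivity to
  \<open>z\<close> with \<open>q\<close>, which is the contraction of the type of paths into
  \<open>y\<close>. The left end stays an unreduced \<open>connection\<close> so as to be literally
  the first component of that pair. The judgement for \<open>wk r\<close> is a separate premise
  because the system has no substitution rule for dimension judgements.\<close>

lemma connection_path:
  assumes wf: "\<Gamma> \<turnstile> Wf" and Y: "\<Gamma> \<turnstile> Ty Large Y" and y: "\<Gamma> \<turnstile> y \<Ztypecolon> Y"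
    and q: "\<Gamma> \<turnstile> q \<Ztypecolon> PathC Y z y"
  shows "\<lbrakk>\<Gamma> \<turnstile> Dim Pth r; DimVar Pth # \<Gamma> \<turnstile> Dim Pth (wk r)\<rbrakk>
      \<Longrightarrow> \<Gamma> \<turnstile> PLam (connection (wk Y) (wk y) (wk q) (wk r) (Var 0)) \<Ztypecolon> PathC Y
      (connection Y y q r (Zero Pth)) y"
    and "\<Gamma> \<turnstile> PLam (connection (wk Y) (wk y) (wk q) (Zero Pth) (Var 0)) \<doteq> PLam (wk y)
      \<Ztypecolon> PathC Y (connection Y y q (Zero Pth) (Zero Pth)) y"
    and "\<Gamma> \<turnstile> PLam (connection (wk Y) (wk y) (wk q) (One Pth) (Var 0)) \<doteq> q
      \<Ztypecolon> PathC Y (connection Y y q (One Pth) (Zero Pth)) y"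
proof -
  let ?\<Gamma> = "DimVar Pth # \<Gamma>"
  note w1 = extends_dim[OF extends_refl, of Pth \<Gamma>]
  have dv: "?\<Gamma> \<turnstile> Dim Pth (Var 0)" by (simp add: dim_var)
  have w: "?\<Gamma> \<turnstile> Wf" "?\<Gamma> \<turnstile> Ty Large (wk Y)" "?\<Gamma> \<turnstile> wk y \<Ztypecolon> wk Y"
    "?\<Gamma> \<turnstile> wk q \<Ztypecolon> PathC (wk Y) (wk z) (wk y)"
    using wf_dim[OF wf] weaken_ty[OF wf Y w1] weaken_tm[OF wf y w1] weaken_tm[OF wf q w1]
    by (simp_all add: sub_norm)
  show "\<Gamma> \<turnstile> PLam (connection (wk Y) (wk y) (wk q) (wk r) (Var 0))
    \<Ztypecolon> PathC Y (connection Y y q r (Zero Pth)) y"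
    if r: "\<Gamma> \<turnstile> Dim Pth r" and r': "?\<Gamma> \<turnstile> Dim Pth (wk r)"
    unfolding PathC_def using connection[OF w r' dv] connection[OF wf Y y q r dim_zero]
      connection_boundary(3)[OF wf Y y q r]
    by (intro path_intro) (simp_all add: sub_norm)
  show "\<Gamma> \<turnstile> PLam (connection (wk Y) (wk y) (wk q) (Zero Pth) (Var 0)) \<doteq> PLam (wk y)
      \<Ztypecolon> PathC Y (connection Y y q (Zero Pth) (Zero Pth)) y"
    unfolding PathC_def using connection_boundary(1)[OF w dv]
      connection[OF wf Y y q dim_zero dim_zero] connection_boundary(3)[OF wf Y y q dim_zero]
    by (intro path_intro) (simp_all add: sub_norm)
  have "\<Gamma> \<turnstile> PLam (connection (wk Y) (wk y) (wk q) (One Pth) (Var 0)) \<doteq> PLam (PApp (wk q) (Var 0))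
      \<Ztypecolon> PathC Y (connection Y y q (One Pth) (Zero Pth)) y"
    unfolding PathC_def using connection_boundary(2)[OF w dv]
      connection[OF wf Y y q dim_one dim_zero] connection_boundary(3)[OF wf Y y q dim_one]
    by (intro path_intro) (simp_all add: sub_norm)
  moreover have "\<Gamma> \<turnstile> q \<doteq> PLam (PApp (wk q) (Var 0))
    \<Ztypecolon> PathC Y (connection Y y q (One Pth) (Zero Pth)) y"
    unfolding PathC_def
  proof (rule path_conv[OF path_eta[OF q[unfolded PathC_def]] w(2)])
    show "\<Gamma> \<turnstile> z \<doteq> connection Y y q (One Pth) (Zero Pth) \<Ztypecolon> (wk Y)\<langle>Zero Pth\<rangle>"
      using tm_trans[OF connection_boundary(2)[OF wf Y y q dim_zero]
        path_ends(1)[OF q[unfolded PathC_def], simplified sub_norm_full]]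
      by (simp add: sub_norm tm_sym)
  qed (simp add: sub_norm y)
  ultimately show "\<Gamma> \<turnstile> PLam (connection (wk Y) (wk y) (wk q) (One Pth) (Var 0)) \<doteq> q
      \<Ztypecolon> PathC Y (connection Y y q (One Pth) (Zero Pth)) y" by (blast intro: tm_trans tm_sym)
qed

section \<open>Quasi-inverses\<close>

text \<open>
  The point of the fiber over \<open>y\<close> given by \<open>z\<close> and a path \<open>q\<close> from \<open>z\<close> to \<open>y\<close>: transporting \<open>q\<close>
  backwards along \<open>s z\<close> yields a path from \<open>f (g z)\<close> to \<open>y\<close>.
\<close>

definition fib_point :: "tm \<Rightarrow> tm \<Rightarrow> tm \<Rightarrow> tm \<Rightarrow> tm \<Rightarrow> tm \<Rightarrow> tm" where
  "fib_point B g s y z q = Pair (App g z)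
     (Coe (Path (wk (wk B)) (PApp (App (wk s) (wk z)) (Var 0)) (wk y)) (One Pth) (Zero Pth) q)"

abbreviation (input) RoundTrip :: "tm \<Rightarrow> tm \<Rightarrow> tm \<Rightarrow> tm" where
  "RoundTrip A f g \<equiv> Pi A (PathC (wk A) (App (wk f) (App (wk g) (Var 0))) (Var 0))"

lemma Fiber_form:
  assumes wf: "\<Gamma> \<turnstile> Wf" and A: "\<Gamma> \<turnstile> Ty Large A" and B: "\<Gamma> \<turnstile> Ty Large B"
    and f: "\<Gamma> \<turnstile> f \<Ztypecolon> Arr A B" and y: "\<Gamma> \<turnstile> y \<Ztypecolon> B"
  shows "\<Gamma> \<turnstile> Ty Large (Fiber A B f y)"
proof -
  note typing' = typing tm_type_eq[OF f] tm_type_eq[OF y] weaken_tm[OF wf f] weaken_tm[OF wf y]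
    A B weaken_ty[OF wf A] weaken_ty[OF wf B]
  show ?thesis by (simp add: sub_norm) (rule typing' | simp add: sub_norm)+
qed

text \<open>Stated as a congruence in \<open>z\<close> and \<open>q\<close>, so that the boundary
  equations of \<open>connection_path\<close> carry over to points of the fiber. The ends of
  \<open>s z\<close> are exposed by conversion before the coercion and removed after it.\<close>

lemma fib_point:
  assumes wf: "\<Gamma> \<turnstile> Wf" and A: "\<Gamma> \<turnstile> Ty Large A" and B: "\<Gamma> \<turnstile> Ty Large B"
    and f: "\<Gamma> \<turnstile> f \<Ztypecolon> Arr A B" and g: "\<Gamma> \<turnstile> g \<Ztypecolon> Arr B A"
    and s: "\<Gamma> \<turnstile> s \<Ztypecolon> RoundTrip B f g" and y: "\<Gamma> \<turnstile> y \<Ztypecolon> B"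
    and z: "\<Gamma> \<turnstile> z \<doteq> z' \<Ztypecolon> B" and q: "\<Gamma> \<turnstile> q \<doteq> q' \<Ztypecolon> PathC B z y"
  shows "\<Gamma> \<turnstile> fib_point B g s y z q \<doteq> fib_point B g s y z' q' \<Ztypecolon> Fiber A B f y"
proof -
  note z1 = tm_refl_left[OF z]
  have sz: "\<Gamma> \<turnstile> App s z \<Ztypecolon> PathC B (App f (App g z)) z"
    using pi_elim[OF s z1] by (simp add: sub_norm)
  note e = path_ends[OF sz[unfolded PathC_def], simplified sub_norm_full]
  note typing' = typing tm_type_eq[OF f] tm_type_eq[OF g] tm_type_eq[OF s] tm_type_eq[OF y]
    tm_type_eq[OF z]
    weaken_tm[OF wf f] weaken_tm[OF wf g] weaken_tm[OF wf s] weaken_tm[OF wf y] weaken_tm[OF wf z]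
    tm_type_eq[OF z1] A B weaken_ty[OF wf A] weaken_ty[OF wf B]
  have B1: "DimVar Pth # \<Gamma> \<turnstile> Ty Large (wk B)"
    by (simp add: sub_norm) (rule typing' | simp add: sub_norm)+
  let ?L = "\<lambda>z. Path (wk (wk B)) (PApp (App (wk s) (wk z)) (Var 0)) (wk y)"
  have L: "DimVar Pth # \<Gamma> \<turnstile> TyEq Large (?L z) (?L z')"
    by (simp add: sub_norm) (rule typing' | simp add: sub_norm)+
  have "\<Gamma> \<turnstile> q \<doteq> q' \<Ztypecolon> (?L z)\<langle>One Pth\<rangle>"
    using path_conv[OF q[unfolded PathC_def] B1, of "PApp (App s z) (One Pth)" y] y e
    by (simp add: sub_norm tm_sym)
  from coe[OF L dim_one dim_zero this]
  have "\<Gamma> \<turnstile> Coe (?L z) (One Pth) (Zero Pth) q \<doteq> Coe (?L z') (One Pth) (Zero Pth) q'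
    \<Ztypecolon> PathC B (App f (App g z)) y"
    using path_conv[OF _ B1, of _ _ "PApp (App s z) (Zero Pth)" y "App f (App g z)" y] y e
    by (simp add: sub_norm)
  note typing'' = tm_type_eq[OF this[simplified sub_norm_full]] typing'
  show ?thesis unfolding fib_point_def
    by (simp add: sub_norm) (rule typing'' | simp add: sub_norm)+
qed

lemma fiber_pair:
  assumes wf: "\<Gamma> \<turnstile> Wf" and A: "\<Gamma> \<turnstile> Ty Large A" and B: "\<Gamma> \<turnstile> Ty Large B"
    and f: "\<Gamma> \<turnstile> f \<Ztypecolon> Arr A B" and y: "\<Gamma> \<turnstile> y \<Ztypecolon> B"
    and x: "\<Gamma> \<turnstile> x \<doteq> x' \<Ztypecolon> A" and p: "\<Gamma> \<turnstile> p \<doteq> p' \<Ztypecolon> PathC B (App f x) y"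
  shows "\<Gamma> \<turnstile> Pair x p \<doteq> Pair x' p' \<Ztypecolon> Fiber A B f y"
proof -
  note typing' = tm_type_eq[OF x] tm_type_eq[OF p[simplified sub_norm_full]] typing
    weaken_tm[OF wf f] weaken_tm[OF wf y]  A B weaken_ty[OF wf A] weaken_ty[OF wf B]
  show ?thesis by (simp add: sub_norm) (rule typing' | simp add: sub_norm)+
qed

text \<open>
  The fiber of \<open>f\<close> over \<open>y\<close> is a retract of \<open>\<Sigma>z. Path(z, y)\<close> by way of \<open>\<Sigma>z. Path(f (g z), y)\<close>. A
  point \<open>(x, p)\<close> is first moved along \<open>t x\<close> to \<open>(g (f x), ?p)\<close>, then along \<open>s (f x)\<close> to the image
  of \<open>(f x, ?q)\<close>; the contraction of \<open>\<Sigma>z. Path(z, y)\<close> connects the latter with the center.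
\<close>

lemma fiber_path:
  assumes wf: "\<Gamma> \<turnstile> Wf" and A: "\<Gamma> \<turnstile> Ty Large A" and B: "\<Gamma> \<turnstile> Ty Large B"
    and f: "\<Gamma> \<turnstile> f \<Ztypecolon> Arr A B" and g: "\<Gamma> \<turnstile> g \<Ztypecolon> Arr B A"
    and s: "\<Gamma> \<turnstile> s \<Ztypecolon> RoundTrip B f g" and t: "\<Gamma> \<turnstile> t \<Ztypecolon> RoundTrip A g f" and y: "\<Gamma> \<turnstile> y \<Ztypecolon> B"
    and x: "\<Gamma> \<turnstile> x \<Ztypecolon> A" and p: "\<Gamma> \<turnstile> p \<Ztypecolon> PathC B (App f x) y"
  obtains w where "\<Gamma> \<turnstile> w \<Ztypecolon> PathC (Fiber A B f y) (fib_point B g s y y (PLam (wk y))) (Pair x p)"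
proof -
  let ?\<Gamma> = "DimVar Pth # \<Gamma>"
  have wf': "?\<Gamma> \<turnstile> Wf" by (rule wf_dim[OF wf])
  have F: "\<Gamma> \<turnstile> Ty Large (Fiber A B f y)" by (rule Fiber_form[OF wf A B f y])
  have tx: "\<Gamma> \<turnstile> App t x \<Ztypecolon> PathC A (App g (App f x)) x"
    using pi_elim[OF t x] by (simp add: sub_norm)
  have fx: "\<Gamma> \<turnstile> App f x \<Ztypecolon> B" using pi_elim[OF f[unfolded Arr_def] x] by (simp add: sub_norm)
  have gfx: "\<Gamma> \<turnstile> App g (App f x) \<Ztypecolon> A" using pi_elim[OF g[unfolded Arr_def] fx]
    by (simp add: sub_norm)
  have sfx: "\<Gamma> \<turnstile> App s (App f x) \<Ztypecolon> PathC B (App f (App g (App f x))) (App f x)"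
    using pi_elim[OF s fx] by (simp add: sub_norm)
  note et = path_ends[OF tx[unfolded PathC_def], simplified sub_norm_full]
  note es = path_ends[OF sfx[unfolded PathC_def], simplified sub_norm_full]
  have fe: "\<Gamma> \<turnstile> App f (PApp (App t x) (Zero Pth)) \<doteq> App f (App g (App f x)) \<Ztypecolon> B"
     "\<Gamma> \<turnstile> App f (PApp (App t x) (One Pth)) \<doteq> App f x \<Ztypecolon> B"
    using pi_elim[OF f[unfolded Arr_def] et(1)] pi_elim[OF f[unfolded Arr_def] et(2)]
    by (simp_all add: sub_norm)
  note typing' = typing tm_type_eq[OF f] tm_type_eq[OF g] tm_type_eq[OF s] tm_type_eq[OF t]
    tm_type_eq[OF y] tm_type_eq[OF x] tm_type_eq[OF p]
    weaken_tm[OF wf f] weaken_tm[OF wf g] weaken_tm[OF wf s] weaken_tm[OF wf t] weaken_tm[OF wf y]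
    weaken_tm[OF wf x] weaken_tm[OF wf p] A B weaken_ty[OF wf A] weaken_ty[OF wf B]
  have B1: "?\<Gamma> \<turnstile> Ty Large (wk B)" and B2: "DimVar Pth # ?\<Gamma> \<turnstile> Ty Large (wk (wk B))"
    by (simp add: sub_norm, (rule typing' | simp add: sub_norm)+)+
  \<comment> \<open>Two lines of types of paths into \<open>y\<close>. The left end of
    \<open>?K\<close> follows \<open>f\<close> applied to \<open>t x\<close>, that of
    \<open>?L\<close> follows \<open>s (f x)\<close>; both lead from \<open>f (g (f x))\<close> to
    \<open>f x\<close>.\<close>
  let ?K = "Path (wk (wk B)) (App (wk f) (PApp (App (wk t) (wk x)) (Var 0))) (wk y)"
  let ?L = "Path (wk (wk B)) (PApp (App (wk s) (App (wk f) (wk x))) (Var 0)) (wk y)"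
  have K: "?\<Gamma> \<turnstile> Ty Large ?K" and L: "?\<Gamma> \<turnstile> Ty Large ?L"
    by (simp add: sub_norm, (rule typing' | simp add: sub_norm)+)+
  let ?p = "Coe ?K (One Pth) (Zero Pth) p"
  have p1: "\<Gamma> \<turnstile> p \<Ztypecolon> ?K\<langle>One Pth\<rangle>"
    using path_conv[OF p[unfolded PathC_def] B1, of "App f (PApp (App t x) (One Pth))" y] fe y
    by (simp add: sub_norm tm_sym)
  note p'' = coe[OF K dim_one dim_zero this]
  from p'' have p': "\<Gamma> \<turnstile> ?p \<Ztypecolon> PathC B (App f (App g (App f x))) y"
    using path_conv[OF _ B1, of _ _ "App f (PApp (App t x) (Zero Pth))" y
      "App f (App g (App f x))" y] fe y
    by (simp add: sub_norm)
  have p'0: "\<Gamma> \<turnstile> ?p \<Ztypecolon> ?L\<langle>Zero Pth\<rangle>"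
    using path_conv[OF p'[unfolded PathC_def] B1, of "PApp (App s (App f x)) (Zero Pth)" y] es y
    by (simp add: sub_norm tm_sym)
  let ?q = "Coe ?L (Zero Pth) (One Pth) ?p"
  have q: "\<Gamma> \<turnstile> ?q \<Ztypecolon> PathC B (App f x) y"
    using path_conv[OF _ B1, of _ _ "PApp (App s (App f x)) (One Pth)" y "App f x" y]
      coe[OF L dim_zero dim_one p'0] es y
    by (simp add: sub_norm)
  let ?N = "Pair (App g (App f x)) ?p"
  let ?F = "Fiber (wk A) (wk B) (wk f) (wk y)"
  note w1 = extends_dim[OF extends_refl, of Pth \<Gamma>]
  have dv: "?\<Gamma> \<turnstile> Dim Pth (Var 0)" by (simp add: dim_var)
  have w: "?\<Gamma> \<turnstile> Ty Large (wk A)" "?\<Gamma> \<turnstile> wk f \<Ztypecolon> Arr (wk A) (wk B)" "?\<Gamma> \<turnstile> wk y \<Ztypecolon> wk B"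
    "?\<Gamma> \<turnstile> wk g \<Ztypecolon> Arr (wk B) (wk A)" "?\<Gamma> \<turnstile> wk s \<Ztypecolon> RoundTrip (wk B) (wk f) (wk g)"
    "?\<Gamma> \<turnstile> wk (App f x) \<Ztypecolon> wk B"
    using weaken_ty[OF wf A w1] weaken_tm[OF wf f w1] weaken_tm[OF wf y w1] weaken_tm[OF wf g w1]
     weaken_tm[OF wf s w1] weaken_tm[OF wf fx w1] by (simp_all add: sub_norm)
  note fib = fiber_pair[OF wf A B f y] fiber_pair[OF wf' w(1) B1 w(2,3)]
  note fp = fib_point[OF wf A B f g s y] fib_point[OF wf' w(1) B1 w(2,4,5,3)]
  have K': "DimVar Pth # ?\<Gamma> \<turnstile> Ty Large (ren (upr Suc) ?K)"
    and L': "DimVar Pth # ?\<Gamma> \<turnstile> Ty Large (ren (upr Suc) ?L)"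
    by (simp add: sub_norm, (rule typing' | simp add: sub_norm)+)+
  \<comment> \<open>The path \<open>p\<close> is coerced only as far as the current point of
    \<open>?K\<close>. At \<open>0\<close> this is \<open>?p\<close>; at \<open>1\<close> it is
    \<open>p\<close>, since a coercion from \<open>1\<close> to \<open>1\<close> is trivial.\<close>
  let ?h2 = "Pair (PApp (App (wk t) (wk x)) (Var 0)) (Coe (ren (upr Suc) ?K) (One Pth) (Var 0)
    (wk p))"
  have h2: "\<Gamma> \<turnstile> PLam ?h2 \<Ztypecolon> PathC (Fiber A B f y) ?N (Pair x p)"
    unfolding PathC_def
  proof (rule path_intro)
    have "?\<Gamma> \<turnstile> Coe (ren (upr Suc) ?K) (One Pth) (Var 0) (wk p) \<Ztypecolon> (ren (upr Suc) ?K)\<langle>Var 0\<rangle>"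
      using weaken_tm[OF wf p1 w1] by (intro coe K' dim_one dim_var) (simp_all add: sub_norm)
    then have "?\<Gamma> \<turnstile> ?h2 \<Ztypecolon> ?F"
      by (intro fib) (simp_all add: sub_norm, (rule typing' | simp add: sub_norm)+)
    then show "?\<Gamma> \<turnstile> ?h2 \<Ztypecolon> wk (Fiber A B f y)" by (simp add: sub_norm)
    have "\<Gamma> \<turnstile> Pair (PApp (App t x) (Zero Pth)) ?p \<doteq> ?N \<Ztypecolon> Fiber A B f y"
      using p'' by (intro fib et) (simp add: sub_norm)
    then show "\<Gamma> \<turnstile> ?h2\<langle>Zero Pth\<rangle> \<doteq> ?N \<Ztypecolon> (wk (Fiber A B f y))\<langle>Zero Pth\<rangle>"
      by (simp add: sub_norm)
    have "\<Gamma> \<turnstile> Pair (PApp (App t x) (One Pth)) (Coe ?K (One Pth) (One Pth) p) \<doteq> Pair x p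
      \<Ztypecolon> Fiber A B f y"
      using coe_same[OF K dim_one p1] by (intro fib et) (simp add: sub_norm)
    then show "\<Gamma> \<turnstile> ?h2\<langle>One Pth\<rangle> \<doteq> Pair x p \<Ztypecolon> (wk (Fiber A B f y))\<langle>One Pth\<rangle>"
      by (simp add: sub_norm)
  qed
  \<comment> \<open>The coercion runs along \<open>?L\<close> out to the current point and back to
    \<open>0\<close>. At \<open>0\<close> both coercions are trivial; at \<open>1\<close> the
    composite is the second component of \<open>fib_point\<close> at \<open>?q\<close>.\<close>
  let ?h1 = "Pair (wk (App g (App f x))) (Coe (ren (upr Suc) ?L) (Var 0) (Zero Pth)
    (Coe (ren (upr Suc) ?L) (Zero Pth) (Var 0) (wk ?p)))"
  have h1: "\<Gamma> \<turnstile> PLam ?h1 \<Ztypecolon> PathC (Fiber A B f y) ?N (fib_point B g s y (App f x) ?q)"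
    unfolding PathC_def
  proof (rule path_intro)
    have "?\<Gamma> \<turnstile> Coe (ren (upr Suc) ?L) (Zero Pth) (Var 0) (wk ?p) \<Ztypecolon> (ren (upr Suc) ?L)\<langle>Var 0\<rangle>"
      using weaken_tm[OF wf p'0 w1] by (intro coe L' dim_zero dv) (simp add: sub_norm)
    from coe[OF L' dv dim_zero this]
    have "?\<Gamma> \<turnstile> Coe (ren (upr Suc) ?L) (Var 0) (Zero Pth) (Coe (ren (upr Suc) ?L) (Zero Pth) (Var 0)
      (wk ?p))
      \<Ztypecolon> PathC (wk B) (App (wk f) (wk (App g (App f x)))) (wk y)"
      using path_conv[OF _ B2, of _ _ "wk (PApp (App s (App f x)) (Zero Pth))" "wk y" "wk
        (App f (App g (App f x)))" "wk y"]
        weaken_tm[OF wf es(1) w1] w(3) by (simp add: sub_norm)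
    then have "?\<Gamma> \<turnstile> ?h1 \<Ztypecolon> ?F"
      using weaken_tm[OF wf gfx w1] by (intro fib) (simp_all add: sub_norm)
    then show "?\<Gamma> \<turnstile> ?h1 \<Ztypecolon> wk (Fiber A B f y)" by (simp add: sub_norm)
    have c: "\<Gamma> \<turnstile> Coe ?L (Zero Pth) (Zero Pth) ?p \<doteq> ?p \<Ztypecolon> ?L\<langle>Zero Pth\<rangle>"
      by (rule coe_same[OF L dim_zero p'0])
    have "\<Gamma> \<turnstile> Coe ?L (Zero Pth) (Zero Pth) (Coe ?L (Zero Pth) (Zero Pth) ?p) \<doteq> ?p \<Ztypecolon> ?L\<langle>Zero Pth\<rangle>"
      by (rule tm_trans[OF coe_same[OF L dim_zero tm_refl_left[OF c]] c])
    then have "\<Gamma> \<turnstile> Coe ?L (Zero Pth) (Zero Pth) (Coe ?L (Zero Pth) (Zero Pth) ?p) \<doteq> ?p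
      \<Ztypecolon> PathC B (App f (App g (App f x))) y"
      using path_conv[OF _ B1, of _ _ "PApp (App s (App f x)) (Zero Pth)" y "App f
        (App g (App f x))" y] es y
      by (simp add: sub_norm)
    from fib(1)[OF gfx this] show "\<Gamma> \<turnstile> ?h1\<langle>Zero Pth\<rangle> \<doteq> ?N \<Ztypecolon> (wk (Fiber A B f y))\<langle>Zero Pth\<rangle>"
      by (simp add: sub_norm)
    show "\<Gamma> \<turnstile> ?h1\<langle>One Pth\<rangle> \<doteq> fib_point B g s y (App f x) ?q \<Ztypecolon> (wk (Fiber A B f y))\<langle>One Pth\<rangle>"
      using fp(1)[OF fx q] by (simp add: sub_norm fib_point_def)
  qed
  \<comment> \<open>The contraction is fed pointwise into \<open>fib_point\<close>. In the inner
    path \<open>Var 1\<close> is the parameter of the contraction and \<open>Var 0\<close> the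
    variable of the contracted path.\<close>
  let ?h0 = "fib_point (wk B) (wk g) (wk s) (wk y) (connection (wk B) (wk y) (wk ?q) (Var 0)
    (Zero Pth))
    (PLam (connection (wk (wk B)) (wk (wk y)) (wk (wk ?q)) (Var 1) (Var 0)))"
  have h0: "\<Gamma> \<turnstile> PLam ?h0 \<Ztypecolon> PathC (Fiber A B f y) (fib_point B g s y y (PLam (wk y)))
    (fib_point B g s y (App f x) ?q)"
    unfolding PathC_def
  proof (rule path_intro)
    have wq: "?\<Gamma> \<turnstile> wk ?q \<Ztypecolon> PathC (wk B) (wk (App f x)) (wk y)"
      using weaken_tm[OF wf q w1] by (simp add: sub_norm)
    have "?\<Gamma> \<turnstile> ?h0 \<Ztypecolon> ?F"
      using fp(2)[OF connection[OF wf' B1 w(3) wq dv dim_zero] connection_path(1)[OF wf' B1 w(3) wq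
        dv]]
      by (simp add: ren.simps dim_var)
    then show "?\<Gamma> \<turnstile> ?h0 \<Ztypecolon> wk (Fiber A B f y)" by (simp add: sub_norm)
    have "\<Gamma> \<turnstile> PApp ?q (Zero Pth) \<doteq> App f x \<Ztypecolon> B"
      using path_ends(1)[OF q[unfolded PathC_def]] by (simp add: sub_norm)
    note e1 = tm_trans[OF connection_boundary(2)[OF wf B y q dim_zero] this]
    show "\<Gamma> \<turnstile> ?h0\<langle>Zero Pth\<rangle> \<doteq> fib_point B g s y y (PLam (wk y)) \<Ztypecolon> (wk (Fiber A B f y))\<langle>Zero Pth\<rangle>"
      using fp(1)[OF connection_boundary(1)[OF wf B y q dim_zero] connection_path(2)[OF wf B y q]]
      by (simp add: sub_norm fib_point_def)
    show "\<Gamma> \<turnstile> ?h0\<langle>One Pth\<rangle> \<doteq> fib_point B g s y (App f x) ?q \<Ztypecolon> (wk (Fiber A B f y))\<langle>One Pth\<rangle>"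
      using fp(1)[OF e1 connection_path(3)[OF wf B y q]] by (simp add: sub_norm fib_point_def)
  qed
  \<comment> \<open>Both \<open>h0\<close> and \<open>h1\<close> end at the image of
    \<open>(f x, ?q)\<close>, so \<open>h1\<close> is traversed backwards to reach
    \<open>?N\<close>.\<close>
  from path_trans_rev[OF wf F h0 h1] obtain h01 where
    "\<Gamma> \<turnstile> h01 \<Ztypecolon> PathC (Fiber A B f y) (fib_point B g s y y (PLam (wk y))) ?N" .
  from path_trans[OF wf F this h2 that] show ?thesis .
qed

section \<open>Contractibility of the fibers\<close>

lemma isContr_body_form:
  assumes wf: "\<Gamma> \<turnstile> Wf" and A: "\<Gamma> \<turnstile> Ty Large A"
  shows "TmVar A # \<Gamma> \<turnstile> Ty Large (Pi (wk A) (PathC (wk (wk A)) (Var 1) (Var 0)))"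
proof -
  note typing' = typing A weaken_ty[OF wf A]
  show ?thesis by (simp add: sub_norm) (rule typing' | simp add: sub_norm)+
qed

lemma isEquiv_form:
  assumes wf: "\<Gamma> \<turnstile> Wf" and A: "\<Gamma> \<turnstile> Ty Large A" and B: "\<Gamma> \<turnstile> Ty Large B"
    and f: "\<Gamma> \<turnstile> f \<Ztypecolon> Arr A B"
  shows "\<Gamma> \<turnstile> Ty Large (isEquiv A B f)"
proof -
  note typing' = typing A weaken_ty[OF wf A] B weaken_ty[OF wf B] weaken_tm[OF wf f]
  show ?thesis by (simp add: sub_norm) (rule typing' | simp add: sub_norm)+
qed

text \<open>Applied to the generic point of the generic fiber, \<open>fiber_path\<close> is the
  contraction. No triangle identity between \<open>s\<close> and \<open>t\<close> enters: the two
  paths from \<open>f (g (f x))\<close> to \<open>f x\<close> are used one after the other, never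
  identified.\<close>

lemma qinv_isEquiv:
  assumes wf: "\<Gamma> \<turnstile> Wf" and A: "\<Gamma> \<turnstile> Ty Large A" and B: "\<Gamma> \<turnstile> Ty Large B"
    and f: "\<Gamma> \<turnstile> f \<Ztypecolon> Arr A B" and g: "\<Gamma> \<turnstile> g \<Ztypecolon> Arr B A"
    and s: "\<Gamma> \<turnstile> s \<Ztypecolon> RoundTrip B f g" and t: "\<Gamma> \<turnstile> t \<Ztypecolon> RoundTrip A g f"
  obtains E where "\<Gamma> \<turnstile> E \<Ztypecolon> isEquiv A B f"
proof -
  let ?\<Gamma> = "TmVar B # \<Gamma>"
  note w1 = extends_tm[OF extends_refl, of B \<Gamma>]
  have w: "?\<Gamma> \<turnstile> Wf" "?\<Gamma> \<turnstile> Ty Large (wk A)" "?\<Gamma> \<turnstile> Ty Large (wk B)" "?\<Gamma> \<turnstile> wk f \<Ztypecolon> Arr (wk A) (wk B)"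
    "?\<Gamma> \<turnstile> wk g \<Ztypecolon> Arr (wk B) (wk A)" "?\<Gamma> \<turnstile> wk s \<Ztypecolon> RoundTrip (wk B) (wk f) (wk g)"
    "?\<Gamma> \<turnstile> wk t \<Ztypecolon> RoundTrip (wk A) (wk g) (wk f)" "?\<Gamma> \<turnstile> Var 0 \<Ztypecolon> wk B"
    using wf_tm[OF wf B] weaken_ty[OF wf A w1] weaken_ty[OF wf B w1] weaken_tm[OF wf f w1]
      weaken_tm[OF wf g w1]
     weaken_tm[OF wf s w1] weaken_tm[OF wf t w1] tm_var[of ?\<Gamma> 0 "wk B"] by (simp_all add: sub_norm)
  let ?F = "Fiber (wk A) (wk B) (wk f) (Var 0)"
  let ?ctr = "fib_point (wk B) (wk g) (wk s) (Var 0) (Var 0) (PLam (wk (Var 0)))"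
  have F: "?\<Gamma> \<turnstile> Ty Large ?F" by (rule Fiber_form[OF w(1-4,8)])
  have ctr: "?\<Gamma> \<turnstile> ?ctr \<Ztypecolon> ?F"
    by (rule fib_point[OF w(1-6,8) w(8) path_refl[OF w(1,8)]])
  let ?\<Delta> = "TmVar ?F # ?\<Gamma>"
  note w2 = extends_tm[OF extends_refl, of ?F ?\<Gamma>]
  have v: "?\<Delta> \<turnstile> Wf" "?\<Delta> \<turnstile> Ty Large (wk (wk A))" "?\<Delta> \<turnstile> Ty Large (wk (wk B))"
    "?\<Delta> \<turnstile> wk (wk f) \<Ztypecolon> Arr (wk (wk A)) (wk (wk B))"
    "?\<Delta> \<turnstile> wk (wk g) \<Ztypecolon> Arr (wk (wk B)) (wk (wk A))"
    "?\<Delta> \<turnstile> wk (wk s) \<Ztypecolon> RoundTrip (wk (wk B)) (wk (wk f)) (wk (wk g))"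
    "?\<Delta> \<turnstile> wk (wk t) \<Ztypecolon> RoundTrip (wk (wk A)) (wk (wk g)) (wk (wk f))" "?\<Delta> \<turnstile> Var 1 \<Ztypecolon> wk (wk B)"
    using wf_tm[OF w(1) F] weaken_ty[OF w(1,2) w2] weaken_ty[OF w(1,3) w2] weaken_tm[OF w(1,4) w2]
      weaken_tm[OF w(1,5) w2]
     weaken_tm[OF w(1,6) w2] weaken_tm[OF w(1,7) w2] tm_var[of ?\<Delta> 1 "wk (wk B)"]
       by (simp_all add: sub_norm)
  have z': "?\<Delta> \<turnstile> Var 0 \<Ztypecolon> Sig (wk (wk A)) (PathC (wk (wk (wk B))) (App (wk (wk (wk f))) (Var 0))
    (wk (Var 1)))"
    by (rule tm_var) (simp add: sub_norm)
  note xp = sig_fst[OF z'] sig_snd[OF z']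
  have p: "?\<Delta> \<turnstile> Snd (Var 0) \<Ztypecolon> PathC (wk (wk B)) (App (wk (wk f)) (Fst (Var 0))) (Var 1)"
    using xp(2) by (simp add: sub_norm)
  let ?zc = "fib_point (wk (wk B)) (wk (wk g)) (wk (wk s)) (Var 1) (Var 1) (PLam (wk (Var 1)))"
  let ?G = "Fiber (wk (wk A)) (wk (wk B)) (wk (wk f)) (Var 1)"
  have G: "?\<Delta> \<turnstile> Ty Large ?G" by (rule Fiber_form[OF v(1-4,8)])
  obtain w where W: "?\<Delta> \<turnstile> w \<Ztypecolon> PathC ?G ?zc (Pair (Fst (Var 0)) (Snd (Var 0)))"
    by (rule fiber_path[OF v xp(1) p])
  have zc: "?\<Delta> \<turnstile> ?zc \<Ztypecolon> ?G" using weaken_tm[OF w(1) ctr w2] by (simp add: sub_norm fib_point_def)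
  have "DimVar Pth # ?\<Delta> \<turnstile> Ty Large (wk ?G)" using weaken_ty[OF v(1) G extends_dim[OF extends_refl]]
    by (simp add: sub_norm)
  \<comment> \<open>The path obtained ends at the eta-expansion of the fiber variable; eta for pairs
    makes it end at the variable itself.\<close>
  from path_conv[OF W[unfolded PathC_def] this, of ?zc "Var 0"]
  have W': "?\<Delta> \<turnstile> w \<Ztypecolon> PathC ?G ?zc (Var 0)"
    using zc tm_sym[OF sig_eta[OF z']] by (simp add: sub_norm)
  have "?\<Gamma> \<turnstile> Pair ?ctr (Lam w) \<Ztypecolon> isContr ?F"
    unfolding isContr_def
  proof (rule sig_intro[OF _ ctr])
    let ?P = "Pi (wk ?F) (PathC (wk (wk ?F)) (Var 1) (Var 0))"
    show "?\<Delta> \<turnstile> Ty Large ?P" by (rule isContr_body_form[OF w(1) F])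
    show "?\<Gamma> \<turnstile> Lam w \<Ztypecolon> ?P\<langle>?ctr\<rangle>"
      using pi_intro[OF F W'] by (simp add: sub_norm fib_point_def)
  qed
  from pi_intro[OF B this] have "\<Gamma> \<turnstile> Lam (Pair ?ctr (Lam w)) \<Ztypecolon> isEquiv A B f"
    by (simp add: isEquiv_def)
  then show ?thesis by (rule that)
qed

section \<open>Univalence for quasi-inverses\<close>

text \<open>
  Deriving the equivalence once, in the generic context \<open>A, B, f, g, s, t\<close>, makes its proof a term
  former that respects equality in all six arguments, by the substitution rule.
\<close>

definition qinv_ctx :: ctx where
  "qinv_ctx = [TmVar (RoundTrip (Var 4) (Var 1) (Var 2)), TmVar (RoundTrip (Var 2) (Var 1) (Var 0)),
     TmVar (Arr (Var 1) (Var 2)), TmVar (Arr (Var 1) (Var 0)), TmVar U, TmVar U]"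

lemma qinv_ctx: "qinv_ctx \<turnstile> Wf" "\<exists>E. qinv_ctx \<turnstile> E \<Ztypecolon> isEquiv (Var 5) (Var 4) (Var 3)"
proof -
  show wf: "qinv_ctx \<turnstile> Wf"
    unfolding qinv_ctx_def
    by (simp add: sub_norm) (rule typing wf_nil wf_tm ty_of_univ | simp add: sub_norm)+
  have "qinv_ctx \<turnstile> Ty Large (Var 5)" "qinv_ctx \<turnstile> Ty Large (Var 4)"
    "qinv_ctx \<turnstile> Var 3 \<Ztypecolon> Arr (Var 5) (Var 4)"
    "qinv_ctx \<turnstile> Var 2 \<Ztypecolon> Arr (Var 4) (Var 5)"
    "qinv_ctx \<turnstile> Var 1 \<Ztypecolon> RoundTrip (Var 4) (Var 3) (Var 2)"
    "qinv_ctx \<turnstile> Var 0 \<Ztypecolon> RoundTrip (Var 5) (Var 2) (Var 3)"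
    unfolding qinv_ctx_def
    by (simp_all add: sub_norm) (rule typing ty_of_univ | simp add: sub_norm)+
  then show "\<exists>E. qinv_ctx \<turnstile> E \<Ztypecolon> isEquiv (Var 5) (Var 4) (Var 3)"
    by (rule qinv_isEquiv[OF wf]) (rule exI)
qed

text \<open>Only the existence of a proof term is available, so one is fixed by choice. Every later
  use is a substitution instance of this single term.\<close>

definition qinv_tm :: tm where
  "qinv_tm = (SOME E. qinv_ctx \<turnstile> E \<Ztypecolon> isEquiv (Var 5) (Var 4) (Var 3))"

lemma qinv_tm: "qinv_ctx \<turnstile> qinv_tm \<Ztypecolon> isEquiv (Var 5) (Var 4) (Var 3)"
  unfolding qinv_tm_def by (rule someI_ex[OF qinv_ctx(2)])

text \<open>
  Only the six variables of \<open>qinv_ctx\<close> matter. The constant tail \<open>U\<close> makes \<open>qinv\<close> commute with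
  substitution on the nose.
\<close>

definition qinv :: "tm \<Rightarrow> tm \<Rightarrow> tm \<Rightarrow> tm \<Rightarrow> tm \<Rightarrow> tm \<Rightarrow> tm" where
  "qinv A B f g s t = sub (t \<bullet> s \<bullet> g \<bullet> f \<bullet> B \<bullet> A \<bullet> (\<lambda>_. U)) qinv_tm"

lemma qinv_sub [simp]:
  "sub \<sigma> (qinv A B f g s t) = qinv (sub \<sigma> A) (sub \<sigma> B) (sub \<sigma> f) (sub \<sigma> g) (sub \<sigma> s) (sub \<sigma> t)"
  by (simp add: qinv_def sub_norm)

lemma qinv:
  assumes "\<Gamma> \<turnstile> A \<doteq> A' \<Ztypecolon> U" "\<Gamma> \<turnstile> B \<doteq> B' \<Ztypecolon> U" "\<Gamma> \<turnstile> f \<doteq> f' \<Ztypecolon> Arr A B" "\<Gamma> \<turnstile> g \<doteq> g' \<Ztypecolon> Arr B A"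
    "\<Gamma> \<turnstile> s \<doteq> s' \<Ztypecolon> RoundTrip B f g" "\<Gamma> \<turnstile> t \<doteq> t' \<Ztypecolon> RoundTrip A g f"
  shows "\<Gamma> \<turnstile> qinv A B f g s t \<doteq> qinv A' B' f' g' s' t' \<Ztypecolon> isEquiv A B f"
proof -
  have cS: "case_nat x \<sigma> \<circ> Suc = \<sigma>" for x :: tm and \<sigma> by (simp add: fun_eq_iff)
  have "\<Gamma> \<turnstile> SubEq (t \<bullet> s \<bullet> g \<bullet> f \<bullet> B \<bullet> A \<bullet> (\<lambda>_. U)) (t' \<bullet> s' \<bullet> g' \<bullet> f' \<bullet> B' \<bullet> A' \<bullet> (\<lambda>_. U))
    qinv_ctx"
    unfolding qinv_ctx_def
    by (intro sub_tm sub_nil) (use assms in \<open>simp_all add: cS sub_norm\<close>)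
  from tm_sub[OF qinv_ctx(1) this qinv_tm] show ?thesis
    by (simp add: qinv_def sub_norm)
qed

section \<open>Quasi-inverses given by lambda-abstractions\<close>

lemma lam_beta:
  assumes "\<Gamma> \<turnstile> Ty Large A" "TmVar A # \<Gamma> \<turnstile> F \<Ztypecolon> B" "\<Gamma> \<turnstile> M \<doteq> M' \<Ztypecolon> A" "C = B\<langle>M'\<rangle>"
  shows "\<Gamma> \<turnstile> App (Lam F) M \<doteq> F\<langle>M'\<rangle> \<Ztypecolon> C"
proof -
  have "\<Gamma> \<turnstile> App (Lam F) M' \<doteq> App (Lam F) M \<Ztypecolon> B\<langle>M'\<rangle>"
    by (rule pi_elim[OF pi_intro[OF assms(1,2)] tm_sym[OF assms(3)]])
  with pi_beta[OF assms(2) tm_refl_right[OF assms(3)]] show ?thesis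
    unfolding assms(4) by (blast intro: tm_trans tm_sym)
qed

lemma weaken_under_tm:
  assumes wf: "\<Gamma> \<turnstile> Wf" and A: "\<Gamma> \<turnstile> Ty Large A" and F: "TmVar A # \<Gamma> \<turnstile> F \<doteq> F' \<Ztypecolon> B"
      and e: "extends k \<Delta> \<Gamma>"
  shows "TmVar (sub (shift k) A) # \<Delta> \<turnstile> sub (Var 0 \<bullet> shift (Suc k)) F
      \<doteq> sub (Var 0 \<bullet> shift (Suc k)) F' \<Ztypecolon> sub (Var 0 \<bullet> shift (Suc k)) B"
proof (rule tm_sub[OF wf_tm[OF wf A] _ F])
  have "case_nat (Var 0) (shift (Suc k)) \<circ> Suc = shift (Suc k)" by (simp add: fun_eq_iff)
  then show "TmVar (sub (shift k) A) # \<Delta> \<turnstile> SubEq (Var 0 \<bullet> shift (Suc k)) (Var 0 \<bullet> shift (Suc k))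
    (TmVar A # \<Gamma>)"
    using shift_SubEq[OF extends_tm[OF e]] by (intro sub_tm) (simp_all add: tm_var sub_norm)
qed

text \<open>The two beta steps of a roundtrip are done here once and for all; what remains is to
  connect the body of \<open>F\<close> at \<open>G\<close> with the variable. The congruence in
  \<open>w\<close> is used where roundtrip proofs become constant paths at the ends of a
  line.\<close>

lemma lam_RoundTrip:
  assumes wf: "\<Gamma> \<turnstile> Wf" and A: "\<Gamma> \<turnstile> Ty Large A" and B: "\<Gamma> \<turnstile> Ty Large B"
    and F: "TmVar A # \<Gamma> \<turnstile> F \<Ztypecolon> wk B" and G: "TmVar B # \<Gamma> \<turnstile> G \<Ztypecolon> wk A"
    and w: "TmVar B # \<Gamma> \<turnstile> w \<doteq> w' \<Ztypecolon> PathC (wk B) (sub (G \<bullet> shift (Suc 0)) F) (Var 0)"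
  shows "\<Gamma> \<turnstile> Lam w \<doteq> Lam w' \<Ztypecolon> RoundTrip B (Lam F) (Lam G)"
proof -
  let ?\<Gamma> = "TmVar B # \<Gamma>"
  note w1 = extends_tm[OF extends_refl, of B \<Gamma>]
  have wA: "?\<Gamma> \<turnstile> Ty Large (wk A)" "?\<Gamma> \<turnstile> Ty Large (wk B)" "?\<Gamma> \<turnstile> Var 0 \<Ztypecolon> wk B"
    using weaken_ty[OF wf A w1] weaken_ty[OF wf B w1] tm_var[of ?\<Gamma> 0 "wk B"]
    by (simp_all add: sub_norm)
  have GG: "TmVar (wk B) # ?\<Gamma> \<turnstile> sub (Var 0 \<bullet> shift (Suc (Suc 0))) G \<Ztypecolon> wk (wk A)"
    and FF: "TmVar (wk A) # ?\<Gamma> \<turnstile> sub (Var 0 \<bullet> shift (Suc (Suc 0))) F \<Ztypecolon> wk (wk B)"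
    using weaken_under_tm[OF wf B G w1] weaken_under_tm[OF wf A F w1] by (simp_all add: sub_norm)
  have "?\<Gamma> \<turnstile> App (wk (Lam G)) (Var 0) \<doteq> G \<Ztypecolon> wk A"
    using lam_beta[OF wA(2) GG wA(3), of "wk A"] by (simp add: sub_norm)
  from lam_beta[OF wA(1) FF this, of "wk B"]
  have "?\<Gamma> \<turnstile> App (wk (Lam F)) (App (wk (Lam G)) (Var 0)) \<doteq> sub (G \<bullet> shift (Suc 0)) F \<Ztypecolon> wk B"
    by (simp add: sub_norm)
  moreover have "DimVar Pth # ?\<Gamma> \<turnstile> Ty Large (wk (wk B))"
    using weaken_ty[OF wf B extends_dim[OF w1]] by (simp add: sub_norm)
  ultimately have "?\<Gamma> \<turnstile> w \<doteq> w' \<Ztypecolon> PathC (wk B) (App (wk (Lam F)) (App (wk (Lam G)) (Var 0))) (Var 0)"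
    using path_conv[OF w[unfolded PathC_def], of "wk (wk B)" _ "Var 0"] wA(3)
    by (simp add: sub_norm tm_sym)
  from pi_intro[OF B this] show ?thesis by simp
qed

definition id_tm :: tm where "id_tm = Lam (Var 0)"
text \<open>Below the path binder \<open>Var 1\<close> is the argument. As a closed term, this
  proves every roundtrip that holds judgementally.\<close>

definition refl_tm :: tm where "refl_tm = Lam (PLam (Var 1))"

lemma id_tm_sub [simp]: "sub \<sigma> id_tm = id_tm" "sub \<sigma> refl_tm = refl_tm"
  by (simp_all add: id_tm_def refl_tm_def sub_norm)

lemma id_tm:
  assumes wf: "\<Gamma> \<turnstile> Wf" and A: "\<Gamma> \<turnstile> Ty Large A"
  shows "\<Gamma> \<turnstile> id_tm \<Ztypecolon> Arr A A" "\<Gamma> \<turnstile> refl_tm \<Ztypecolon> RoundTrip A id_tm id_tm"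
proof -
  have v: "TmVar A # \<Gamma> \<turnstile> Var 0 \<Ztypecolon> wk A" by (simp add: tm_var)
  show "\<Gamma> \<turnstile> id_tm \<Ztypecolon> Arr A A"
    unfolding id_tm_def Arr_def by (rule pi_intro[OF A v])
  show "\<Gamma> \<turnstile> refl_tm \<Ztypecolon> RoundTrip A id_tm id_tm"
    unfolding id_tm_def refl_tm_def
    using path_refl[OF wf_tm[OF wf A] v] by (intro lam_RoundTrip[OF wf A A v v])
      (simp add: sub_norm)
qed

text \<open>The univalence rule takes such a proof as an argument. Obtaining it through
  \<open>qinv\<close> makes it respect equality in \<open>A\<close> and commute with
  substitution.\<close>

definition id_isEquiv :: "tm \<Rightarrow> tm" where "id_isEquiv A = qinv A A id_tm id_tm refl_tm refl_tm"

lemma id_isEquiv: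
  assumes wf: "\<Gamma> \<turnstile> Wf" and A: "\<Gamma> \<turnstile> A \<doteq> A' \<Ztypecolon> U"
  shows "\<Gamma> \<turnstile> id_isEquiv A \<doteq> id_isEquiv A' \<Ztypecolon> isEquiv A A id_tm"
  unfolding id_isEquiv_def
  using id_tm[OF wf ty_of_univ[OF tm_refl_left[OF A]]] by (intro qinv A)

section \<open>Equivalences as pairs, and the paths that univalence assigns to them\<close>

definition equiv_tm :: "tm \<Rightarrow> tm \<Rightarrow> tm \<Rightarrow> tm \<Rightarrow> tm \<Rightarrow> tm \<Rightarrow> tm" where
  "equiv_tm A B f g s t = Pair f (qinv A B f g s t)"

lemma equiv_tm_sub [simp]:
  "sub \<sigma> (equiv_tm A B f g s t) = equiv_tm (sub \<sigma> A) (sub \<sigma> B) (sub \<sigma> f) (sub \<sigma> g) (sub \<sigma> s)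
    (sub \<sigma> t)"
  by (simp add: equiv_tm_def sub_norm)

lemma Arr_form:
  assumes wf: "\<Gamma> \<turnstile> Wf" and A: "\<Gamma> \<turnstile> Ty l A" and B: "\<Gamma> \<turnstile> Ty l B"
  shows "\<Gamma> \<turnstile> Ty l (Arr A B)"
  unfolding Arr_def using weaken_ty[OF wf B extends_tm[OF extends_refl]]
  by (intro pi_form A) (simp add: sub_norm)

lemma Equiv_body_form:
  assumes wf: "\<Gamma> \<turnstile> Wf" and A: "\<Gamma> \<turnstile> Ty Large A" and B: "\<Gamma> \<turnstile> Ty Large B"
  shows "TmVar (Arr A B) # \<Gamma> \<turnstile> Ty Large (isEquiv (wk A) (wk B) (Var 0))"
proof (rule isEquiv_form)
  note w1 = extends_tm[OF extends_refl, of "Arr A B" \<Gamma>]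
  show "TmVar (Arr A B) # \<Gamma> \<turnstile> Wf" by (rule wf_tm[OF wf Arr_form[OF assms]])
  show "TmVar (Arr A B) # \<Gamma> \<turnstile> Ty Large (wk A)" "TmVar (Arr A B) # \<Gamma> \<turnstile> Ty Large (wk B)"
    using weaken_ty[OF wf A w1] weaken_ty[OF wf B w1] by (simp_all add: sub_norm)
  show "TmVar (Arr A B) # \<Gamma> \<turnstile> Var 0 \<Ztypecolon> Arr (wk A) (wk B)" by (rule tm_var) (simp add: sub_norm)
qed

lemma Equiv_intro:
  assumes wf: "\<Gamma> \<turnstile> Wf" and A: "\<Gamma> \<turnstile> Ty Large A" and B: "\<Gamma> \<turnstile> Ty Large B"
   and f: "\<Gamma> \<turnstile> f \<doteq> f' \<Ztypecolon> Arr A B" and E: "\<Gamma> \<turnstile> E \<doteq> E' \<Ztypecolon> isEquiv A B f"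
  shows "\<Gamma> \<turnstile> Pair f E \<doteq> Pair f' E' \<Ztypecolon> Equiv A B"
  unfolding Equiv_def
proof (rule sig_intro[OF Equiv_body_form[OF wf A B] f])
  have "(isEquiv (wk A) (wk B) (Var 0))\<langle>f\<rangle> = isEquiv A B f" by (simp add: sub_norm)
  then show "\<Gamma> \<turnstile> E \<doteq> E' \<Ztypecolon> (isEquiv (wk A) (wk B) (Var 0))\<langle>f\<rangle>" using E by simp
qed

lemma equiv_tm:
  assumes wf: "\<Gamma> \<turnstile> Wf" and A: "\<Gamma> \<turnstile> A \<doteq> A' \<Ztypecolon> U" and B: "\<Gamma> \<turnstile> B \<doteq> B' \<Ztypecolon> U" and f: "\<Gamma> \<turnstile> f \<doteq> f' \<Ztypecolon> Arr A B"
    and g: "\<Gamma> \<turnstile> g \<doteq> g' \<Ztypecolon> Arr B A"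
    and s: "\<Gamma> \<turnstile> s \<doteq> s' \<Ztypecolon> RoundTrip B f g" and t: "\<Gamma> \<turnstile> t \<doteq> t' \<Ztypecolon> RoundTrip A g f"
  shows "\<Gamma> \<turnstile> equiv_tm A B f g s t \<doteq> equiv_tm A' B' f' g' s' t' \<Ztypecolon> Equiv A B"
  unfolding equiv_tm_def
  by (rule Equiv_intro[OF wf ty_of_univ[OF tm_refl_left[OF A]] ty_of_univ[OF tm_refl_left[OF B]] f
    qinv[OF A B f g s t]])

text \<open>\<open>Univalence\<close> at \<open>e\<close> proves that the fiber of
  \<open>pathtoequiv\<close> over \<open>e\<close> is contractible. The outer \<open>Fst\<close> of
  its center is the path; the witness that \<open>pathtoequiv\<close> sends it to \<open>e\<close>
  is discarded.\<close>

definition ua :: "tm \<Rightarrow> tm \<Rightarrow> tm \<Rightarrow> tm" where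
  "ua A B e = Fst (Fst (App (Univalence A B (id_isEquiv A)) e))"

lemma ua_sub [simp]: "sub \<sigma> (ua A B e) = ua (sub \<sigma> A) (sub \<sigma> B) (sub \<sigma> e)"
  by (simp add: ua_def id_isEquiv_def sub_norm)

lemma ua:
  assumes wf: "\<Gamma> \<turnstile> Wf" and A: "\<Gamma> \<turnstile> A \<doteq> A' \<Ztypecolon> U" and B: "\<Gamma> \<turnstile> B \<doteq> B' \<Ztypecolon> U"
      and e: "\<Gamma> \<turnstile> e \<doteq> e' \<Ztypecolon> Equiv A B"
  shows "\<Gamma> \<turnstile> ua A B e \<doteq> ua A' B' e' \<Ztypecolon> PathC U A B"
proof -
  let ?P = "\<lambda>e. isContr (Fiber (PathC U A B) (Equiv A B) (pathtoequiv A (id_isEquiv A)) e)"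
  have "\<Gamma> \<turnstile> Univalence A B (id_isEquiv A) \<doteq> Univalence A' B' (id_isEquiv A')
    \<Ztypecolon> isEquiv (PathC U A B) (Equiv A B) (pathtoequiv A (id_isEquiv A))"
    using id_isEquiv[OF wf A] by (intro univalence univ_elim A B) (simp add: id_tm_def)
  from pi_elim[OF this[unfolded isEquiv_def] e]
  have "\<Gamma> \<turnstile> App (Univalence A B (id_isEquiv A)) e \<doteq> App (Univalence A' B' (id_isEquiv A')) e'
    \<Ztypecolon> isContr (Fiber (PathC U A B) (Equiv A B) (pathtoequiv A (id_isEquiv A)) e)"
    by (simp add: sub_norm pathtoequiv_def id_isEquiv_def)
  from sig_fst[OF this[unfolded isContr_def]] show ?thesis
    unfolding ua_def Fiber_def by (rule sig_fst)
qed

section \<open>Gel-types\<close>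

definition relation :: "ctx \<Rightarrow> tm \<Rightarrow> tm \<Rightarrow> tm \<Rightarrow> bool" where
  "relation \<Gamma> A B R \<longleftrightarrow> (\<Gamma> \<turnstile> Wf) \<and> (\<Gamma> \<turnstile> A \<Ztypecolon> U) \<and> (\<Gamma> \<turnstile> B \<Ztypecolon> U) \<and> (\<Gamma> \<turnstile> R \<Ztypecolon> Arr (Times A B) U)"

lemma relationD:
  assumes "relation \<Gamma> A B R"
  shows "\<Gamma> \<turnstile> Wf" "\<Gamma> \<turnstile> A \<Ztypecolon> U" "\<Gamma> \<turnstile> B \<Ztypecolon> U" "\<Gamma> \<turnstile> R \<Ztypecolon> Arr (Times A B) U"
    "\<Gamma> \<turnstile> Ty l A" "\<Gamma> \<turnstile> Ty l B"
  using assms by (simp_all add: relation_def ty_of_univ)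

lemma relation_weaken:
  assumes "relation \<Gamma> A B R" "extends k \<Delta> \<Gamma>" "\<Delta> \<turnstile> Wf"
  shows "relation \<Delta> (sub (shift k) A) (sub (shift k) B) (sub (shift k) R)"
  unfolding relation_def
  using relationD(2,3,4)[OF assms(1), THEN weaken_tm[OF relationD(1)[OF assms(1)] _ assms(2)]]
    assms(3)
  by (simp add: sub_norm)

lemma wk_shift: "wk M = sub (shift (Suc 0)) M" by (simp add: sub_norm)

text \<open>The \<open>Dead\<close> case is the one met below a fresh bridge variable: restricting
  \<open>DimVar Brg # \<Gamma>\<close> by \<open>Var 0\<close> leaves
  \<open>Dead # \<Gamma>\<close>.\<close>

lemma relation_wk:
  assumes "relation \<Gamma> A B R"
  shows "relation (DimVar k # \<Gamma>) (wk A) (wk B) (wk R)" "relation (Dead # \<Gamma>) (wk A) (wk B) (wk R)"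
    "\<Gamma> \<turnstile> Ty Large T \<Longrightarrow> relation (TmVar T # \<Gamma>) (wk A) (wk B) (wk R)"
  unfolding wk_shift using relationD(1)[OF assms]
  by (auto intro!: relation_weaken[OF assms] extends.intros wf_dim wf_dead wf_tm)

lemma Times_intro:
  assumes wf: "\<Gamma> \<turnstile> Wf" and A: "\<Gamma> \<turnstile> Ty Large A" and B: "\<Gamma> \<turnstile> Ty Large B"
    and a: "\<Gamma> \<turnstile> a \<doteq> a' \<Ztypecolon> A" and b: "\<Gamma> \<turnstile> b \<doteq> b' \<Ztypecolon> B"
  shows "\<Gamma> \<turnstile> Pair a b \<doteq> Pair a' b' \<Ztypecolon> Times A B"
  unfolding Times_def using weaken_ty[OF wf B extends_tm[OF extends_refl]] b
  by (intro sig_intro a) (simp_all add: sub_norm)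

lemma tm_conv_univ:
  "\<lbrakk>\<Gamma> \<turnstile> M \<doteq> N \<Ztypecolon> A; \<Gamma> \<turnstile> A \<doteq> B \<Ztypecolon> U\<rbrakk> \<Longrightarrow> \<Gamma> \<turnstile> M \<doteq> N \<Ztypecolon> B"
  by (rule tm_conv[OF _ ty_of_univ])

lemma relation_pair:
  assumes "relation \<Gamma> A B R" and a: "\<Gamma> \<turnstile> a \<doteq> a' \<Ztypecolon> A" and b: "\<Gamma> \<turnstile> b \<doteq> b' \<Ztypecolon> B"
  shows "\<Gamma> \<turnstile> App R (Pair a b) \<doteq> App R (Pair a' b') \<Ztypecolon> U"
  using app_type_eq[OF relationD(4)[OF assms(1), unfolded Arr_def]
    Times_intro[OF relationD(1,5,6)[OF assms(1)] a b]]
  by (simp add: sub_norm)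

definition GelRel :: "tm \<Rightarrow> tm \<Rightarrow> tm \<Rightarrow> tm \<Rightarrow> tm" where
  "GelRel r A B R = Gel r A B (App (wk (wk R)) (Pair (Var 1) (Var 0)))"

lemma GelRel_sub [simp]: "sub \<sigma> (GelRel r A B R) = GelRel (sub \<sigma> r) (sub \<sigma> A) (sub \<sigma> B) (sub \<sigma> R)"
  by (simp add: GelRel_def sub_norm)

lemma relation_body:
  assumes r: "relation \<Gamma> A B R"
  shows "TmVar (wk B) # TmVar A # \<Gamma> \<turnstile> App (wk (wk R)) (Pair (Var 1) (Var 0)) \<Ztypecolon> U"
    "TmVar (wk B) # TmVar A # \<Gamma> \<turnstile> Ty l (App (wk (wk R)) (Pair (Var 1) (Var 0)))"
proof -
  note r1 = relation_wk(3)[OF r relationD(5)[OF r]]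
  show *: "TmVar (wk B) # TmVar A # \<Gamma> \<turnstile> App (wk (wk R)) (Pair (Var 1) (Var 0)) \<Ztypecolon> U"
    by (rule relation_pair[OF relation_wk(3)[OF r1 relationD(6)[OF r1]]]) (simp_all add: tm_var)
  then show "TmVar (wk B) # TmVar A # \<Gamma> \<turnstile> Ty l (App (wk (wk R)) (Pair (Var 1) (Var 0)))"
    by (rule ty_of_univ)
qed

lemma GelRel_form:
  assumes "\<Gamma> \<turnstile> Dim Brg r" and R: "relation (restr \<Gamma> r) A B R"
  shows "\<Gamma> \<turnstile> GelRel r A B R \<Ztypecolon> U"
  unfolding GelRel_def using assms relationD[OF R] relation_body[OF R]
  by (intro univ_intro gel_form)

lemma GelRel_boundary:
  assumes R: "relation \<Gamma> A B R"
  shows "\<Gamma> \<turnstile> GelRel (Zero Brg) A B R \<doteq> A \<Ztypecolon> U" "\<Gamma> \<turnstile> GelRel (One Brg) A B R \<doteq> B \<Ztypecolon> U"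
  unfolding GelRel_def
  by (rule univ_intro gel_form_zero gel_form_one relationD(5,6)[OF R] relation_body(2)[OF R])+

lemma MkGelRel:
  assumes "\<Gamma> \<turnstile> Dim Brg r" and R: "relation (restr \<Gamma> r) A B R"
    and "restr \<Gamma> r \<turnstile> M \<doteq> M' \<Ztypecolon> A" "restr \<Gamma> r \<turnstile> N \<doteq> N' \<Ztypecolon> B" "restr \<Gamma> r \<turnstile> P \<doteq> P' \<Ztypecolon> App R (Pair M N)"
  shows "\<Gamma> \<turnstile> MkGel r M N P \<doteq> MkGel r M' N' P' \<Ztypecolon> GelRel r A B R"
  unfolding GelRel_def using assms relation_body[OF R] by (intro gel_intro) (simp_all add: sub_norm)

lemma MkGelRel_boundary:
  assumes R: "relation \<Gamma> A B R" and "\<Gamma> \<turnstile> M \<Ztypecolon> A" "\<Gamma> \<turnstile> N \<Ztypecolon> B" "\<Gamma> \<turnstile> P \<Ztypecolon> App R (Pair M N)"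
  shows "\<Gamma> \<turnstile> MkGel (Zero Brg) M N P \<doteq> M \<Ztypecolon> A" "\<Gamma> \<turnstile> MkGel (One Brg) M N P \<doteq> N \<Ztypecolon> B"
  using assms relation_body[OF R] gel_intro_zero[OF relation_body(2)[OF R]]
    gel_intro_one[OF relation_body(2)[OF R]]
  by (simp_all add: sub_norm)

section \<open>Bridges over a line of Gel-types\<close>

definition BridgeGel :: "tm \<Rightarrow> tm \<Rightarrow> tm \<Rightarrow> tm \<Rightarrow> tm \<Rightarrow> tm" where
  "BridgeGel A B R a b = Bridge (GelRel (Var 0) (wk A) (wk B) (wk R)) a b"

lemma BridgeGel_sub [simp]: "sub \<sigma> (BridgeGel A B R a b) = BridgeGel (sub \<sigma> A) (sub \<sigma> B) (sub \<sigma> R)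
  (sub \<sigma> a) (sub \<sigma> b)"
  by (simp add: BridgeGel_def sub_norm)

lemma GelRel_line:
  assumes R: "relation \<Gamma> A B R"
  shows "DimVar Brg # \<Gamma> \<turnstile> GelRel (Var 0) (wk A) (wk B) (wk R) \<Ztypecolon> U"
  by (rule GelRel_form) (simp_all add: dim_var relation_wk[OF R])

lemma GelRel_conv:
  assumes R: "relation \<Gamma> A B R"
  shows "\<Gamma> \<turnstile> a \<doteq> a' \<Ztypecolon> A \<Longrightarrow> \<Gamma> \<turnstile> a \<doteq> a' \<Ztypecolon> GelRel (Zero Brg) A B R"
    "\<Gamma> \<turnstile> b \<doteq> b' \<Ztypecolon> B \<Longrightarrow> \<Gamma> \<turnstile> b \<doteq> b' \<Ztypecolon> GelRel (One Brg) A B R"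
    "\<Gamma> \<turnstile> a \<doteq> a' \<Ztypecolon> GelRel (Zero Brg) A B R \<Longrightarrow> \<Gamma> \<turnstile> a \<doteq> a' \<Ztypecolon> A"
    "\<Gamma> \<turnstile> b \<doteq> b' \<Ztypecolon> GelRel (One Brg) A B R \<Longrightarrow> \<Gamma> \<turnstile> b \<doteq> b' \<Ztypecolon> B"
  by (erule tm_conv_univ[OF _ tm_sym[OF GelRel_boundary(1)[OF R]]]
    tm_conv_univ[OF _ tm_sym[OF GelRel_boundary(2)[OF R]]]
      tm_conv_univ[OF _ GelRel_boundary(1)[OF R]] tm_conv_univ[OF _ GelRel_boundary(2)[OF R]])+

lemma BridgeGel_form:
  assumes R: "relation \<Gamma> A B R" and a: "\<Gamma> \<turnstile> a \<doteq> a' \<Ztypecolon> A" and b: "\<Gamma> \<turnstile> b \<doteq> b' \<Ztypecolon> B"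
  shows "\<Gamma> \<turnstile> BridgeGel A B R a b \<doteq> BridgeGel A B R a' b' \<Ztypecolon> U"
  unfolding BridgeGel_def
  by (rule univ_intro, rule bridge_form, rule ty_of_univ, rule GelRel_line[OF R])
    (use GelRel_conv(1)[OF R a] GelRel_conv(2)[OF R b] in \<open>simp_all add: sub_norm\<close>)

lemma BridgeGel_app:
  assumes "\<Gamma> \<turnstile> Dim Brg r" "restr \<Gamma> r \<turnstile> c \<doteq> c' \<Ztypecolon> BridgeGel A B R a b"
  shows "\<Gamma> \<turnstile> BApp c r \<doteq> BApp c' r \<Ztypecolon> GelRel r A B R"
  using bridge_elim[OF assms(1) assms(2)[unfolded BridgeGel_def]] by (simp add: sub_norm)

lemma BridgeGel_ends:
  assumes R: "relation \<Gamma> A B R" and c: "\<Gamma> \<turnstile> c \<Ztypecolon> BridgeGel A B R a b"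
  shows "\<Gamma> \<turnstile> BApp c (Zero Brg) \<doteq> a \<Ztypecolon> A" "\<Gamma> \<turnstile> BApp c (One Brg) \<doteq> b \<Ztypecolon> B"
  using bridge_zero[OF c[unfolded BridgeGel_def]] bridge_one[OF c[unfolded BridgeGel_def]]
    GelRel_conv[OF R]
  by (simp_all add: sub_norm)

definition ungel_bridge :: "tm \<Rightarrow> tm" where "ungel_bridge c = Ungel (BApp (wk c) (Var 0))"

lemma ungel_bridge_sub [simp]: "sub \<sigma> (ungel_bridge c) = ungel_bridge (sub \<sigma> c)"
  by (simp add: ungel_bridge_def sub_norm)

text \<open>The eliminator types its result over the values of \<open>c\<close> at the two ends, and
  conversion moves it to \<open>a\<close> and \<open>b\<close>. Since \<open>c\<close> is applied to
  the fresh variable, it is weakened along \<open>Dead\<close>, in the restricted context.\<close>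

lemma ungel_bridge:
  assumes R: "relation \<Gamma> A B R" and c: "\<Gamma> \<turnstile> c \<doteq> c' \<Ztypecolon> BridgeGel A B R a b"
  shows "\<Gamma> \<turnstile> ungel_bridge c \<doteq> ungel_bridge c' \<Ztypecolon> App R (Pair a b)"
proof -
  have "DimVar Brg # \<Gamma> \<turnstile> BApp (wk c) (Var 0) \<doteq> BApp (wk c') (Var 0)
    \<Ztypecolon> GelRel (Var 0) (wk A) (wk B) (wk R)"
    using weaken_tm[OF relationD(1)[OF R] c extends_dead[OF extends_refl]]
    by (intro BridgeGel_app) (simp_all add: dim_var sub_norm)
  then have "DimVar Brg # \<Gamma> \<turnstile> BApp (wk c) (Var 0) \<doteq> BApp (wk c') (Var 0)
    \<Ztypecolon> Gel (Var 0) (wk A) (wk B) (ren (upr (upr Suc)) (App (wk (wk R)) (Pair (Var 1) (Var 0))))"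
    unfolding GelRel_def by (simp add: sub_norm)
  from gel_elim[OF relationD(5,6)[OF R] relation_body(2)[OF R] this]
  have "\<Gamma> \<turnstile> ungel_bridge c \<doteq> ungel_bridge c' \<Ztypecolon> App R (Pair (BApp c (Zero Brg)) (BApp c (One Brg)))"
    by (simp add: sub_norm ungel_bridge_def)
  then show ?thesis
    by (rule tm_conv_univ[OF _ relation_pair[OF R BridgeGel_ends[OF R tm_refl_left[OF c]]]])
qed

definition gel_bridge :: "tm \<Rightarrow> tm \<Rightarrow> tm \<Rightarrow> tm" where
  "gel_bridge a b p = BLam (MkGel (Var 0) (wk a) (wk b) (wk p))"

lemma gel_bridge_sub [simp]: "sub \<sigma> (gel_bridge a b p) = gel_bridge (sub \<sigma> a) (sub \<sigma> b) (sub \<sigma> p)"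
  by (simp add: gel_bridge_def sub_norm)

lemma MkGelRel_line:
  assumes R: "relation \<Gamma> A B R" and a: "\<Gamma> \<turnstile> a \<doteq> a' \<Ztypecolon> A" and b: "\<Gamma> \<turnstile> b \<doteq> b' \<Ztypecolon> B"
      and p: "\<Gamma> \<turnstile> p \<doteq> p' \<Ztypecolon> App R (Pair a b)"
  shows "DimVar Brg # \<Gamma> \<turnstile> MkGel (Var 0) (wk a) (wk b) (wk p) \<doteq> MkGel (Var 0) (wk a') (wk b') (wk p')
      \<Ztypecolon> GelRel (Var 0) (wk A) (wk B) (wk R)"
proof -
  note w = weaken_tm[OF relationD(1)[OF R] _ extends_dead[OF extends_refl]]
  show ?thesis using w[OF a] w[OF b] w[OF p] relation_wk(2)[OF R]
    by (intro MkGelRel) (simp_all add: dim_var sub_norm)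
qed

lemma gel_bridge:
  assumes R: "relation \<Gamma> A B R" and a: "\<Gamma> \<turnstile> a \<doteq> a' \<Ztypecolon> A" and b: "\<Gamma> \<turnstile> b \<doteq> b' \<Ztypecolon> B"
      and p: "\<Gamma> \<turnstile> p \<doteq> p' \<Ztypecolon> App R (Pair a b)"
  shows "\<Gamma> \<turnstile> gel_bridge a b p \<doteq> gel_bridge a' b' p' \<Ztypecolon> BridgeGel A B R a b"
  unfolding BridgeGel_def gel_bridge_def
  using MkGelRel_line[OF assms] GelRel_conv(1,2)[OF R]
    MkGelRel_boundary[OF R tm_refl_left[OF a] tm_refl_left[OF b] tm_refl_left[OF p]]
  by (intro bridge_intro) (simp_all add: sub_norm)

lemma gel_bridge_beta:
  assumes r: "\<Gamma> \<turnstile> Dim Brg r" and R: "relation (restr \<Gamma> r) A B R" and a: "restr \<Gamma> r \<turnstile> a \<Ztypecolon> A"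
      and b: "restr \<Gamma> r \<turnstile> b \<Ztypecolon> B"
    and p: "restr \<Gamma> r \<turnstile> p \<Ztypecolon> App R (Pair a b)"
  shows "\<Gamma> \<turnstile> BApp (gel_bridge a b p) r \<doteq> MkGel r a b p \<Ztypecolon> GelRel r A B R"
  using bridge_beta[OF r MkGelRel_line[OF R a b p]]
  by (simp add: gel_bridge_def sub_norm)

lemma ungel_gel_bridge:
  assumes R: "relation \<Gamma> A B R" and a: "\<Gamma> \<turnstile> a \<Ztypecolon> A" and b: "\<Gamma> \<turnstile> b \<Ztypecolon> B"
      and p: "\<Gamma> \<turnstile> p \<Ztypecolon> App R (Pair a b)"
  shows "\<Gamma> \<turnstile> ungel_bridge (gel_bridge a b p) \<doteq> p \<Ztypecolon> App R (Pair a b)"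
proof -
  note w = weaken_tm[OF relationD(1)[OF R] _ extends_dead[OF extends_refl]]
  have "DimVar Brg # \<Gamma> \<turnstile> BApp (gel_bridge (wk a) (wk b) (wk p)) (Var 0)
    \<doteq> MkGel (Var 0) (wk a) (wk b) (wk p)
    \<Ztypecolon> GelRel (Var 0) (wk A) (wk B) (wk R)"
    using w[OF a] w[OF b] w[OF p] relation_wk(2)[OF R]
    by (intro gel_bridge_beta) (simp_all add: dim_var sub_norm)
  then have "DimVar Brg # \<Gamma> \<turnstile> BApp (wk (gel_bridge a b p)) (Var 0)
    \<doteq> MkGel (Var 0) (wk a) (wk b) (wk p)
    \<Ztypecolon> Gel (Var 0) (wk A) (wk B) (ren (upr (upr Suc)) (App (wk (wk R)) (Pair (Var 1) (Var 0))))"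
    unfolding GelRel_def by (simp add: sub_norm)
  from gel_elim[OF relationD(5,6)[OF R] relation_body(2)[OF R] this]
  have "\<Gamma> \<turnstile> ungel_bridge (gel_bridge a b p) \<doteq> Ungel (MkGel (Var 0) (wk a) (wk b) (wk p))
    \<Ztypecolon> App R (Pair (BApp (gel_bridge a b p) (Zero Brg)) (BApp (gel_bridge a b p) (One Brg)))"
    unfolding ungel_bridge_def by (simp add: sub_norm)
  then have "\<Gamma> \<turnstile> ungel_bridge (gel_bridge a b p) \<doteq> Ungel (MkGel (Var 0) (wk a) (wk b) (wk p))
    \<Ztypecolon> App R (Pair a b)"
    by (rule tm_conv_univ[OF _ relation_pair[OF R BridgeGel_ends[OF R gel_bridge[OF R a b p]]]])
  moreover have "\<Gamma> \<turnstile> Ungel (MkGel (Var 0) (wk a) (wk b) (wk p)) \<doteq> p \<Ztypecolon> App R (Pair a b)"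
    using gel_beta[OF relation_body(2)[OF R] a b, of p] p by (simp add: sub_norm)
  ultimately show ?thesis by (rule tm_trans)
qed

text \<open>Eta for Gel-types on the line \<open>c x\<close>, evaluated at \<open>r\<close>, with
  the ends of \<open>c\<close> replaced by \<open>a\<close> and \<open>b\<close>. At the fresh
  variable it gives the second half of the isomorphism with bridges.\<close>

lemma MkGel_ungel_bridge:
  assumes r: "\<Gamma> \<turnstile> Dim Brg r" and R: "relation (restr \<Gamma> r) A B R"
      and c: "restr \<Gamma> r \<turnstile> c \<Ztypecolon> BridgeGel A B R a b"
  shows "\<Gamma> \<turnstile> MkGel r a b (ungel_bridge c) \<doteq> BApp c r \<Ztypecolon> GelRel r A B R"
proof -
  have "DimVar Brg # restr \<Gamma> r \<turnstile> BApp (wk c) (Var 0) \<Ztypecolon> GelRel (Var 0) (wk A) (wk B) (wk R)"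
    using weaken_tm[OF relationD(1)[OF R] c extends_dead[OF extends_refl]]
    by (intro BridgeGel_app) (simp_all add: dim_var sub_norm)
  then have "DimVar Brg # restr \<Gamma> r \<turnstile> BApp (wk c) (Var 0)
    \<Ztypecolon> Gel (Var 0) (wk A) (wk B) (ren (upr (upr Suc)) (App (wk (wk R)) (Pair (Var 1) (Var 0))))"
    unfolding GelRel_def by (simp add: sub_norm)
  from gel_eta[OF r relationD(5,6)[OF R] relation_body(2)[OF R] this]
  have "\<Gamma> \<turnstile> BApp c r \<doteq> MkGel r (BApp c (Zero Brg)) (BApp c (One Brg)) (ungel_bridge c)
    \<Ztypecolon> GelRel r A B R"
    by (simp add: GelRel_def sub_norm ungel_bridge_def)
  moreover have "\<Gamma> \<turnstile> MkGel r (BApp c (Zero Brg)) (BApp c (One Brg)) (ungel_bridge c)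
    \<doteq> MkGel r a b (ungel_bridge c) \<Ztypecolon> GelRel r A B R"
  proof (rule MkGelRel[OF r R])
    note e = BridgeGel_ends[OF R c]
    show "restr \<Gamma> r \<turnstile> BApp c (Zero Brg) \<doteq> a \<Ztypecolon> A" "restr \<Gamma> r \<turnstile> BApp c (One Brg) \<doteq> b \<Ztypecolon> B" by (fact e)+
    show "restr \<Gamma> r \<turnstile> ungel_bridge c \<Ztypecolon> App R (Pair (BApp c (Zero Brg)) (BApp c (One Brg)))"
      by (rule tm_conv_univ[OF ungel_bridge[OF R c] relation_pair[OF R tm_sym[OF e(1)]
        tm_sym[OF e(2)]]])
  qed
  ultimately show ?thesis by (rule tm_sym[OF tm_trans])
qed

lemma gel_ungel_bridge:
  assumes R: "relation \<Gamma> A B R" and c: "\<Gamma> \<turnstile> c \<Ztypecolon> BridgeGel A B R a b"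
  shows "\<Gamma> \<turnstile> gel_bridge a b (ungel_bridge c) \<doteq> c \<Ztypecolon> BridgeGel A B R a b"
proof -
  note e = BridgeGel_ends[OF R c]
  have "DimVar Brg # \<Gamma> \<turnstile> MkGel (Var 0) (wk a) (wk b) (ungel_bridge (wk c)) \<doteq> BApp (wk c) (Var 0)
    \<Ztypecolon> GelRel (Var 0) (wk A) (wk B) (wk R)"
    using weaken_tm[OF relationD(1)[OF R] c extends_dead[OF extends_refl]] relation_wk(2)[OF R]
    by (intro MkGel_ungel_bridge) (simp_all add: dim_var sub_norm)
  then have "\<Gamma> \<turnstile> gel_bridge a b (ungel_bridge c) \<doteq> BLam (BApp (wk c) (Var 0)) \<Ztypecolon> BridgeGel A B R a b"
    unfolding gel_bridge_def BridgeGel_def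
    using MkGelRel_boundary[OF R tm_refl_right[OF e(1)] tm_refl_right[OF e(2)] ungel_bridge[OF R c]]
      e GelRel_conv(1,2)[OF R]
    by (intro bridge_intro) (simp_all add: sub_norm tm_refl_right[OF e(1)] tm_refl_right[OF e(2)])
  then show ?thesis
    using bridge_eta[OF c[unfolded BridgeGel_def], folded BridgeGel_def]
    by (rule tm_trans[OF _ tm_sym])
qed

section \<open>From relations to lines of types and back\<close>

text \<open>Both roundtrips hold judgementally by the beta and eta rules, so \<open>refl_tm\<close>
  serves for each.\<close>

definition gel_equiv :: "tm \<Rightarrow> tm \<Rightarrow> tm \<Rightarrow> tm \<Rightarrow> tm \<Rightarrow> tm" where
  "gel_equiv A B R a b = equiv_tm (BridgeGel A B R a b) (App R (Pair a b))
     (Lam (ungel_bridge (Var 0))) (Lam (gel_bridge (wk a) (wk b) (Var 0))) refl_tm refl_tm"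

lemma path_refl_eq:
  assumes wf: "\<Gamma> \<turnstile> Wf" and A: "\<Gamma> \<turnstile> Ty Large A" and a: "\<Gamma> \<turnstile> a \<doteq> a' \<Ztypecolon> A"
  shows "\<Gamma> \<turnstile> PLam (wk a') \<Ztypecolon> PathC A a a'"
  using path_conv[OF path_refl[OF wf tm_refl_right[OF a], unfolded PathC_def], of "wk A" a a']
    weaken_ty[OF wf A extends_dim[OF extends_refl]] a tm_refl_right[OF a]
      by (simp add: sub_norm tm_sym)

lemma gel_equiv:
  assumes R: "relation \<Gamma> A B R" and a: "\<Gamma> \<turnstile> a \<Ztypecolon> A" and b: "\<Gamma> \<turnstile> b \<Ztypecolon> B"
  shows "\<Gamma> \<turnstile> gel_equiv A B R a b \<Ztypecolon> Equiv (BridgeGel A B R a b) (App R (Pair a b))"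
proof -
  let ?X = "BridgeGel A B R a b" and ?Y = "App R (Pair a b)"
  note wf = relationD(1)[OF R]
  have X: "\<Gamma> \<turnstile> ?X \<Ztypecolon> U" by (rule BridgeGel_form[OF R a b])
  have Y: "\<Gamma> \<turnstile> ?Y \<Ztypecolon> U" by (rule relation_pair[OF R a b])
  note XL = ty_of_univ[OF X, of Large] and YL = ty_of_univ[OF Y, of Large]
  note RX = relation_wk(3)[OF R XL] and RY = relation_wk(3)[OF R YL]
  note wX = weaken_tm[OF wf _ extends_tm[OF extends_refl], of _ _ _ _ ?X]
  note wY = weaken_tm[OF wf _ extends_tm[OF extends_refl], of _ _ _ _ ?Y]
  have aX: "TmVar ?X # \<Gamma> \<turnstile> wk a \<Ztypecolon> wk A" "TmVar ?X # \<Gamma> \<turnstile> wk b \<Ztypecolon> wk B"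
    and aY: "TmVar ?Y # \<Gamma> \<turnstile> wk a \<Ztypecolon> wk A" "TmVar ?Y # \<Gamma> \<turnstile> wk b \<Ztypecolon> wk B"
    using wX[OF a] wX[OF b] wY[OF a] wY[OF b] by (simp_all add: sub_norm)
  have vX: "TmVar ?X # \<Gamma> \<turnstile> Var 0 \<Ztypecolon> BridgeGel (wk A) (wk B) (wk R) (wk a) (wk b)"
    and vY: "TmVar ?Y # \<Gamma> \<turnstile> Var 0 \<Ztypecolon> App (wk R) (Pair (wk a) (wk b))"
    by (rule tm_var, simp add: sub_norm)+
  have f: "TmVar ?X # \<Gamma> \<turnstile> ungel_bridge (Var 0) \<Ztypecolon> wk ?Y"
    using ungel_bridge[OF RX vX] by (simp add: sub_norm)
  have g: "TmVar ?Y # \<Gamma> \<turnstile> gel_bridge (wk a) (wk b) (Var 0) \<Ztypecolon> wk ?X"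
    using gel_bridge[OF RY aY vY] by (simp add: sub_norm)
  have s: "\<Gamma> \<turnstile> refl_tm \<Ztypecolon> RoundTrip ?Y (Lam (ungel_bridge (Var 0)))
    (Lam (gel_bridge (wk a) (wk b) (Var 0)))"
    unfolding refl_tm_def
  proof (rule lam_RoundTrip[OF wf XL YL f g])
    have "TmVar ?Y # \<Gamma> \<turnstile> Ty Large (wk ?Y)"
      using weaken_ty[OF wf YL extends_tm[OF extends_refl]] by (simp add: sub_norm)
    from path_refl_eq[OF relationD(1)[OF RY] this, of "ungel_bridge (gel_bridge (wk a) (wk b)
      (Var 0))" "Var 0"]
    show "TmVar ?Y # \<Gamma> \<turnstile> PLam (Var 1)
      \<Ztypecolon> PathC (wk ?Y)
      (sub (gel_bridge (wk a) (wk b) (Var 0) \<bullet> shift (Suc 0)) (ungel_bridge (Var 0))) (Var 0)"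
      using ungel_gel_bridge[OF RY aY vY] by (simp add: sub_norm)
  qed
  have t: "\<Gamma> \<turnstile> refl_tm \<Ztypecolon> RoundTrip ?X (Lam (gel_bridge (wk a) (wk b) (Var 0)))
    (Lam (ungel_bridge (Var 0)))"
    unfolding refl_tm_def
  proof (rule lam_RoundTrip[OF wf YL XL g f])
    have "TmVar ?X # \<Gamma> \<turnstile> Ty Large (wk ?X)"
      using weaken_ty[OF wf XL extends_tm[OF extends_refl]] by (simp add: sub_norm)
    from path_refl_eq[OF relationD(1)[OF RX] this, of "gel_bridge (wk a) (wk b)
      (ungel_bridge (Var 0))" "Var 0"]
    show "TmVar ?X # \<Gamma> \<turnstile> PLam (Var 1)
      \<Ztypecolon> PathC (wk ?X)
      (sub (ungel_bridge (Var 0) \<bullet> shift (Suc 0)) (gel_bridge (wk a) (wk b) (Var 0))) (Var 0)"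
      using gel_ungel_bridge[OF RX vX] by (simp add: sub_norm)
  qed
  show ?thesis unfolding gel_equiv_def
    using pi_intro[OF XL f] pi_intro[OF YL g] by (intro equiv_tm[OF wf X Y _ _ s t])
      (simp_all add: Arr_def)
qed

definition gel_path :: "tm \<Rightarrow> tm \<Rightarrow> tm \<Rightarrow> tm \<Rightarrow> tm \<Rightarrow> tm" where
  "gel_path A B R a b = ua (BridgeGel A B R a b) (App R (Pair a b)) (gel_equiv A B R a b)"

lemma gel_path_sub [simp]:
  "sub \<sigma> (gel_path A B R a b) = gel_path (sub \<sigma> A) (sub \<sigma> B) (sub \<sigma> R) (sub \<sigma> a) (sub \<sigma> b)"
  by (simp add: gel_path_def gel_equiv_def sub_norm)

lemma gel_path:
  assumes R: "relation \<Gamma> A B R" and a: "\<Gamma> \<turnstile> a \<Ztypecolon> A" and b: "\<Gamma> \<turnstile> b \<Ztypecolon> B"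
  shows "\<Gamma> \<turnstile> gel_path A B R a b \<Ztypecolon> PathC U (BridgeGel A B R a b) (App R (Pair a b))"
  unfolding gel_path_def
  by (rule ua[OF relationD(1)[OF R] BridgeGel_form[OF R a b] relation_pair[OF R a b]
    gel_equiv[OF assms]])

section \<open>The line of Gel-types and the relation of bridges over a line\<close>

definition GelLine :: "tm \<Rightarrow> tm \<Rightarrow> tm \<Rightarrow> tm" where
  "GelLine A B R = BLam (GelRel (Var 0) (wk A) (wk B) (wk R))"

lemma GelLine_sub [simp]: "sub \<sigma> (GelLine A B R) = GelLine (sub \<sigma> A) (sub \<sigma> B) (sub \<sigma> R)"
  by (simp add: GelLine_def sub_norm)

lemma GelLine:
  assumes R: "relation \<Gamma> A B R"
  shows "\<Gamma> \<turnstile> GelLine A B R \<Ztypecolon> BridgeC U A B"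
  unfolding GelLine_def BridgeC_def
  using GelRel_line[OF R] GelRel_boundary[OF R] by (intro bridge_intro) (simp_all add: sub_norm)

lemma GelLine_app:
  assumes r: "\<Gamma> \<turnstile> Dim Brg r" and R: "relation (restr \<Gamma> r) A B R"
  shows "\<Gamma> \<turnstile> BApp (GelLine A B R) r \<doteq> GelRel r A B R \<Ztypecolon> U"
  using bridge_beta[OF r GelRel_line[OF R]] by (simp add: GelLine_def sub_norm)

text \<open>The beta-reduced value of \<open>bridgetorel\<close> at \<open>C\<close>, which spares
  the arguments below the outer application.\<close>

definition bridge_rel :: "tm \<Rightarrow> tm" where
  "bridge_rel C = Lam (Bridge (BApp (wk (wk C)) (Var 0)) (Fst (Var 0)) (Snd (Var 0)))"

lemma bridge_rel_sub [simp]: "sub \<sigma> (bridge_rel C) = bridge_rel (sub \<sigma> C)"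
  by (simp add: bridge_rel_def sub_norm)

lemma BridgeC_app:
  assumes "\<Gamma> \<turnstile> Dim Brg r" "restr \<Gamma> r \<turnstile> C \<doteq> C' \<Ztypecolon> BridgeC U A B"
  shows "\<Gamma> \<turnstile> BApp C r \<doteq> BApp C' r \<Ztypecolon> U"
  using bridge_elim[OF assms(1) assms(2)[unfolded BridgeC_def]] by (simp add: sub_norm)

lemma BridgeC_ends:
  assumes C: "\<Gamma> \<turnstile> C \<Ztypecolon> BridgeC U A B"
  shows "\<Gamma> \<turnstile> BApp C (Zero Brg) \<doteq> A \<Ztypecolon> U" "\<Gamma> \<turnstile> BApp C (One Brg) \<doteq> B \<Ztypecolon> U"
  using bridge_zero[OF C[unfolded BridgeC_def]] bridge_one[OF C[unfolded BridgeC_def]]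
  by (simp_all add: sub_norm)

definition BridgeOver :: "tm \<Rightarrow> tm \<Rightarrow> tm \<Rightarrow> tm" where
  "BridgeOver C a b = Bridge (BApp (wk C) (Var 0)) a b"

lemma BridgeOver_sub [simp]: "sub \<sigma> (BridgeOver C a b) = BridgeOver (sub \<sigma> C) (sub \<sigma> a) (sub \<sigma> b)"
  by (simp add: BridgeOver_def sub_norm)

lemma BridgeC_conv:
  assumes C: "\<Gamma> \<turnstile> C \<Ztypecolon> BridgeC U A B"
  shows "\<Gamma> \<turnstile> a \<doteq> a' \<Ztypecolon> A \<Longrightarrow> \<Gamma> \<turnstile> a \<doteq> a' \<Ztypecolon> BApp C (Zero Brg)"
    "\<Gamma> \<turnstile> b \<doteq> b' \<Ztypecolon> B \<Longrightarrow> \<Gamma> \<turnstile> b \<doteq> b' \<Ztypecolon> BApp C (One Brg)"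
    "\<Gamma> \<turnstile> a \<doteq> a' \<Ztypecolon> BApp C (Zero Brg) \<Longrightarrow> \<Gamma> \<turnstile> a \<doteq> a' \<Ztypecolon> A"
    "\<Gamma> \<turnstile> b \<doteq> b' \<Ztypecolon> BApp C (One Brg) \<Longrightarrow> \<Gamma> \<turnstile> b \<doteq> b' \<Ztypecolon> B"
  by (erule tm_conv_univ[OF _ tm_sym[OF BridgeC_ends(1)[OF C]]]
    tm_conv_univ[OF _ tm_sym[OF BridgeC_ends(2)[OF C]]]
      tm_conv_univ[OF _ BridgeC_ends(1)[OF C]] tm_conv_univ[OF _ BridgeC_ends(2)[OF C]])+

lemma BridgeC_line:
  assumes wf: "\<Gamma> \<turnstile> Wf" and C: "\<Gamma> \<turnstile> C \<doteq> C' \<Ztypecolon> BridgeC U A B"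
  shows "DimVar Brg # \<Gamma> \<turnstile> BApp (wk C) (Var 0) \<doteq> BApp (wk C') (Var 0) \<Ztypecolon> U"
  using weaken_tm[OF wf C extends_dead[OF extends_refl]]
  by (intro BridgeC_app) (simp_all add: dim_var sub_norm)

lemma BridgeOver_form:
  assumes wf: "\<Gamma> \<turnstile> Wf" and C: "\<Gamma> \<turnstile> C \<doteq> C' \<Ztypecolon> BridgeC U A B"
    and a: "\<Gamma> \<turnstile> a \<doteq> a' \<Ztypecolon> A" and b: "\<Gamma> \<turnstile> b \<doteq> b' \<Ztypecolon> B"
  shows "\<Gamma> \<turnstile> BridgeOver C a b \<doteq> BridgeOver C' a' b' \<Ztypecolon> U"
  unfolding BridgeOver_def
  by (rule univ_intro, rule bridge_form, rule ty_of_univ, rule BridgeC_line[OF wf C])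
    (use BridgeC_conv(1)[OF tm_refl_left[OF C] a] BridgeC_conv(2)[OF tm_refl_left[OF C] b] in
      \<open>simp_all add: sub_norm\<close>)

lemma times_var:
  "TmVar (Times A B) # \<Gamma> \<turnstile> Fst (Var 0) \<Ztypecolon> wk A" "TmVar (Times A B) # \<Gamma> \<turnstile> Snd (Var 0) \<Ztypecolon> wk B"
  "TmVar (Times A B) # \<Gamma> \<turnstile> Var 0 \<doteq> Pair (Fst (Var 0)) (Snd (Var 0)) \<Ztypecolon> Times (wk A) (wk B)"
proof -
  have v: "TmVar (Times A B) # \<Gamma> \<turnstile> Var 0 \<Ztypecolon> Sig (wk A) (wk (wk B))"
    by (rule tm_var) (simp add: sub_norm)
  show "TmVar (Times A B) # \<Gamma> \<turnstile> Fst (Var 0) \<Ztypecolon> wk A" "TmVar (Times A B) # \<Gamma> \<turnstile> Snd (Var 0) \<Ztypecolon> wk B"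
     "TmVar (Times A B) # \<Gamma> \<turnstile> Var 0 \<doteq> Pair (Fst (Var 0)) (Snd (Var 0)) \<Ztypecolon> Times (wk A) (wk B)"
    using sig_fst[OF v] sig_snd[OF v] sig_eta[OF v] by (simp_all add: sub_norm)
qed

lemma Times_form:
  assumes wf: "\<Gamma> \<turnstile> Wf" and A: "\<Gamma> \<turnstile> Ty l A" and B: "\<Gamma> \<turnstile> Ty l B"
  shows "\<Gamma> \<turnstile> Ty l (Times A B)"
  unfolding Times_def using weaken_ty[OF wf B extends_tm[OF extends_refl]]
  by (intro sig_form A) (simp add: sub_norm)

lemma bridge_rel:
  assumes wf: "\<Gamma> \<turnstile> Wf" and A: "\<Gamma> \<turnstile> A \<Ztypecolon> U" and B: "\<Gamma> \<turnstile> B \<Ztypecolon> U"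
    and C: "\<Gamma> \<turnstile> C \<doteq> C' \<Ztypecolon> BridgeC U A B"
  shows "\<Gamma> \<turnstile> bridge_rel C \<doteq> bridge_rel C' \<Ztypecolon> Arr (Times A B) U"
proof -
  note T = Times_form[OF wf ty_of_univ[OF A, of Large] ty_of_univ[OF B, of Large]]
  have "TmVar (Times A B) # \<Gamma> \<turnstile> wk C \<doteq> wk C' \<Ztypecolon> BridgeC U (wk A) (wk B)"
    using weaken_tm[OF wf C extends_tm[OF extends_refl]] by (simp add: sub_norm)
  from BridgeOver_form[OF wf_tm[OF wf T] this times_var(1,2)]
  have "TmVar (Times A B) # \<Gamma> \<turnstile> BridgeOver (wk C) (Fst (Var 0)) (Snd (Var 0))
    \<doteq> BridgeOver (wk C') (Fst (Var 0)) (Snd (Var 0)) \<Ztypecolon> U" .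
  from pi_intro[OF T this] show ?thesis
    by (simp add: bridge_rel_def Arr_def BridgeOver_def ren.simps)
qed

text \<open>At the fresh bridge variable \<open>GelLine\<close> reduces to the Gel-type. This turns
  its relation into the family of types at which \<open>gel_path\<close> starts.\<close>

lemma bridge_rel_GelLine:
  assumes R: "relation \<Gamma> A B R"
  shows "\<Gamma> \<turnstile> bridge_rel (GelLine A B R)
      \<doteq> Lam (BridgeGel (wk A) (wk B) (wk R) (Fst (Var 0)) (Snd (Var 0))) \<Ztypecolon> Arr (Times A B) U"
proof -
  have T: "\<Gamma> \<turnstile> Ty Large (Times A B)" by (rule Times_form[OF relationD(1,5,6)[OF R]])
  let ?\<Gamma> = "TmVar (Times A B) # \<Gamma>"
  have R': "relation ?\<Gamma> (wk A) (wk B) (wk R)" by (rule relation_wk(3)[OF R T])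
  have "DimVar Brg # ?\<Gamma> \<turnstile> BApp (wk (wk (GelLine A B R))) (Var 0)
    \<doteq> GelRel (Var 0) (wk (wk A)) (wk (wk B)) (wk (wk R)) \<Ztypecolon> U"
    using GelLine_app[of "DimVar Brg # ?\<Gamma>" "Var 0" "wk (wk A)" "wk (wk B)" "wk (wk R)"]
      relation_wk(2)[OF R']
    by (simp add: dim_var sub_norm)
  from ty_of_univ[OF this]
  have "?\<Gamma> \<turnstile> BridgeOver (wk (GelLine A B R)) (Fst (Var 0)) (Snd (Var 0))
    \<doteq> BridgeGel (wk A) (wk B) (wk R) (Fst (Var 0)) (Snd (Var 0)) \<Ztypecolon> U"
    unfolding BridgeOver_def BridgeGel_def
    using BridgeC_conv(1,2)[OF GelLine[OF R']] times_var(1,2)[of A B \<Gamma>]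
    by (intro univ_intro bridge_form) (simp_all add: sub_norm)
  from pi_intro[OF T this] show ?thesis
    by (simp add: bridge_rel_def Arr_def BridgeOver_def ren.simps)
qed

lemma bridgetorel_eq: "bridgetorel = Lam (bridge_rel (Var 0))"
  by (simp add: bridgetorel_def bridge_rel_def sub_norm)

lemma BridgeU_form:
  assumes A: "\<Gamma> \<turnstile> A \<Ztypecolon> U" and B: "\<Gamma> \<turnstile> B \<Ztypecolon> U"
  shows "\<Gamma> \<turnstile> Ty Large (BridgeC U A B)"
  unfolding BridgeC_def using A B by (intro bridge_form) (simp_all add: sub_norm univ_form)

lemma rel_type_form:
  assumes wf: "\<Gamma> \<turnstile> Wf" and A: "\<Gamma> \<turnstile> A \<Ztypecolon> U" and B: "\<Gamma> \<turnstile> B \<Ztypecolon> U"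
  shows "\<Gamma> \<turnstile> Ty Large (Arr (Times A B) U)"
  by (rule Arr_form[OF wf Times_form[OF wf ty_of_univ[OF A] ty_of_univ[OF B]] univ_form])

lemma bridgetorel_body:
  assumes wf: "\<Gamma> \<turnstile> Wf" and A: "\<Gamma> \<turnstile> A \<Ztypecolon> U" and B: "\<Gamma> \<turnstile> B \<Ztypecolon> U"
  shows "TmVar (BridgeC U A B) # \<Gamma> \<turnstile> bridge_rel (Var 0) \<Ztypecolon> wk (Arr (Times A B) U)"
proof -
  note w = weaken_tm[OF wf _ extends_tm[OF extends_refl]]
  have "TmVar (BridgeC U A B) # \<Gamma> \<turnstile> Var 0 \<Ztypecolon> BridgeC U (wk A) (wk B)"
    by (rule tm_var) (simp add: sub_norm)
  from bridge_rel[OF wf_tm[OF wf BridgeU_form[OF A B]] _ _ this] w[OF A] w[OF B] show ?thesis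
    by (simp add: sub_norm)
qed

lemma bridgetorel_typ:
  assumes wf: "\<Gamma> \<turnstile> Wf" and A: "\<Gamma> \<turnstile> A \<Ztypecolon> U" and B: "\<Gamma> \<turnstile> B \<Ztypecolon> U"
  shows "\<Gamma> \<turnstile> bridgetorel \<Ztypecolon> Arr (BridgeC U A B) (Arr (Times A B) U)"
  using pi_intro[OF BridgeU_form[OF A B] bridgetorel_body[OF assms]]
  by (simp add: bridgetorel_eq Arr_def)

definition rel_bridge :: "tm \<Rightarrow> tm \<Rightarrow> tm" where
  "rel_bridge A B = Lam (GelLine (wk A) (wk B) (Var 0))"

lemma rel_bridge_body:
  assumes wf: "\<Gamma> \<turnstile> Wf" and A: "\<Gamma> \<turnstile> A \<Ztypecolon> U" and B: "\<Gamma> \<turnstile> B \<Ztypecolon> U"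
  shows "TmVar (Arr (Times A B) U) # \<Gamma> \<turnstile> GelLine (wk A) (wk B) (Var 0) \<Ztypecolon> wk (BridgeC U A B)"
proof -
  note w = weaken_tm[OF wf _ extends_tm[OF extends_refl]]
  have "relation (TmVar (Arr (Times A B) U) # \<Gamma>) (wk A) (wk B) (Var 0)"
    unfolding relation_def using wf_tm[OF wf rel_type_form[OF assms]] w[OF A] w[OF B]
    by (simp add: sub_norm tm_var)
  from GelLine[OF this] show ?thesis by (simp add: sub_norm)
qed

lemma rel_bridge:
  assumes wf: "\<Gamma> \<turnstile> Wf" and A: "\<Gamma> \<turnstile> A \<Ztypecolon> U" and B: "\<Gamma> \<turnstile> B \<Ztypecolon> U"
  shows "\<Gamma> \<turnstile> rel_bridge A B \<Ztypecolon> Arr (Arr (Times A B) U) (BridgeC U A B)"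
  using pi_intro[OF rel_type_form[OF assms] rel_bridge_body[OF assms]]
  by (simp add: rel_bridge_def Arr_def)

text \<open>Function extensionality amounts to exchanging the path binder with the lambda. The
  pointwise path is taken at the projections of the argument, so reaching \<open>R\<close> at the
  far end needs eta for pairs and then for functions.\<close>

lemma rel_path:
  assumes R: "relation \<Gamma> A B R"
  obtains w where "\<Gamma> \<turnstile> w \<Ztypecolon> PathC (Arr (Times A B) U) (bridge_rel (GelLine A B R)) R"
proof -
  have T: "\<Gamma> \<turnstile> Ty Large (Times A B)" by (rule Times_form[OF relationD(1,5,6)[OF R]])
  let ?p = "\<lambda>A B R. gel_path (wk A) (wk B) (wk R) (Fst (Var 0)) (Snd (Var 0))"
  have p: "TmVar (Times A B) # \<Gamma> \<turnstile> ?p A B R \<Ztypecolon>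
      PathC U (BridgeGel (wk A) (wk B) (wk R) (Fst (Var 0)) (Snd (Var 0)))
        (App (wk R) (Pair (Fst (Var 0)) (Snd (Var 0))))"
    if R: "relation \<Gamma> A B R" and T: "\<Gamma> \<turnstile> Ty Large (Times A B)" for \<Gamma> A B R
    using gel_path[OF relation_wk(3)[OF R T] times_var(1,2)] .
  \<comment> \<open>\<open>Var 0\<close> is the pair bound by the lambda and \<open>Var 1\<close>
    the path variable outside it, hence the weakened \<open>A\<close>, \<open>B\<close>,
    \<open>R\<close>.\<close>
  let ?P = "Lam (PApp (?p (wk A) (wk B) (wk R)) (Var 1))"
  have "\<Gamma> \<turnstile> PLam ?P \<Ztypecolon> PathC (Arr (Times A B) U) (bridge_rel (GelLine A B R)) R"
    unfolding PathC_def
  proof (rule path_intro)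
    let ?\<Gamma> = "DimVar Pth # \<Gamma>"
    have R': "relation ?\<Gamma> (wk A) (wk B) (wk R)" by (rule relation_wk(1)[OF R])
    have T': "?\<Gamma> \<turnstile> Ty Large (Times (wk A) (wk B))" by (rule Times_form[OF relationD(1,5,6)[OF R']])
    have "TmVar (Times (wk A) (wk B)) # ?\<Gamma> \<turnstile> PApp (?p (wk A) (wk B) (wk R)) (Var 1) \<Ztypecolon> U"
      using path_elim[OF p[OF R' T', unfolded PathC_def], of "Var 1"]
      by (simp add: dim_var sub_norm)
    from pi_intro[OF T' this] show "?\<Gamma> \<turnstile> ?P \<Ztypecolon> wk (Arr (Times A B) U)"
      by (simp add: sub_norm)
    have e: "TmVar (Times A B) # \<Gamma> \<turnstile> PApp (?p A B R) (Zero Pth)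
      \<doteq> BridgeGel (wk A) (wk B) (wk R) (Fst (Var 0)) (Snd (Var 0)) \<Ztypecolon> U"
      "TmVar (Times A B) # \<Gamma> \<turnstile> PApp (?p A B R) (One Pth)
        \<doteq> App (wk R) (Pair (Fst (Var 0)) (Snd (Var 0))) \<Ztypecolon> U"
      using path_ends(1,2)[OF p[OF R T, unfolded PathC_def]] by (simp_all add: sub_norm)
    have "\<Gamma> \<turnstile> Lam (PApp (?p A B R) (Zero Pth))
      \<doteq> Lam (BridgeGel (wk A) (wk B) (wk R) (Fst (Var 0)) (Snd (Var 0))) \<Ztypecolon> Arr (Times A B) U"
      using pi_intro[OF T e(1)] by (simp add: sub_norm)
    with bridge_rel_GelLine[OF R] have
      "\<Gamma> \<turnstile> Lam (PApp (?p A B R) (Zero Pth)) \<doteq> bridge_rel (GelLine A B R) \<Ztypecolon> Arr (Times A B) U"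
      by (rule tm_trans[OF _ tm_sym, rotated])
    then show "\<Gamma> \<turnstile> ?P\<langle>Zero Pth\<rangle> \<doteq> bridge_rel (GelLine A B R) \<Ztypecolon> (wk (Arr (Times A B) U))\<langle>Zero Pth\<rangle>"
      by (simp add: sub_norm)
    have "\<Gamma> \<turnstile> Lam (PApp (?p A B R) (One Pth)) \<doteq> Lam (App (wk R) (Pair (Fst (Var 0)) (Snd (Var 0))))
      \<Ztypecolon> Arr (Times A B) U"
      using pi_intro[OF T e(2)] by (simp add: sub_norm)
    moreover have "TmVar (Times A B) # \<Gamma> \<turnstile> App (wk R) (Pair (Fst (Var 0)) (Snd (Var 0)))
      \<doteq> App (wk R) (Var 0) \<Ztypecolon> U"
      using app_type_eq[OF relationD(4)[OF relation_wk(3)[OF R T], unfolded Arr_def]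
        tm_sym[OF times_var(3)]] by (simp add: sub_norm)
    from pi_intro[OF T this] have "\<Gamma> \<turnstile> Lam (App (wk R) (Pair (Fst (Var 0)) (Snd (Var 0))))
      \<doteq> Lam (App (wk R) (Var 0)) \<Ztypecolon> Arr (Times A B) U"
      by (simp add: Arr_def ren.simps)
    moreover have "\<Gamma> \<turnstile> Lam (App (wk R) (Var 0)) \<doteq> R \<Ztypecolon> Arr (Times A B) U"
      using tm_sym[OF pi_eta[OF relationD(4)[OF R, unfolded Arr_def]]] by (simp add: Arr_def)
    ultimately have "\<Gamma> \<turnstile> Lam (PApp (?p A B R) (One Pth)) \<doteq> R \<Ztypecolon> Arr (Times A B) U"
      by (rule tm_trans[OF _ tm_trans])
    then show "\<Gamma> \<turnstile> ?P\<langle>One Pth\<rangle> \<doteq> R \<Ztypecolon> (wk (Arr (Times A B) U))\<langle>One Pth\<rangle>"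
      by (simp add: sub_norm)
  qed
  then show ?thesis by (rule that)
qed

lemma bridgetorel_RoundTrip:
  assumes wf: "\<Gamma> \<turnstile> Wf" and A: "\<Gamma> \<turnstile> A \<Ztypecolon> U" and B: "\<Gamma> \<turnstile> B \<Ztypecolon> U"
  obtains w where "\<Gamma> \<turnstile> w \<Ztypecolon> RoundTrip (Arr (Times A B) U) bridgetorel (rel_bridge A B)"
proof -
  let ?T = "Arr (Times A B) U"
  let ?\<Gamma> = "TmVar ?T # \<Gamma>"
  note T = rel_type_form[OF assms]
  note w = weaken_tm[OF wf _ extends_tm[OF extends_refl]]
  have R: "relation ?\<Gamma> (wk A) (wk B) (Var 0)"
    unfolding relation_def using wf_tm[OF wf T] w[OF A] w[OF B] by (simp add: sub_norm tm_var)
  from rel_path[OF this] obtain w where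
    w: "?\<Gamma> \<turnstile> w \<Ztypecolon> PathC (Arr (Times (wk A) (wk B)) U) (bridge_rel (GelLine (wk A) (wk B) (Var 0)))
    (Var 0)" .
  have "\<Gamma> \<turnstile> Lam w \<Ztypecolon> RoundTrip ?T (Lam (bridge_rel (Var 0))) (Lam (GelLine (wk A) (wk B) (Var 0)))"
    using w by (intro lam_RoundTrip[OF wf BridgeU_form[OF A B] T bridgetorel_body[OF assms]
      rel_bridge_body[OF assms]])
      (simp add: sub_norm)
  with that show ?thesis by (simp add: bridgetorel_eq rel_bridge_def)
qed

section \<open>Extending maps of bridges by extent\<close>

text \<open>
  A map from the bridges over \<open>D\<close> to the bridges over \<open>C\<close> is given by a closed combinator
  \<open>\<phi> a b c\<close> that is well-typed in all extensions of \<open>\<Gamma>\<close>. The extensions are needed because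
  \<open>extent\<close> takes place in a context that is restricted by a bridge variable.
\<close>

type_synonym bridge_term = "tm \<Rightarrow> tm \<Rightarrow> tm \<Rightarrow> tm"

definition univ_bridge :: "ctx \<Rightarrow> tm \<Rightarrow> tm \<Rightarrow> tm \<Rightarrow> bool" where
  "univ_bridge \<Gamma> A B C \<longleftrightarrow> (\<Gamma> \<turnstile> Wf) \<and> (\<Gamma> \<turnstile> A \<Ztypecolon> U) \<and> (\<Gamma> \<turnstile> B \<Ztypecolon> U) \<and> (\<Gamma> \<turnstile> C \<Ztypecolon> BridgeC U A B)"

lemma univ_bridgeD:
  assumes "univ_bridge \<Gamma> A B C"
  shows "\<Gamma> \<turnstile> Wf" "\<Gamma> \<turnstile> A \<Ztypecolon> U" "\<Gamma> \<turnstile> B \<Ztypecolon> U" "\<Gamma> \<turnstile> C \<Ztypecolon> BridgeC U A B" "\<Gamma> \<turnstile> Ty l A" "\<Gamma> \<turnstile> Ty l B"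
  using assms by (simp_all add: univ_bridge_def ty_of_univ)

lemma univ_bridge_weaken:
  assumes C: "univ_bridge \<Gamma> A B C" and e: "extends k \<Delta> \<Gamma>" and wf: "\<Delta> \<turnstile> Wf"
  shows "univ_bridge \<Delta> (sub (shift k) A) (sub (shift k) B) (sub (shift k) C)"
  unfolding univ_bridge_def
  using univ_bridgeD(2,3,4)[OF C, THEN weaken_tm[OF univ_bridgeD(1)[OF C] _ e]] wf
  by (simp add: sub_norm)

lemma extends_trans: "\<lbrakk>extends j \<Theta> \<Delta>; extends k \<Delta> \<Gamma>\<rbrakk> \<Longrightarrow> extends (k + j) \<Theta> \<Gamma>"
  by (induction rule: extends.induct) (auto intro: extends.intros)

definition bridge_map :: "ctx \<Rightarrow> tm \<Rightarrow> tm \<Rightarrow> tm \<Rightarrow> tm \<Rightarrow> bridge_term \<Rightarrow> bool" where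
  "bridge_map \<Gamma> A B D C \<phi> \<longleftrightarrow> univ_bridge \<Gamma> A B D \<and> univ_bridge \<Gamma> A B C \<and>
     (\<forall>\<sigma> a b c. sub \<sigma> (\<phi> a b c) = \<phi> (sub \<sigma> a) (sub \<sigma> b) (sub \<sigma> c)) \<and>
     (\<forall>k \<Delta> a a' b b' c c'. extends k \<Delta> \<Gamma> \<longrightarrow> (\<Delta> \<turnstile> Wf) \<longrightarrow> (\<Delta> \<turnstile> a \<doteq> a' \<Ztypecolon> sub (shift k) A) \<longrightarrow>
       (\<Delta> \<turnstile> b \<doteq> b' \<Ztypecolon> sub (shift k) B)
       \<longrightarrow> (\<Delta> \<turnstile> c \<doteq> c' \<Ztypecolon> BridgeOver (sub (shift k) D) a b) \<longrightarrow>
         (\<Delta> \<turnstile> \<phi> a b c \<doteq> \<phi> a' b' c' \<Ztypecolon> BridgeOver (sub (shift k) C) a b))"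

lemma bridge_mapD:
  assumes "bridge_map \<Gamma> A B D C \<phi>"
  shows "univ_bridge \<Gamma> A B D" "univ_bridge \<Gamma> A B C"
    "sub \<sigma> (\<phi> a b c) = \<phi> (sub \<sigma> a) (sub \<sigma> b) (sub \<sigma> c)"
    "\<lbrakk>\<Gamma> \<turnstile> a \<doteq> a' \<Ztypecolon> A; \<Gamma> \<turnstile> b \<doteq> b' \<Ztypecolon> B; \<Gamma> \<turnstile> c \<doteq> c' \<Ztypecolon> BridgeOver D a b\<rbrakk> \<Longrightarrow> \<Gamma> \<turnstile> \<phi> a b c \<doteq> \<phi> a' b' c'
      \<Ztypecolon> BridgeOver C a b"
proof -
  show "univ_bridge \<Gamma> A B D" "univ_bridge \<Gamma> A B C"
    "sub \<sigma> (\<phi> a b c) = \<phi> (sub \<sigma> a) (sub \<sigma> b) (sub \<sigma> c)"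
    using assms unfolding bridge_map_def by blast+
  show "\<lbrakk>\<Gamma> \<turnstile> a \<doteq> a' \<Ztypecolon> A; \<Gamma> \<turnstile> b \<doteq> b' \<Ztypecolon> B; \<Gamma> \<turnstile> c \<doteq> c' \<Ztypecolon> BridgeOver D a b\<rbrakk> \<Longrightarrow> \<Gamma> \<turnstile> \<phi> a b c \<doteq> \<phi> a' b' c'
    \<Ztypecolon> BridgeOver C a b"
    using assms extends_refl[of \<Gamma>] unfolding bridge_map_def univ_bridge_def by (metis sub_shift_0)
qed

lemma bridge_map_weaken:
  assumes "bridge_map \<Gamma> A B D C \<phi>" "extends k \<Delta> \<Gamma>" "\<Delta> \<turnstile> Wf"
  shows "bridge_map \<Delta> (sub (shift k) A) (sub (shift k) B) (sub (shift k) D) (sub (shift k) C) \<phi>"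
  unfolding bridge_map_def
proof (intro conjI allI impI)
  show "univ_bridge \<Delta> (sub (shift k) A) (sub (shift k) B) (sub (shift k) D)"
    "univ_bridge \<Delta> (sub (shift k) A) (sub (shift k) B) (sub (shift k) C)"
    by (rule univ_bridge_weaken[OF bridge_mapD(1)[OF assms(1)] assms(2,3)] univ_bridge_weaken[OF
      bridge_mapD(2)[OF assms(1)] assms(2,3)])+
  show "sub \<sigma> (\<phi> a b c) = \<phi> (sub \<sigma> a) (sub \<sigma> b) (sub \<sigma> c)" for \<sigma> a b c
    by (rule bridge_mapD(3)[OF assms(1)])
  fix j \<Theta> a a' b b' c c'
  assume "extends j \<Theta> \<Delta>" and h: "\<Theta> \<turnstile> Wf" "\<Theta> \<turnstile> a \<doteq> a' \<Ztypecolon> sub (shift j) (sub (shift k) A)"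
    "\<Theta> \<turnstile> b \<doteq> b' \<Ztypecolon> sub (shift j) (sub (shift k) B)"
    "\<Theta> \<turnstile> c \<doteq> c' \<Ztypecolon> BridgeOver (sub (shift j) (sub (shift k) D)) a b"
  then have "extends (k + j) \<Theta> \<Gamma>" using extends_trans assms(2) by blast
  moreover have s: "sub (shift j) (sub (shift k) M) = sub (shift (k + j)) M" for M
    by (simp add: sub_norm)
  ultimately show "\<Theta> \<turnstile> \<phi> a b c \<doteq> \<phi> a' b' c' \<Ztypecolon> BridgeOver (sub (shift j) (sub (shift k) C)) a b"
    using assms(1) h unfolding bridge_map_def s by blast
qed

lemma univ_bridge_wk:
  assumes "univ_bridge \<Gamma> A B C"
  shows "univ_bridge (DimVar k # \<Gamma>) (wk A) (wk B) (wk C)"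
    "univ_bridge (Dead # \<Gamma>) (wk A) (wk B) (wk C)"
    "\<Gamma> \<turnstile> Ty Large T \<Longrightarrow> univ_bridge (TmVar T # \<Gamma>) (wk A) (wk B) (wk C)"
  unfolding wk_shift using univ_bridgeD(1)[OF assms]
  by (auto intro!: univ_bridge_weaken[OF assms] extends.intros wf_dim wf_dead wf_tm)

lemma bridge_map_wk:
  assumes "bridge_map \<Gamma> A B D C \<phi>"
  shows "bridge_map (DimVar k # \<Gamma>) (wk A) (wk B) (wk D) (wk C) \<phi>"
    "bridge_map (Dead # \<Gamma>) (wk A) (wk B) (wk D) (wk C) \<phi>"
    "\<Gamma> \<turnstile> Ty Large T \<Longrightarrow> bridge_map (TmVar T # \<Gamma>) (wk A) (wk B) (wk D) (wk C) \<phi>"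
  unfolding wk_shift using univ_bridgeD(1)[OF bridge_mapD(1)[OF assms]]
  by (auto intro!: bridge_map_weaken[OF assms] extends.intros wf_dim wf_dead wf_tm)

section \<open>Elimination of bridges over a line, and functions between lines by extent\<close>

lemma BridgeOver_app:
  assumes "\<Gamma> \<turnstile> Dim Brg r" "restr \<Gamma> r \<turnstile> c \<doteq> c' \<Ztypecolon> BridgeOver C a b"
  shows "\<Gamma> \<turnstile> BApp c r \<doteq> BApp c' r \<Ztypecolon> BApp C r"
  using bridge_elim[OF assms(1) assms(2)[unfolded BridgeOver_def]] by (simp add: sub_norm)

lemma BridgeOver_ends:
  assumes C: "univ_bridge \<Gamma> A B C" and c: "\<Gamma> \<turnstile> c \<Ztypecolon> BridgeOver C a b"
  shows "\<Gamma> \<turnstile> BApp c (Zero Brg) \<doteq> a \<Ztypecolon> A" "\<Gamma> \<turnstile> BApp c (One Brg) \<doteq> b \<Ztypecolon> B"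
  using bridge_zero[OF c[unfolded BridgeOver_def]] bridge_one[OF c[unfolded BridgeOver_def]]
    BridgeC_conv[OF univ_bridgeD(4)[OF C]]
  by (simp_all add: sub_norm)

lemma line_form:
  assumes C: "univ_bridge \<Gamma> A B C"
  shows "DimVar Brg # \<Gamma> \<turnstile> BApp (wk C) (Var 0) \<Ztypecolon> U"
  by (rule BridgeC_line[OF univ_bridgeD(1,4)[OF C]])

text \<open>The context of the last premise of \<open>extent_cases\<close> for the line
  \<open>D\<close>: indices 2, 1 and 0 are the two end points and the bridge between them.\<close>

definition extent_ctx :: "tm \<Rightarrow> ctx \<Rightarrow> ctx" where
  "extent_ctx D \<Gamma> = TmVar (BridgeOver (wk (wk D)) (Var 1) (Var 0)) # TmVar (BApp (wk D) (One Brg)) #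
    TmVar (BApp D (Zero Brg)) # \<Gamma>"

lemma extent_ctx:
  assumes D: "univ_bridge \<Gamma> A B D"
  shows "extent_ctx D \<Gamma> \<turnstile> Wf" "extent_ctx D \<Gamma> \<turnstile> Var 0
      \<Ztypecolon> BridgeOver (sub (shift 3) D) (Var 2) (Var 1)"
    "extent_ctx D \<Gamma> \<turnstile> Var 1 \<Ztypecolon> sub (shift 3) B" "extent_ctx D \<Gamma> \<turnstile> Var 2 \<Ztypecolon> sub (shift 3) A"
    "extends 3 (extent_ctx D \<Gamma>) \<Gamma>"
proof -
  note e0 = BridgeC_ends[OF univ_bridgeD(4)[OF D]]
  let ?\<Gamma>1 = "TmVar (BApp D (Zero Brg)) # \<Gamma>"
  let ?\<Gamma>2 = "TmVar (BApp (wk D) (One Brg)) # ?\<Gamma>1"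
  note D1 = univ_bridge_wk(3)[OF D ty_of_univ[OF tm_refl_left[OF e0(1)]]]
  note e1 = BridgeC_ends[OF univ_bridgeD(4)[OF D1]]
  note D2 = univ_bridge_wk(3)[OF D1 ty_of_univ[OF tm_refl_left[OF e1(2)]]]
  note e2 = BridgeC_ends[OF univ_bridgeD(4)[OF D2]]
  have v: "?\<Gamma>2 \<turnstile> Var 0 \<Ztypecolon> wk (wk B)" "?\<Gamma>2 \<turnstile> Var 1 \<Ztypecolon> wk (wk A)"
    by (rule tm_conv_univ[OF _ e2(2)] tm_conv_univ[OF _ e2(1)]; rule tm_var; simp add: sub_norm)+
  note T = BridgeOver_form[OF univ_bridgeD(1,4)[OF D2] v(2,1)]
  note D3 = univ_bridge_wk(3)[OF D2 ty_of_univ[OF T]]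
  show "extent_ctx D \<Gamma> \<turnstile> Wf" using univ_bridgeD(1)[OF D3] by (simp add: extent_ctx_def)
  show "extent_ctx D \<Gamma> \<turnstile> Var 0 \<Ztypecolon> BridgeOver (sub (shift 3) D) (Var 2) (Var 1)"
    by (rule tm_var) (simp add: sub_norm extent_ctx_def)
  note e3 = BridgeC_ends[OF univ_bridgeD(4)[OF D3]]
  have "extent_ctx D \<Gamma> \<turnstile> Var 1 \<Ztypecolon> wk (wk (wk B))"
    unfolding extent_ctx_def by (rule tm_conv_univ[OF _ e3(2)], rule tm_var) (simp add: sub_norm)
  moreover have "extent_ctx D \<Gamma> \<turnstile> Var 2 \<Ztypecolon> wk (wk (wk A))"
    unfolding extent_ctx_def by (rule tm_conv_univ[OF _ e3(1)], rule tm_var) (simp add: sub_norm)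
  ultimately show "extent_ctx D \<Gamma> \<turnstile> Var 1 \<Ztypecolon> sub (shift 3) B"
    "extent_ctx D \<Gamma> \<turnstile> Var 2 \<Ztypecolon> sub (shift 3) A"
    by (simp_all add: sub_norm)
  show "extends 3 (extent_ctx D \<Gamma>) \<Gamma>" unfolding extent_ctx_def
    by (simp add: eval_nat_numeral extends.intros)
qed

text \<open>The identity can be used at both ends because the two lines have judgementally equal
  ends; only the bridge case involves \<open>\<phi>\<close>.\<close>

definition extent_map :: "bridge_term \<Rightarrow> tm \<Rightarrow> tm \<Rightarrow> tm" where
  "extent_map \<phi> r M = Extent r M (Var 0) (Var 0) (\<phi> (Var 2) (Var 1) (Var 0))"

lemma extent_map_sub:
  assumes "bridge_map \<Gamma> A B D C \<phi>"
  shows "sub \<sigma> (extent_map \<phi> r M) = extent_map \<phi> (sub \<sigma> r) (sub \<sigma> M)"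
  by (simp add: extent_map_def sub_norm bridge_mapD(3)[OF assms])

lemma line_ends_var:
  assumes C: "univ_bridge \<Gamma> A B C" and D: "univ_bridge \<Gamma> A B D"
  shows "TmVar (BApp D (Zero Brg)) # \<Gamma> \<turnstile> Var 0 \<Ztypecolon> BApp (wk C) (Zero Brg)"
    "TmVar (BApp D (One Brg)) # \<Gamma> \<turnstile> Var 0 \<Ztypecolon> BApp (wk C) (One Brg)"
proof -
  note e = BridgeC_ends[OF univ_bridgeD(4)[OF D]]
  note T0 = ty_of_univ[OF tm_refl_left[OF e(1)]] and T1 = ty_of_univ[OF tm_refl_left[OF e(2)]]
  note D0 = BridgeC_ends(1)[OF univ_bridgeD(4)[OF univ_bridge_wk(3)[OF D T0]]]
  note D1 = BridgeC_ends(2)[OF univ_bridgeD(4)[OF univ_bridge_wk(3)[OF D T1]]]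
  note C0 = BridgeC_ends(1)[OF univ_bridgeD(4)[OF univ_bridge_wk(3)[OF C T0]]]
  note C1 = BridgeC_ends(2)[OF univ_bridgeD(4)[OF univ_bridge_wk(3)[OF C T1]]]
  show "TmVar (BApp D (Zero Brg)) # \<Gamma> \<turnstile> Var 0 \<Ztypecolon> BApp (wk C) (Zero Brg)"
    by (rule tm_conv_univ[OF _ tm_sym[OF C0]], rule tm_conv_univ[OF _ D0], rule tm_var)
      (simp add: sub_norm)
  show "TmVar (BApp D (One Brg)) # \<Gamma> \<turnstile> Var 0 \<Ztypecolon> BApp (wk C) (One Brg)"
    by (rule tm_conv_univ[OF _ tm_sym[OF C1]], rule tm_conv_univ[OF _ D1], rule tm_var)
      (simp add: sub_norm)
qed

lemma extent_map_cases:
  assumes m: "bridge_map \<Gamma> A B D C \<phi>"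
  defines "Q \<equiv> \<phi> (Var 2) (Var 1) (Var 0)"
  shows "\<Gamma> \<turnstile> ExtentCases (BApp (wk D) (Var 0)) (BApp (wk (wk C)) (Var 1)) (Var 0) (Var 0) Q (Var 0)
      (Var 0) Q"
proof (rule extent_cases)
  note D = bridge_mapD(1)[OF m] and C = bridge_mapD(2)[OF m]
  show L: "DimVar Brg # \<Gamma> \<turnstile> Ty Large (BApp (wk D) (Var 0))" by (rule ty_of_univ[OF line_form[OF D]])
  show "TmVar (BApp (wk D) (Var 0)) # DimVar Brg # \<Gamma> \<turnstile> Ty Large (BApp (wk (wk C)) (Var 1))"
    using univ_bridgeD(4)[OF univ_bridge_wk(2)[OF univ_bridge_wk(2)[OF C]]]
    by (intro ty_of_univ BridgeC_app) (simp_all add: dim_var)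
  show "TmVar (BApp (wk D) (Var 0))\<langle>Zero Brg\<rangle> # \<Gamma> \<turnstile> Var 0
    \<Ztypecolon> sub (Var 0 \<bullet> Zero Brg \<bullet> (\<lambda>n. Var (n + 1))) (BApp (wk (wk C)) (Var 1))"
    using line_ends_var(1)[OF C D] by (simp add: sub_norm)
  show "TmVar (BApp (wk D) (Var 0))\<langle>One Brg\<rangle> # \<Gamma> \<turnstile> Var 0 \<Ztypecolon> sub (Var 0 \<bullet> One Brg \<bullet> (\<lambda>n. Var (n + 1)))
    (BApp (wk (wk C)) (Var 1))"
    using line_ends_var(2)[OF C D] by (simp add: sub_norm)
  \<comment> \<open>Here \<open>\<phi>\<close> acts on three variables, in an extension of the given
    context.\<close>
  have "extent_ctx D \<Gamma> \<turnstile> Q \<Ztypecolon> BridgeOver (sub (shift 3) C) (Var 2) (Var 1)"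
    unfolding Q_def using extent_ctx[OF D] by (intro bridge_mapD(4)[OF bridge_map_weaken[OF m]])
  then show "TmVar (Bridge (ren (upr (\<lambda>n. n + 2)) (BApp (wk D) (Var 0))) (Var 1) (Var 0)) #
    TmVar (wk (BApp (wk D) (Var 0))\<langle>One Brg\<rangle>) # TmVar (BApp (wk D) (Var 0))\<langle>Zero Brg\<rangle> # \<Gamma> \<turnstile>
    Q \<Ztypecolon> Bridge (sub (BApp (Var 1) (Var 0) \<bullet> Var 0 \<bullet> (\<lambda>n. Var (n + 4))) (BApp (wk (wk C)) (Var 1)))
           (sub (Var 2 \<bullet> (\<lambda>n. Var (n + 3))) (Var 0)) (sub (Var 1 \<bullet> (\<lambda>n. Var (n + 3))) (Var 0))"
    unfolding extent_ctx_def BridgeOver_def by (simp add: sub_norm)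
qed

text \<open>\<open>M\<close> is typed in the full context and may mention \<open>r\<close>; only the
  map of bridges has to be apart from \<open>r\<close>.\<close>

lemma extent_map:
  assumes r: "\<Gamma> \<turnstile> Dim Brg r" and m: "bridge_map (restr \<Gamma> r) A B D C \<phi>"
      and M: "\<Gamma> \<turnstile> M \<doteq> M' \<Ztypecolon> BApp D r"
  shows "\<Gamma> \<turnstile> extent_map \<phi> r M \<doteq> extent_map \<phi> r M' \<Ztypecolon> BApp C r"
  using extent[OF r _ extent_map_cases[OF m], of M M'] M by (simp add: sub_norm extent_map_def)

lemma extent_map_ends:
  assumes m: "bridge_map \<Gamma> A B D C \<phi>"
  shows "\<Gamma> \<turnstile> M \<Ztypecolon> A \<Longrightarrow> \<Gamma> \<turnstile> extent_map \<phi> (Zero Brg) M \<doteq> M \<Ztypecolon> A"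
    "\<Gamma> \<turnstile> M \<Ztypecolon> B \<Longrightarrow> \<Gamma> \<turnstile> extent_map \<phi> (One Brg) M \<doteq> M \<Ztypecolon> B"
proof -
  note D = BridgeC_conv[OF univ_bridgeD(4)[OF bridge_mapD(1)[OF m]]]
    and C = BridgeC_conv[OF univ_bridgeD(4)[OF bridge_mapD(2)[OF m]]]
  show "\<Gamma> \<turnstile> extent_map \<phi> (Zero Brg) M \<doteq> M \<Ztypecolon> A" if "\<Gamma> \<turnstile> M \<Ztypecolon> A"
    using extent_zero[OF _ extent_map_cases[OF m], of M] D(1)[OF that] C(3)
    by (simp add: sub_norm extent_map_def)
  show "\<Gamma> \<turnstile> extent_map \<phi> (One Brg) M \<doteq> M \<Ztypecolon> B" if "\<Gamma> \<turnstile> M \<Ztypecolon> B"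
    using extent_one[OF _ extent_map_cases[OF m], of M] D(2)[OF that] C(4)
    by (simp add: sub_norm extent_map_def)
qed

text \<open>The rule for \<open>extent\<close> hands \<open>\<phi>\<close> the computed ends and the
  eta-expansion of \<open>c\<close>. The congruence of \<open>\<phi>\<close> restores
  \<open>a\<close>, \<open>b\<close> and \<open>c\<close>.\<close>

lemma extent_map_beta:
  assumes r: "\<Gamma> \<turnstile> Dim Brg r" and m: "bridge_map (restr \<Gamma> r) A B D C \<phi>"
      and c: "restr \<Gamma> r \<turnstile> c \<Ztypecolon> BridgeOver D a b"
  shows "\<Gamma> \<turnstile> extent_map \<phi> r (BApp c r) \<doteq> BApp (\<phi> a b c) r \<Ztypecolon> BApp C r"
proof -
  note D = bridge_mapD(1)[OF m]
  note e = BridgeOver_ends[OF D c]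
  have "DimVar Brg # restr \<Gamma> r \<turnstile> BApp (wk c) (Var 0) \<Ztypecolon> BApp (wk D) (Var 0)"
    using weaken_tm[OF univ_bridgeD(1)[OF D] c extends_dead[OF extends_refl]]
    by (intro BridgeOver_app) (simp_all add: dim_var sub_norm)
  from extent_beta[OF r this extent_map_cases[OF m]]
  have "\<Gamma> \<turnstile> extent_map \<phi> r (BApp c r)
    \<doteq> BApp (\<phi> (BApp c (Zero Brg)) (BApp c (One Brg)) (BLam (BApp (wk c) (Var 0)))) r \<Ztypecolon> BApp C r"
    by (simp add: sub_norm extent_map_def bridge_mapD(3)[OF m])
  moreover have "restr \<Gamma> r \<turnstile> BLam (BApp (wk c) (Var 0)) \<doteq> c \<Ztypecolon> BridgeOver D a b"
    using tm_sym[OF bridge_eta[OF c[unfolded BridgeOver_def], folded BridgeOver_def]] .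
  then have "restr \<Gamma> r \<turnstile> BLam (BApp (wk c) (Var 0)) \<doteq> c
    \<Ztypecolon> BridgeOver D (BApp c (Zero Brg)) (BApp c (One Brg))"
    by (rule tm_conv_univ[OF _ tm_sym[OF BridgeOver_form[OF univ_bridgeD(1,4)[OF D] e]]])
  from BridgeOver_app[OF r bridge_mapD(4)[OF m e this]]
  have "\<Gamma> \<turnstile> BApp (\<phi> (BApp c (Zero Brg)) (BApp c (One Brg)) (BLam (BApp (wk c) (Var 0)))) r
    \<doteq> BApp (\<phi> a b c) r \<Ztypecolon> BApp C r" .
  ultimately show ?thesis by (rule tm_trans)
qed

text \<open>The equation is judgemental and one-sided; an isomorphism is used as two retractions
  with the roles exchanged. Quantifying over extensions makes it available under the binders of
  \<open>extent\<close>.\<close>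

definition bridge_retraction :: "ctx \<Rightarrow> tm \<Rightarrow> tm \<Rightarrow> tm \<Rightarrow> tm \<Rightarrow> bridge_term \<Rightarrow> bridge_term \<Rightarrow> bool" where
  "bridge_retraction \<Gamma> A B D C \<phi> \<psi> \<longleftrightarrow> bridge_map \<Gamma> A B D C \<phi> \<and> bridge_map \<Gamma> A B C D \<psi> \<and>
     (\<forall>k \<Delta> a b c. extends k \<Delta> \<Gamma> \<longrightarrow> (\<Delta> \<turnstile> Wf) \<longrightarrow> (\<Delta> \<turnstile> a \<Ztypecolon> sub (shift k) A) \<longrightarrow> (\<Delta> \<turnstile> b \<Ztypecolon> sub (shift k) B)
       \<longrightarrow> (\<Delta> \<turnstile> c \<Ztypecolon> BridgeOver (sub (shift k) D) a b) \<longrightarrow>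
         (\<Delta> \<turnstile> \<psi> a b (\<phi> a b c) \<doteq> c \<Ztypecolon> BridgeOver (sub (shift k) D) a b))"

lemma bridge_retractionD:
  assumes "bridge_retraction \<Gamma> A B D C \<phi> \<psi>"
  shows "bridge_map \<Gamma> A B D C \<phi>" "bridge_map \<Gamma> A B C D \<psi>"
    "\<lbrakk>\<Gamma> \<turnstile> a \<Ztypecolon> A; \<Gamma> \<turnstile> b \<Ztypecolon> B; \<Gamma> \<turnstile> c \<Ztypecolon> BridgeOver D a b\<rbrakk> \<Longrightarrow> \<Gamma> \<turnstile> \<psi> a b (\<phi> a b c) \<doteq> c \<Ztypecolon> BridgeOver D a b"
proof -
  show m: "bridge_map \<Gamma> A B D C \<phi>" "bridge_map \<Gamma> A B C D \<psi>" using assms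
    unfolding bridge_retraction_def by blast+
  show "\<lbrakk>\<Gamma> \<turnstile> a \<Ztypecolon> A; \<Gamma> \<turnstile> b \<Ztypecolon> B; \<Gamma> \<turnstile> c \<Ztypecolon> BridgeOver D a b\<rbrakk> \<Longrightarrow> \<Gamma> \<turnstile> \<psi> a b (\<phi> a b c) \<doteq> c
    \<Ztypecolon> BridgeOver D a b"
    using assms extends_refl[of \<Gamma>] univ_bridgeD(1)[OF bridge_mapD(1)[OF m(1)]]
      unfolding bridge_retraction_def by (metis sub_shift_0)
qed

lemma bridge_retraction_weaken:
  assumes "bridge_retraction \<Gamma> A B D C \<phi> \<psi>" "extends k \<Delta> \<Gamma>" "\<Delta> \<turnstile> Wf"
  shows "bridge_retraction \<Delta> (sub (shift k) A) (sub (shift k) B) (sub (shift k) D) (sub (shift k) C)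
      \<phi> \<psi>"
  unfolding bridge_retraction_def
proof (intro conjI allI impI)
  show "bridge_map \<Delta> (sub (shift k) A) (sub (shift k) B) (sub (shift k) D) (sub (shift k) C) \<phi>"
    "bridge_map \<Delta> (sub (shift k) A) (sub (shift k) B) (sub (shift k) C) (sub (shift k) D) \<psi>"
    using bridge_retractionD(1,2)[OF assms(1)] by (auto intro: bridge_map_weaken assms(2,3))
  fix j \<Theta> a b c
  assume "extends j \<Theta> \<Delta>" and h: "\<Theta> \<turnstile> Wf" "\<Theta> \<turnstile> a \<Ztypecolon> sub (shift j) (sub (shift k) A)"
    "\<Theta> \<turnstile> b \<Ztypecolon> sub (shift j) (sub (shift k) B)"
    "\<Theta> \<turnstile> c \<Ztypecolon> BridgeOver (sub (shift j) (sub (shift k) D)) a b"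
  then have "extends (k + j) \<Theta> \<Gamma>" using extends_trans assms(2) by blast
  moreover have s: "sub (shift j) (sub (shift k) M) = sub (shift (k + j)) M" for M
    by (simp add: sub_norm)
  ultimately show "\<Theta> \<turnstile> \<psi> a b (\<phi> a b c) \<doteq> c \<Ztypecolon> BridgeOver (sub (shift j) (sub (shift k) D)) a b"
    using assms(1) h unfolding bridge_retraction_def s by blast
qed

lemma bridge_retraction_wk:
  assumes "bridge_retraction \<Gamma> A B D C \<phi> \<psi>"
  shows "bridge_retraction (DimVar k # \<Gamma>) (wk A) (wk B) (wk D) (wk C) \<phi> \<psi>"
    "bridge_retraction (Dead # \<Gamma>) (wk A) (wk B) (wk D) (wk C) \<phi> \<psi>"
    "\<Gamma> \<turnstile> Ty Large T \<Longrightarrow> bridge_retraction (TmVar T # \<Gamma>) (wk A) (wk B) (wk D) (wk C) \<phi> \<psi>"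
  unfolding wk_shift using univ_bridgeD(1)[OF bridge_mapD(1)[OF bridge_retractionD(1)[OF assms]]]
  by (auto intro!: bridge_retraction_weaken[OF assms] extends.intros wf_dim wf_dead wf_tm)

lemma extent_map_round:
  assumes r: "\<Gamma> \<turnstile> Dim Brg r" and i: "bridge_retraction (restr \<Gamma> r) A B D C \<phi> \<psi>"
      and c: "restr \<Gamma> r \<turnstile> c \<Ztypecolon> BridgeOver D a b"
  shows "\<Gamma> \<turnstile> extent_map \<psi> r (extent_map \<phi> r (BApp c r)) \<doteq> BApp c r \<Ztypecolon> BApp D r"
proof -
  note m = bridge_retractionD(1,2)[OF i]
  note e = BridgeOver_ends[OF bridge_mapD(1)[OF m(1)] c]
  note ab = tm_refl_right[OF e(1)] tm_refl_right[OF e(2)]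
  note 1 = extent_map[OF r m(2) extent_map_beta[OF r m(1) c]]
  note 2 = extent_map_beta[OF r m(2) bridge_mapD(4)[OF m(1) ab c]]
  note 3 = BridgeOver_app[OF r bridge_retractionD(3)[OF i ab c]]
  show ?thesis by (rule tm_trans[OF 1 tm_trans[OF 2 3]])
qed

lemma extent_map_round_ends:
  assumes i: "bridge_retraction \<Gamma> A B D C \<phi> \<psi>"
  shows "\<Gamma> \<turnstile> M \<Ztypecolon> BApp D (Zero Brg) \<Longrightarrow> \<Gamma> \<turnstile> extent_map \<psi> (Zero Brg) (extent_map \<phi> (Zero Brg) M) \<doteq> M
      \<Ztypecolon> BApp D (Zero Brg)"
    "\<Gamma> \<turnstile> M \<Ztypecolon> BApp D (One Brg) \<Longrightarrow> \<Gamma> \<turnstile> extent_map \<psi> (One Brg) (extent_map \<phi> (One Brg) M) \<doteq> M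
      \<Ztypecolon> BApp D (One Brg)"
proof -
  note m = bridge_retractionD(1,2)[OF i]
  note D = BridgeC_conv[OF univ_bridgeD(4)[OF bridge_mapD(1)[OF m(1)]]]
    and C = BridgeC_conv[OF univ_bridgeD(4)[OF bridge_mapD(2)[OF m(1)]]]
  show "\<Gamma> \<turnstile> extent_map \<psi> (Zero Brg) (extent_map \<phi> (Zero Brg) M) \<doteq> M \<Ztypecolon> BApp D (Zero Brg)"
    if M: "\<Gamma> \<turnstile> M \<Ztypecolon> BApp D (Zero Brg)"
  proof -
    note 1 = extent_map_ends(1)[OF m(1) D(3)[OF M]]
    show ?thesis by (rule D(1)[OF tm_trans[OF extent_map_ends(1)[OF m(2) tm_refl_left[OF 1]] 1]])
  qed
  show "\<Gamma> \<turnstile> extent_map \<psi> (One Brg) (extent_map \<phi> (One Brg) M) \<doteq> M \<Ztypecolon> BApp D (One Brg)"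
    if M: "\<Gamma> \<turnstile> M \<Ztypecolon> BApp D (One Brg)"
  proof -
    note 1 = extent_map_ends(2)[OF m(1) D(4)[OF M]]
    show ?thesis by (rule D(2)[OF tm_trans[OF extent_map_ends(2)[OF m(2) tm_refl_left[OF 1]] 1]])
  qed
qed

text \<open>
  If \<open>\<psi>\<close> is a strict left inverse of \<open>\<phi>\<close>, then the roundtrip of their extents is equal to the
  identity strictly on terms of the form \<open>c r\<close>, and hence, by another extent of reflexivities, up
  to a path on all terms. The term does not depend on \<open>\<phi>\<close> and \<open>\<psi>\<close>.
\<close>

definition extent_refl :: "tm \<Rightarrow> tm \<Rightarrow> tm" where
  "extent_refl r M = Extent r M (PLam (Var 1)) (PLam (Var 1)) (BLam (PLam (BApp (Var 2) (Var 1))))"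

lemma extent_refl_sub [simp]: "sub \<sigma> (extent_refl r M) = extent_refl (sub \<sigma> r) (sub \<sigma> M)"
  by (simp add: extent_refl_def sub_norm)

lemma PathC_form:
  assumes wf: "\<Gamma> \<turnstile> Wf" and A: "\<Gamma> \<turnstile> Ty l A" and a: "\<Gamma> \<turnstile> a \<Ztypecolon> A" and b: "\<Gamma> \<turnstile> b \<Ztypecolon> A"
  shows "\<Gamma> \<turnstile> Ty l (PathC A a b)"
  unfolding PathC_def using weaken_ty[OF wf A extends_dim[OF extends_refl]] a b
  by (intro path_form) (simp_all add: sub_norm)

lemma path_refl_cong:
  assumes wf: "\<Gamma> \<turnstile> Wf" and A: "\<Gamma> \<turnstile> Ty Large A" and a: "\<Gamma> \<turnstile> a \<doteq> a' \<Ztypecolon> A" and a': "\<Gamma> \<turnstile> a' \<doteq> a'' \<Ztypecolon> A"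
  shows "\<Gamma> \<turnstile> PLam (wk a') \<doteq> PLam (wk a'') \<Ztypecolon> PathC A a a'"
  using path_conv[OF path_refl[OF wf a', unfolded PathC_def], of "wk A" a a']
    weaken_ty[OF wf A extends_dim[OF extends_refl]] a tm_refl_right[OF a]
      by (simp add: sub_norm PathC_def tm_sym)

lemma extent_refl_cases:
  assumes i: "bridge_retraction \<Gamma> A B D C \<phi> \<psi>"
  defines "Q \<equiv> BLam (PLam (BApp (Var 2) (Var 1)))"
  shows "\<Gamma> \<turnstile> ExtentCases (BApp (wk D) (Var 0)) (PathC (BApp (wk (wk D)) (Var 1))
      (extent_map \<psi> (Var 1) (extent_map \<phi> (Var 1) (Var 0))) (Var 0))
    (PLam (Var 1)) (PLam (Var 1)) Q (PLam (Var 1)) (PLam (Var 1)) Q"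
proof (rule extent_cases)
  note m = bridge_retractionD(1,2)[OF i]
  note D = bridge_mapD(1)[OF m(1)]
  note wf = univ_bridgeD(1)[OF D]
  note s = extent_map_sub[OF m(1)] extent_map_sub[OF m(2)]
  note e = BridgeC_ends[OF univ_bridgeD(4)[OF D]]
  show L: "DimVar Brg # \<Gamma> \<turnstile> Ty Large (BApp (wk D) (Var 0))" by (rule ty_of_univ[OF line_form[OF D]])
  let ?\<Gamma>x = "TmVar (BApp (wk D) (Var 0)) # DimVar Brg # \<Gamma>"
  have wfx: "?\<Gamma>x \<turnstile> Wf" by (rule wf_tm[OF wf_dim[OF wf] L])
  have d1: "?\<Gamma>x \<turnstile> Dim Brg (Var 1)" by (simp add: dim_var)
  have Tx: "?\<Gamma>x \<turnstile> Ty Large (BApp (wk (wk D)) (Var 1))"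
    using univ_bridgeD(4)[OF univ_bridge_wk(2)[OF univ_bridge_wk(2)[OF D]]]
    by (intro ty_of_univ BridgeC_app) (simp_all add: dim_var)
  have v: "?\<Gamma>x \<turnstile> Var 0 \<Ztypecolon> BApp (wk (wk D)) (Var 1)" by (rule tm_var) (simp add: sub_norm)
  note mm = bridge_map_wk(2)[OF bridge_map_wk(2)[OF m(1)]]
    bridge_map_wk(2)[OF bridge_map_wk(2)[OF m(2)]]
  have "?\<Gamma>x \<turnstile> extent_map \<psi> (Var 1) (extent_map \<phi> (Var 1) (Var 0)) \<Ztypecolon> BApp (wk (wk D)) (Var 1)"
    using extent_map[OF d1 _ extent_map[OF d1 _ v]] mm by simp
  then show "?\<Gamma>x \<turnstile> Ty Large (PathC (BApp (wk (wk D)) (Var 1)) (extent_map \<psi> (Var 1)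
    (extent_map \<phi> (Var 1) (Var 0))) (Var 0))"
    by (rule PathC_form[OF wfx Tx _ v])
  show "TmVar (BApp (wk D) (Var 0))\<langle>Zero Brg\<rangle> # \<Gamma> \<turnstile> PLam (Var 1)
    \<Ztypecolon> sub (Var 0 \<bullet> Zero Brg \<bullet> (\<lambda>n. Var (n + 1)))
    (PathC (BApp (wk (wk D)) (Var 1)) (extent_map \<psi> (Var 1) (extent_map \<phi> (Var 1) (Var 0)))
      (Var 0))"
  proof -
    note T = ty_of_univ[OF tm_refl_left[OF e(1)]]
    note D0 = univ_bridge_wk(3)[OF D T]
    have "TmVar (BApp D (Zero Brg)) # \<Gamma> \<turnstile> Var 0 \<Ztypecolon> BApp (wk D) (Zero Brg)"
      by (rule tm_var) (simp add: sub_norm)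
    from path_refl_eq[OF univ_bridgeD(1)[OF D0]
      ty_of_univ[OF tm_refl_left[OF BridgeC_ends(1)[OF univ_bridgeD(4)[OF D0]]]]
      extent_map_round_ends(1)[OF bridge_retraction_wk(3)[OF i T] this]]
    show ?thesis by (simp add: sub_norm s)
  qed
  show "TmVar (BApp (wk D) (Var 0))\<langle>One Brg\<rangle> # \<Gamma> \<turnstile> PLam (Var 1)
    \<Ztypecolon> sub (Var 0 \<bullet> One Brg \<bullet> (\<lambda>n. Var (n + 1)))
    (PathC (BApp (wk (wk D)) (Var 1)) (extent_map \<psi> (Var 1) (extent_map \<phi> (Var 1) (Var 0)))
      (Var 0))"
  proof -
    note T = ty_of_univ[OF tm_refl_left[OF e(2)]]
    note D0 = univ_bridge_wk(3)[OF D T]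
    have "TmVar (BApp D (One Brg)) # \<Gamma> \<turnstile> Var 0 \<Ztypecolon> BApp (wk D) (One Brg)"
      by (rule tm_var) (simp add: sub_norm)
    from path_refl_eq[OF univ_bridgeD(1)[OF D0]
      ty_of_univ[OF tm_refl_left[OF BridgeC_ends(2)[OF univ_bridgeD(4)[OF D0]]]]
      extent_map_round_ends(2)[OF bridge_retraction_wk(3)[OF i T] this]]
    show ?thesis by (simp add: sub_norm s)
  qed
  let ?\<Delta> = "extent_ctx D \<Gamma>"
  note b = extent_ctx[OF D]
  let ?D = "sub (shift 3) D"
  have i3: "bridge_retraction ?\<Delta> (sub (shift 3) A) (sub (shift 3) B) ?D (sub (shift 3) C) \<phi> \<psi>"
    by (rule bridge_retraction_weaken[OF i b(5,1)])
  note D3 = bridge_mapD(1)[OF bridge_retractionD(1)[OF i3]]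
  note e3 = BridgeOver_ends[OF D3 b(2)]
  note D3c = BridgeC_conv[OF univ_bridgeD(4)[OF D3]]
  note D3e = BridgeC_ends[OF univ_bridgeD(4)[OF D3]]
  let ?P = "\<lambda>r c. PathC (BApp ?D r) (extent_map \<psi> r (extent_map \<phi> r c)) c"
  have "?\<Delta> \<turnstile> Q \<Ztypecolon> Bridge (PathC (BApp (wk ?D) (Var 0)) (extent_map \<psi> (Var 0) (extent_map \<phi> (Var 0)
    (BApp (Var 1) (Var 0)))) (BApp (Var 1) (Var 0)))
     (PLam (Var 3)) (PLam (Var 2))"
    unfolding Q_def
  proof (rule bridge_intro)
    have c: "Dead # ?\<Delta> \<turnstile> Var 1 \<Ztypecolon> BridgeOver (wk ?D) (Var 3) (Var 2)"
      using weaken_tm[OF b(1,2) extends_dead[OF extends_refl]] by (simp add: sub_norm)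
    have d: "DimVar Brg # ?\<Delta> \<turnstile> Dim Brg (Var 0)" by (simp add: dim_var)
    have r: "restr (DimVar Brg # ?\<Delta>) (Var 0) = Dead # ?\<Delta>" by simp
    have "DimVar Brg # ?\<Delta> \<turnstile> Ty Large (BApp (wk ?D) (Var 0))"
      by (rule ty_of_univ[OF line_form[OF D3]])
    \<comment> \<open>At \<open>c x\<close> the roundtrip is judgementally trivial, so the constant
      path at \<open>c x\<close> has the required type.\<close>
    from path_refl_eq[OF wf_dim[OF b(1)] this extent_map_round[OF d, unfolded r, OF
      bridge_retraction_wk(2)[OF i3] c]]
    show "DimVar Brg # ?\<Delta> \<turnstile> PLam (BApp (Var 2) (Var 1))
      \<Ztypecolon> PathC (BApp (wk ?D) (Var 0))
      (extent_map \<psi> (Var 0) (extent_map \<phi> (Var 0) (BApp (Var 1) (Var 0)))) (BApp (Var 1) (Var 0))"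
      by (simp add: sub_norm)
    \<comment> \<open>The bridge takes the constant path at \<open>c 0\<close>, the end branch the
      one at \<open>a\<close>. They agree because \<open>c 0\<close> equals
      \<open>a\<close>.\<close>
    have "?\<Delta> \<turnstile> PLam (wk (BApp (Var 0) (Zero Brg))) \<doteq> PLam (wk (Var 2))
      \<Ztypecolon> ?P (Zero Brg) (BApp (Var 0) (Zero Brg))"
      by (rule path_refl_cong[OF b(1) ty_of_univ[OF tm_refl_left[OF D3e(1)]]
        extent_map_round_ends(1)[OF i3 tm_refl_left[OF D3c(1)[OF e3(1)]]] D3c(1)[OF e3(1)]])
    then show "?\<Delta> \<turnstile> (PLam (BApp (Var 2) (Var 1)))\<langle>Zero Brg\<rangle> \<doteq> PLam (Var 3) \<Ztypecolon>
      (PathC (BApp (wk ?D) (Var 0)) (extent_map \<psi> (Var 0) (extent_map \<phi> (Var 0)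
        (BApp (Var 1) (Var 0)))) (BApp (Var 1) (Var 0)))\<langle>Zero Brg\<rangle>"
      by (simp add: sub_norm s)
    have "?\<Delta> \<turnstile> PLam (wk (BApp (Var 0) (One Brg))) \<doteq> PLam (wk (Var 1))
      \<Ztypecolon> ?P (One Brg) (BApp (Var 0) (One Brg))"
      by (rule path_refl_cong[OF b(1) ty_of_univ[OF tm_refl_left[OF D3e(2)]]
        extent_map_round_ends(2)[OF i3 tm_refl_left[OF D3c(2)[OF e3(2)]]] D3c(2)[OF e3(2)]])
    then show "?\<Delta> \<turnstile> (PLam (BApp (Var 2) (Var 1)))\<langle>One Brg\<rangle> \<doteq> PLam (Var 2) \<Ztypecolon>
      (PathC (BApp (wk ?D) (Var 0)) (extent_map \<psi> (Var 0) (extent_map \<phi> (Var 0)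
        (BApp (Var 1) (Var 0)))) (BApp (Var 1) (Var 0)))\<langle>One Brg\<rangle>"
      by (simp add: sub_norm s)
  qed
  then show "TmVar (Bridge (ren (upr (\<lambda>n. n + 2)) (BApp (wk D) (Var 0))) (Var 1) (Var 0)) #
    TmVar (wk (BApp (wk D) (Var 0))\<langle>One Brg\<rangle>) # TmVar (BApp (wk D) (Var 0))\<langle>Zero Brg\<rangle> # \<Gamma> \<turnstile>
    Q \<Ztypecolon> Bridge
      (sub (BApp (Var 1) (Var 0) \<bullet> Var 0 \<bullet> (\<lambda>n. Var (n + 4))) (PathC (BApp (wk (wk D)) (Var 1))
      (extent_map \<psi> (Var 1) (extent_map \<phi> (Var 1) (Var 0))) (Var 0)))
           (sub (Var 2 \<bullet> (\<lambda>n. Var (n + 3))) (PLam (Var 1)))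
             (sub (Var 1 \<bullet> (\<lambda>n. Var (n + 3))) (PLam (Var 1)))"
    unfolding extent_ctx_def BridgeOver_def by (simp add: sub_norm s)
qed

lemma extent_refl:
  assumes r: "\<Gamma> \<turnstile> Dim Brg r" and i: "bridge_retraction (restr \<Gamma> r) A B D C \<phi> \<psi>"
      and M: "\<Gamma> \<turnstile> M \<Ztypecolon> BApp D r"
  shows "\<Gamma> \<turnstile> extent_refl r M \<Ztypecolon> PathC (BApp D r) (extent_map \<psi> r (extent_map \<phi> r M)) M"
  using extent[OF r _ extent_refl_cases[OF i], of M M] M
    extent_map_sub[OF bridge_retractionD(1)[OF i]] extent_map_sub[OF bridge_retractionD(2)[OF i]]
  by (simp add: sub_norm extent_refl_def)

lemma extent_refl_ends:
  assumes i: "bridge_retraction \<Gamma> A B D C \<phi> \<psi>"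
  shows "\<Gamma> \<turnstile> M \<Ztypecolon> BApp D (Zero Brg) \<Longrightarrow> \<Gamma> \<turnstile> extent_refl (Zero Brg) M \<doteq> PLam (wk M)
      \<Ztypecolon> PathC (BApp D (Zero Brg)) (extent_map \<psi> (Zero Brg) (extent_map \<phi> (Zero Brg) M)) M"
    "\<Gamma> \<turnstile> M \<Ztypecolon> BApp D (One Brg) \<Longrightarrow> \<Gamma> \<turnstile> extent_refl (One Brg) M \<doteq> PLam (wk M)
      \<Ztypecolon> PathC (BApp D (One Brg)) (extent_map \<psi> (One Brg) (extent_map \<phi> (One Brg) M)) M"
  using extent_zero[OF _ extent_refl_cases[OF i], of M]
    extent_one[OF _ extent_refl_cases[OF i], of M]
    extent_map_sub[OF bridge_retractionD(1)[OF i]] extent_map_sub[OF bridge_retractionD(2)[OF i]]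
  by (simp_all add: sub_norm extent_refl_def)

section \<open>Isomorphic bridges yield equal lines\<close>

definition line_equiv :: "tm \<Rightarrow> tm \<Rightarrow> bridge_term \<Rightarrow> bridge_term \<Rightarrow> tm \<Rightarrow> tm" where
  "line_equiv D C \<phi> \<psi> r = equiv_tm (BApp D r) (BApp C r) (Lam (extent_map \<phi> (wk r) (Var 0)))
    (Lam (extent_map \<psi> (wk r) (Var 0)))
     (Lam (extent_refl (wk r) (Var 0))) (Lam (extent_refl (wk r) (Var 0)))"

lemma extent_map_line:
  assumes m: "bridge_map \<Gamma> A B D C \<phi>"
  shows "TmVar (BApp (wk D) (Var 0)) # DimVar Brg # \<Gamma> \<turnstile> extent_map \<phi> (Var 1) (Var 0)
      \<Ztypecolon> wk (BApp (wk C) (Var 0))"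
proof -
  have "TmVar (BApp (wk D) (Var 0)) # DimVar Brg # \<Gamma> \<turnstile> Var 0 \<Ztypecolon> BApp (wk (wk D)) (Var 1)"
    by (rule tm_var) (simp add: sub_norm)
  from extent_map[OF _ _ this, of "wk (wk A)" "wk (wk B)" "wk (wk C)" \<phi>]
    bridge_map_wk(2)[OF bridge_map_wk(2)[OF m]]
  show ?thesis by (simp add: dim_var sub_norm)
qed

lemma extent_refl_line:
  assumes i: "bridge_retraction \<Gamma> A B D C \<phi> \<psi>"
  shows "TmVar (BApp (wk D) (Var 0)) # DimVar Brg # \<Gamma> \<turnstile> extent_refl (Var 1) (Var 0)
    \<Ztypecolon> PathC (wk (BApp (wk D) (Var 0))) (extent_map \<psi> (Var 1) (extent_map \<phi> (Var 1) (Var 0)))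
      (Var 0)"
proof -
  have "TmVar (BApp (wk D) (Var 0)) # DimVar Brg # \<Gamma> \<turnstile> Var 0 \<Ztypecolon> BApp (wk (wk D)) (Var 1)"
    by (rule tm_var) (simp add: sub_norm)
  from extent_refl[OF _ _ this, of "wk (wk A)" "wk (wk B)" "wk (wk C)" \<phi> \<psi>]
    bridge_retraction_wk(2)[OF bridge_retraction_wk(2)[OF i]]
  show ?thesis by (simp add: dim_var sub_norm)
qed

lemma line_equiv:
  assumes i: "bridge_retraction \<Gamma> A B D C \<phi> \<psi>" and j: "bridge_retraction \<Gamma> A B C D \<psi> \<phi>"
  shows "DimVar Brg # \<Gamma> \<turnstile> line_equiv (wk D) (wk C) \<phi> \<psi> (Var 0)
      \<Ztypecolon> Equiv (BApp (wk D) (Var 0)) (BApp (wk C) (Var 0))"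
proof -
  note m = bridge_retractionD(1,2)[OF i]
  note D = bridge_mapD(1)[OF m(1)] and C = bridge_mapD(2)[OF m(1)]
  note wf = wf_dim[OF univ_bridgeD(1)[OF D]]
  note DL = line_form[OF D] and CL = line_form[OF C]
  note DT = ty_of_univ[OF DL, of Large] and CT = ty_of_univ[OF CL, of Large]
  note f = extent_map_line[OF m(1)] and g = extent_map_line[OF m(2)]
  note s = extent_map_sub[OF m(1)] extent_map_sub[OF m(2)]
  have ht: "DimVar Brg # \<Gamma> \<turnstile> Lam (extent_refl (Var 1) (Var 0))
    \<Ztypecolon> RoundTrip (BApp (wk D) (Var 0)) (Lam (extent_map \<psi> (Var 1) (Var 0)))
    (Lam (extent_map \<phi> (Var 1) (Var 0)))"
    using extent_refl_line[OF i] by (intro lam_RoundTrip[OF wf CT DT g f]) (simp add: sub_norm s)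
  have hs: "DimVar Brg # \<Gamma> \<turnstile> Lam (extent_refl (Var 1) (Var 0))
    \<Ztypecolon> RoundTrip (BApp (wk C) (Var 0)) (Lam (extent_map \<phi> (Var 1) (Var 0)))
    (Lam (extent_map \<psi> (Var 1) (Var 0)))"
    using extent_refl_line[OF j] by (intro lam_RoundTrip[OF wf DT CT f g]) (simp add: sub_norm s)
  show ?thesis
    unfolding line_equiv_def
    using equiv_tm[OF wf DL CL pi_intro[OF DT f, folded Arr_def] pi_intro[OF CT g, folded Arr_def]
      hs ht]
    by (simp add: ren.simps)
qed

definition id_equiv :: "tm \<Rightarrow> tm" where "id_equiv A = equiv_tm A A id_tm id_tm refl_tm refl_tm"

text \<open>Since \<open>equiv_tm\<close> respects equality in all arguments, it suffices that the
  two maps become the identity and the roundtrip proofs constant paths; the proof component then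
  agrees as well. Stated for any \<open>r\<close> to cover both ends.\<close>

lemma line_equiv_end:
  assumes wf: "\<Gamma> \<turnstile> Wf" and A: "\<Gamma> \<turnstile> BApp D r \<doteq> A \<Ztypecolon> U" and B: "\<Gamma> \<turnstile> BApp C r \<doteq> A \<Ztypecolon> U"
    and f: "TmVar (BApp D r) # \<Gamma> \<turnstile> extent_map \<phi> (wk r) (Var 0) \<doteq> Var 0 \<Ztypecolon> wk (BApp C r)"
    and g: "TmVar (BApp C r) # \<Gamma> \<turnstile> extent_map \<psi> (wk r) (Var 0) \<doteq> Var 0 \<Ztypecolon> wk (BApp D r)"
    and s: "TmVar (BApp C r) # \<Gamma> \<turnstile> extent_refl (wk r) (Var 0) \<doteq> PLam (Var 1)
      \<Ztypecolon> PathC (wk (BApp C r)) (extent_map \<phi> (wk r) (extent_map \<psi> (wk r) (Var 0))) (Var 0)"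
    and t: "TmVar (BApp D r) # \<Gamma> \<turnstile> extent_refl (wk r) (Var 0) \<doteq> PLam (Var 1)
      \<Ztypecolon> PathC (wk (BApp D r)) (extent_map \<psi> (wk r) (extent_map \<phi> (wk r) (Var 0))) (Var 0)"
    and sb: "\<And>\<sigma> r M. sub \<sigma> (extent_map \<phi> r M) = extent_map \<phi> (sub \<sigma> r) (sub \<sigma> M)"
      "\<And>\<sigma> r M. sub \<sigma> (extent_map \<psi> r M) = extent_map \<psi> (sub \<sigma> r) (sub \<sigma> M)"
  shows "\<Gamma> \<turnstile> line_equiv D C \<phi> \<psi> r \<doteq> id_equiv A \<Ztypecolon> Equiv (BApp D r) (BApp C r)"
proof -
  note DT = ty_of_univ[OF tm_refl_left[OF A], of Large]
    and CT = ty_of_univ[OF tm_refl_left[OF B], of Large]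
  note f' = tm_refl_left[OF f] and g' = tm_refl_left[OF g]
  have ht: "\<Gamma> \<turnstile> Lam (extent_refl (wk r) (Var 0)) \<doteq> Lam (PLam (Var 1))
    \<Ztypecolon> RoundTrip (BApp D r) (Lam (extent_map \<psi> (wk r) (Var 0))) (Lam (extent_map \<phi> (wk r) (Var 0)))"
    using t by (intro lam_RoundTrip[OF wf CT DT g' f']) (simp add: sub_norm sb)
  have hs: "\<Gamma> \<turnstile> Lam (extent_refl (wk r) (Var 0)) \<doteq> Lam (PLam (Var 1))
    \<Ztypecolon> RoundTrip (BApp C r) (Lam (extent_map \<phi> (wk r) (Var 0))) (Lam (extent_map \<psi> (wk r) (Var 0)))"
    using s by (intro lam_RoundTrip[OF wf DT CT f' g']) (simp add: sub_norm sb)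
  show ?thesis
    unfolding line_equiv_def id_equiv_def id_tm_def refl_tm_def
    by (rule equiv_tm[OF wf A B pi_intro[OF DT f, folded Arr_def] pi_intro[OF CT g, folded Arr_def]
      hs ht])
qed

lemma line_equiv_ends:
  assumes i: "bridge_retraction \<Gamma> A B D C \<phi> \<psi>" and j: "bridge_retraction \<Gamma> A B C D \<psi> \<phi>"
  shows "\<Gamma> \<turnstile> line_equiv D C \<phi> \<psi> (Zero Brg) \<doteq> id_equiv A
      \<Ztypecolon> Equiv (BApp D (Zero Brg)) (BApp C (Zero Brg))"
    "\<Gamma> \<turnstile> line_equiv D C \<phi> \<psi> (One Brg) \<doteq> id_equiv B \<Ztypecolon> Equiv (BApp D (One Brg)) (BApp C (One Brg))"
proof -
  note m = bridge_retractionD(1,2)[OF i]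
  note D = bridge_mapD(1)[OF m(1)] and C = bridge_mapD(2)[OF m(1)]
  note wf = univ_bridgeD(1)[OF D]
  note eD = BridgeC_ends[OF univ_bridgeD(4)[OF D]] and eC = BridgeC_ends[OF univ_bridgeD(4)[OF C]]
  note sb = extent_map_sub[OF m(1)] extent_map_sub[OF m(2)]
  have f: "TmVar (BApp D (Zero Brg)) # \<Gamma> \<turnstile> extent_map \<phi> (Zero Brg) (Var 0) \<doteq> Var 0
    \<Ztypecolon> BApp (wk C) (Zero Brg)"
     "TmVar (BApp D (One Brg)) # \<Gamma> \<turnstile> extent_map \<phi> (One Brg) (Var 0) \<doteq> Var 0 \<Ztypecolon> BApp (wk C) (One Brg)"
    if m: "bridge_map \<Gamma> A B D C \<phi>" for D C \<phi>
  proof -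
    note D = bridge_mapD(1)[OF m] and C = bridge_mapD(2)[OF m]
    note eD = BridgeC_ends[OF univ_bridgeD(4)[OF D]] and eC = BridgeC_ends[OF univ_bridgeD(4)[OF C]]
    note m0 = bridge_map_wk(3)[OF m ty_of_univ[OF tm_refl_left[OF eD(1)]]]
      and m1 = bridge_map_wk(3)[OF m ty_of_univ[OF tm_refl_left[OF eD(2)]]]
    note c0 = BridgeC_conv[OF univ_bridgeD(4)[OF bridge_mapD(2)[OF m0]]]
      and c1 = BridgeC_conv[OF univ_bridgeD(4)[OF bridge_mapD(2)[OF m1]]]
    show "TmVar (BApp D (Zero Brg)) # \<Gamma> \<turnstile> extent_map \<phi> (Zero Brg) (Var 0) \<doteq> Var 0
      \<Ztypecolon> BApp (wk C) (Zero Brg)"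
      by (rule c0(1)[OF extent_map_ends(1)[OF m0 c0(3)[OF line_ends_var(1)[OF C D]]]])
    show "TmVar (BApp D (One Brg)) # \<Gamma> \<turnstile> extent_map \<phi> (One Brg) (Var 0) \<doteq> Var 0
      \<Ztypecolon> BApp (wk C) (One Brg)"
      by (rule c1(2)[OF extent_map_ends(2)[OF m1 c1(4)[OF line_ends_var(2)[OF C D]]]])
  qed
  have h: "TmVar (BApp D (Zero Brg)) # \<Gamma> \<turnstile> extent_refl (Zero Brg) (Var 0) \<doteq> PLam (Var 1)
    \<Ztypecolon> PathC (BApp (wk D) (Zero Brg)) (extent_map \<psi> (Zero Brg) (extent_map \<phi> (Zero Brg) (Var 0)))
    (Var 0)"
     "TmVar (BApp D (One Brg)) # \<Gamma> \<turnstile> extent_refl (One Brg) (Var 0) \<doteq> PLam (Var 1)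
       \<Ztypecolon> PathC (BApp (wk D) (One Brg)) (extent_map \<psi> (One Brg) (extent_map \<phi> (One Brg) (Var 0)))
       (Var 0)"
    if i: "bridge_retraction \<Gamma> A B D C \<phi> \<psi>" for D C \<phi> \<psi>
  proof -
    note D = bridge_mapD(1)[OF bridge_retractionD(1)[OF i]]
    note eD = BridgeC_ends[OF univ_bridgeD(4)[OF D]]
    note i0 = bridge_retraction_wk(3)[OF i ty_of_univ[OF tm_refl_left[OF eD(1)]]]
      and i1 = bridge_retraction_wk(3)[OF i ty_of_univ[OF tm_refl_left[OF eD(2)]]]
    show "TmVar (BApp D (Zero Brg)) # \<Gamma> \<turnstile> extent_refl (Zero Brg) (Var 0) \<doteq> PLam (Var 1)
      \<Ztypecolon> PathC (BApp (wk D) (Zero Brg)) (extent_map \<psi> (Zero Brg) (extent_map \<phi> (Zero Brg) (Var 0)))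
      (Var 0)"
      using extent_refl_ends(1)[OF i0 line_ends_var(1)[OF D D]] by (simp add: sub_norm)
    show "TmVar (BApp D (One Brg)) # \<Gamma> \<turnstile> extent_refl (One Brg) (Var 0) \<doteq> PLam (Var 1)
      \<Ztypecolon> PathC (BApp (wk D) (One Brg)) (extent_map \<psi> (One Brg) (extent_map \<phi> (One Brg) (Var 0)))
      (Var 0)"
      using extent_refl_ends(2)[OF i1 line_ends_var(2)[OF D D]] by (simp add: sub_norm)
  qed
  show "\<Gamma> \<turnstile> line_equiv D C \<phi> \<psi> (Zero Brg) \<doteq> id_equiv A
    \<Ztypecolon> Equiv (BApp D (Zero Brg)) (BApp C (Zero Brg))"
    using f(1)[OF m(1)] f(1)[OF m(2)] h(1)[OF i] h(1)[OF j]
    by (intro line_equiv_end[OF wf eD(1) eC(1) _ _ _ _ sb]) (simp_all add: ren.simps)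
  show "\<Gamma> \<turnstile> line_equiv D C \<phi> \<psi> (One Brg) \<doteq> id_equiv B \<Ztypecolon> Equiv (BApp D (One Brg)) (BApp C (One Brg))"
    using f(2)[OF m(1)] f(2)[OF m(2)] h(2)[OF i] h(2)[OF j]
    by (intro line_equiv_end[OF wf eD(2) eC(2) _ _ _ _ sb]) (simp_all add: ren.simps)
qed

section \<open>Univalence along a line of types, and its loops at the ends\<close>

definition id_loop :: "tm \<Rightarrow> tm" where "id_loop A = ua A A (id_equiv A)"

lemma id_loop_sub [simp]: "sub \<sigma> (id_loop A) = id_loop (sub \<sigma> A)"
  by (simp add: id_loop_def id_equiv_def)

lemma id_loop:
  assumes wf: "\<Gamma> \<turnstile> Wf" and A: "\<Gamma> \<turnstile> A \<Ztypecolon> U"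
  shows "\<Gamma> \<turnstile> id_loop A \<Ztypecolon> PathC U A A"
  unfolding id_loop_def id_equiv_def
  using id_tm[OF wf ty_of_univ[OF A]] by (intro ua equiv_tm wf A)

definition line_ua :: "tm \<Rightarrow> tm \<Rightarrow> bridge_term \<Rightarrow> bridge_term \<Rightarrow> tm \<Rightarrow> tm" where
  "line_ua D C \<phi> \<psi> r = ua (BApp D r) (BApp C r) (line_equiv D C \<phi> \<psi> r)"

text \<open>The assumption supplies that \<open>\<phi>\<close> and \<open>\<psi>\<close> commute
  with substitution. The lines in the conclusion are arbitrary terms, since they change under
  weakening.\<close>

lemma line_ua_sub:
  assumes i: "bridge_retraction \<Gamma> A B D' C' \<phi> \<psi>"
  shows "sub \<sigma> (line_ua D C \<phi> \<psi> r) = line_ua (sub \<sigma> D) (sub \<sigma> C) \<phi> \<psi> (sub \<sigma> r)"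
  by (simp add: line_ua_def line_equiv_def sub_norm extent_map_sub[OF bridge_retractionD(1)[OF i]]
    extent_map_sub[OF bridge_retractionD(2)[OF i]])

lemma line_ua:
  assumes i: "bridge_retraction \<Gamma> A B D C \<phi> \<psi>" and j: "bridge_retraction \<Gamma> A B C D \<psi> \<phi>"
  shows "DimVar Brg # \<Gamma> \<turnstile> line_ua (wk D) (wk C) \<phi> \<psi> (Var 0)
      \<Ztypecolon> PathC U (BApp (wk D) (Var 0)) (BApp (wk C) (Var 0))"
    "\<Gamma> \<turnstile> line_ua D C \<phi> \<psi> (Zero Brg) \<doteq> id_loop A \<Ztypecolon> PathC U (BApp D (Zero Brg)) (BApp C (Zero Brg))"
    "\<Gamma> \<turnstile> line_ua D C \<phi> \<psi> (One Brg) \<doteq> id_loop B \<Ztypecolon> PathC U (BApp D (One Brg)) (BApp C (One Brg))"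
proof -
  note D = bridge_mapD(1)[OF bridge_retractionD(1)[OF i]]
    and C = bridge_mapD(2)[OF bridge_retractionD(1)[OF i]]
  note wf = univ_bridgeD(1)[OF D]
  note eD = BridgeC_ends[OF univ_bridgeD(4)[OF D]] and eC = BridgeC_ends[OF univ_bridgeD(4)[OF C]]
  show "DimVar Brg # \<Gamma> \<turnstile> line_ua (wk D) (wk C) \<phi> \<psi> (Var 0)
    \<Ztypecolon> PathC U (BApp (wk D) (Var 0)) (BApp (wk C) (Var 0))"
    unfolding line_ua_def
    by (rule ua[OF wf_dim[OF wf] line_form[OF D] line_form[OF C] line_equiv[OF i j]])
  show "\<Gamma> \<turnstile> line_ua D C \<phi> \<psi> (Zero Brg) \<doteq> id_loop A
    \<Ztypecolon> PathC U (BApp D (Zero Brg)) (BApp C (Zero Brg))"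
    "\<Gamma> \<turnstile> line_ua D C \<phi> \<psi> (One Brg) \<doteq> id_loop B \<Ztypecolon> PathC U (BApp D (One Brg)) (BApp C (One Brg))"
    unfolding line_ua_def id_loop_def
    by (rule ua[OF wf eD(1) eC(1) line_equiv_ends(1)[OF i j]] ua[OF wf eD(2) eC(2)
      line_equiv_ends(2)[OF i j]])+
qed

text \<open>Turns a dependent path into a path after transport: coerce each \<open>P i\<close> from
  \<open>i\<close> to \<open>1\<close>. At \<open>0\<close> this is the full coercion of
  \<open>u\<close>; at \<open>1\<close> the coercion is trivial.\<close>

lemma coe_path:
  assumes wf: "\<Gamma> \<turnstile> Wf" and T: "DimVar Pth # \<Gamma> \<turnstile> Ty Large T" and P: "DimVar Pth # \<Gamma> \<turnstile> P \<Ztypecolon> T"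
    and u: "\<Gamma> \<turnstile> P\<langle>Zero Pth\<rangle> \<doteq> u \<Ztypecolon> T\<langle>Zero Pth\<rangle>" and v: "\<Gamma> \<turnstile> P\<langle>One Pth\<rangle> \<doteq> v \<Ztypecolon> T\<langle>One Pth\<rangle>"
  obtains w where "\<Gamma> \<turnstile> w \<Ztypecolon> PathC T\<langle>One Pth\<rangle> (Coe T (Zero Pth) (One Pth) u) v"
proof -
  let ?\<Gamma> = "DimVar Pth # \<Gamma>"
  \<comment> \<open>\<open>T\<close> under its own path variable, moved past the variable
    \<open>i\<close> of the path being built.\<close>
  let ?T = "sub (Var 0 \<bullet> shift 2) T"
  have w: "?\<Gamma> \<turnstile> Wf" by (rule wf_dim[OF wf])
  have sS: "case_nat (Var 0) (shift 2) \<circ> Suc = shift 2" by (simp add: fun_eq_iff)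
  have "DimVar Pth # ?\<Gamma> \<turnstile> SubEq (Var 0 \<bullet> shift 2) (Var 0 \<bullet> shift 2) (DimVar Pth # \<Gamma>)"
    by (rule sub_path, unfold sS, rule shift_SubEq)
      (simp_all add: dim_var extends.intros eval_nat_numeral)
  from ty_sub[OF w this T] have T': "DimVar Pth # ?\<Gamma> \<turnstile> Ty Large ?T" .
  have d: "?\<Gamma> \<turnstile> Dim Pth (Var 0)" by (simp add: dim_var)
  have "?\<Gamma> \<turnstile> P \<Ztypecolon> ?T\<langle>Var 0\<rangle>" using P by (simp add: sub_norm)
  from coe[OF T' d dim_one this] have c: "?\<Gamma> \<turnstile> Coe ?T (Var 0) (One Pth) P \<Ztypecolon> wk T\<langle>One Pth\<rangle>"
    by (simp add: sub_norm)
  have "\<Gamma> \<turnstile> PLam (Coe ?T (Var 0) (One Pth) P) \<Ztypecolon> PathC T\<langle>One Pth\<rangle> (Coe T (Zero Pth) (One Pth) u) v"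
    unfolding PathC_def
  proof (rule path_intro[OF c])
    show "\<Gamma> \<turnstile> (Coe ?T (Var 0) (One Pth) P)\<langle>Zero Pth\<rangle> \<doteq> Coe T (Zero Pth) (One Pth) u
      \<Ztypecolon> (wk T\<langle>One Pth\<rangle>)\<langle>Zero Pth\<rangle>"
      using coe[OF T dim_zero dim_one u] by (simp add: sub_norm)
    have "\<Gamma> \<turnstile> Coe T (One Pth) (One Pth) P\<langle>One Pth\<rangle> \<doteq> v \<Ztypecolon> T\<langle>One Pth\<rangle>"
      by (rule tm_trans[OF coe_same[OF T dim_one tm_refl_left[OF v]] v])
    then show "\<Gamma> \<turnstile> (Coe ?T (Var 0) (One Pth) P)\<langle>One Pth\<rangle> \<doteq> v \<Ztypecolon> (wk T\<langle>One Pth\<rangle>)\<langle>One Pth\<rangle>"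
      by (simp add: sub_norm)
  qed
  then show ?thesis by (rule that)
qed

text \<open>
  The univalence paths of \<open>line_equiv\<close> form a dependent path over this line of types, from \<open>D\<close> to
  \<open>C\<close>. As the line does not depend on \<open>D\<close> and \<open>C\<close>, the coercion along it cancels in
  \<open>GelLine_path\<close>.
\<close>

definition id_loop_line :: "tm \<Rightarrow> tm \<Rightarrow> tm" where
  "id_loop_line A B = BridgeC U (PApp (wk (id_loop A)) (Var 0)) (PApp (wk (id_loop B)) (Var 0))"

lemma bridge_iso_path:
  assumes i: "bridge_retraction \<Gamma> A B D C \<phi> \<psi>" and j: "bridge_retraction \<Gamma> A B C D \<psi> \<phi>"
  obtains w where "\<Gamma> \<turnstile> w \<Ztypecolon> PathC (BridgeC U A B) (Coe (id_loop_line A B) (Zero Pth) (One Pth) D) C"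
proof -
  let ?\<Gamma> = "DimVar Pth # \<Gamma>"
  note D = bridge_mapD(1)[OF bridge_retractionD(1)[OF i]]
    and C = bridge_mapD(2)[OF bridge_retractionD(1)[OF i]]
  note wf = univ_bridgeD(1)[OF D]
  note i1 = bridge_retraction_wk(1)[OF i, of Pth] and j1 = bridge_retraction_wk(1)[OF j, of Pth]
  note D1 = bridge_mapD(1)[OF bridge_retractionD(1)[OF i1]]
  note pA = id_loop[OF univ_bridgeD(1,2)[OF D1], unfolded PathC_def]
    and pB = id_loop[OF univ_bridgeD(1,3)[OF D1], unfolded PathC_def]
  have dv: "?\<Gamma> \<turnstile> Dim Pth (Var 0)" by (simp add: dim_var)
  have pA0: "?\<Gamma> \<turnstile> PApp (wk (id_loop A)) (Var 0) \<Ztypecolon> U"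
    and pB0: "?\<Gamma> \<turnstile> PApp (wk (id_loop B)) (Var 0) \<Ztypecolon> U"
    using path_elim[OF pA dv] path_elim[OF pB dv] by (simp_all add: sub_norm)
  have T: "?\<Gamma> \<turnstile> Ty Large (id_loop_line A B)" unfolding id_loop_line_def
    by (rule BridgeU_form[OF pA0 pB0])
  \<comment> \<open>The bridge binder is put inside the path binder: \<open>Var 0\<close> is the
    bridge variable, at which the univalence path is formed, and \<open>Var 1\<close> the path
    variable, at which it is evaluated.\<close>
  let ?P = "BLam (PApp (line_ua (wk (wk D)) (wk (wk C)) \<phi> \<psi> (Var 0)) (Var 1))"
  note b1 = line_ua[OF i1 j1, unfolded PathC_def] and b = line_ua[OF i j, unfolded PathC_def]
  note s = line_ua_sub[OF i]
  have "DimVar Brg # ?\<Gamma> \<turnstile> PApp (line_ua (wk (wk D)) (wk (wk C)) \<phi> \<psi> (Var 0)) (Var 1) \<Ztypecolon> U"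
    using path_elim[OF b1(1), of "Var 1"] by (simp add: dim_var sub_norm)
  moreover have "?\<Gamma> \<turnstile> PApp (line_ua (wk D) (wk C) \<phi> \<psi> (Zero Brg)) (Var 0)
    \<doteq> PApp (wk (id_loop A)) (Var 0) \<Ztypecolon> U"
     "?\<Gamma> \<turnstile> PApp (line_ua (wk D) (wk C) \<phi> \<psi> (One Brg)) (Var 0) \<doteq> PApp (wk (id_loop B)) (Var 0) \<Ztypecolon> U"
    using path_elim[OF b1(2) dv] path_elim[OF b1(3) dv] by (simp_all add: sub_norm)
  ultimately have P: "?\<Gamma> \<turnstile> ?P \<Ztypecolon> id_loop_line A B"
    unfolding id_loop_line_def BridgeC_def by (intro bridge_intro) (simp_all add: sub_norm s)
  \<comment> \<open>Both path ends at once: \<open>X\<close> is \<open>D\<close> for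
    \<open>r = 0\<close> and \<open>C\<close> for \<open>r = 1\<close>. The univalence path reduces
    to the line under the bridge binder, and eta for bridges removes the binder.\<close>
  have P0: "\<Gamma> \<turnstile> BLam (PApp (line_ua (wk D) (wk C) \<phi> \<psi> (Var 0)) r) \<doteq> X
    \<Ztypecolon> BridgeC U (PApp (id_loop A) r) (PApp (id_loop B) r)"
    if r: "\<Gamma> \<turnstile> Dim Pth r" and X: "univ_bridge \<Gamma> A B X"
      and e: "DimVar Brg # \<Gamma> \<turnstile> PApp (line_ua (wk D) (wk C) \<phi> \<psi> (Var 0)) (wk r) \<doteq> BApp (wk X) (Var 0)
        \<Ztypecolon> U"
      and wr: "wk r = r" "\<And>\<sigma>. sub \<sigma> r = r"
      and A: "\<Gamma> \<turnstile> PApp (id_loop A) r \<doteq> A \<Ztypecolon> U" and B: "\<Gamma> \<turnstile> PApp (id_loop B) r \<doteq> B \<Ztypecolon> U" for r X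
  proof -
    have "\<Gamma> \<turnstile> PApp (line_ua D C \<phi> \<psi> (Zero Brg)) r \<doteq> PApp (id_loop A) r \<Ztypecolon> U"
      "\<Gamma> \<turnstile> PApp (line_ua D C \<phi> \<psi> (One Brg)) r \<doteq> PApp (id_loop B) r \<Ztypecolon> U"
      using path_elim[OF b(2) r] path_elim[OF b(3) r] by (simp_all add: sub_norm)
    then have 1: "\<Gamma> \<turnstile> BLam (PApp (line_ua (wk D) (wk C) \<phi> \<psi> (Var 0)) r) \<doteq> BLam (BApp (wk X) (Var 0))
      \<Ztypecolon> BridgeC U (PApp (id_loop A) r) (PApp (id_loop B) r)"
      using e unfolding BridgeC_def by (intro bridge_intro) (simp_all add: sub_norm s wr)
    have "\<Gamma> \<turnstile> TyEq Large (BridgeC U A B) (BridgeC U (PApp (id_loop A) r) (PApp (id_loop B) r))"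
      unfolding BridgeC_def using tm_sym[OF A] tm_sym[OF B]
      by (intro bridge_form) (simp_all add: sub_norm univ_form)
    from tm_conv[OF bridge_eta[OF univ_bridgeD(4)[OF X, unfolded BridgeC_def], folded BridgeC_def]
      this]
    show ?thesis by (rule tm_trans[OF 1 tm_sym])
  qed
  note lA = path_ends[OF id_loop[OF wf univ_bridgeD(2)[OF D], unfolded PathC_def]]
    and lB = path_ends[OF id_loop[OF wf univ_bridgeD(3)[OF D], unfolded PathC_def]]
  note be = path_ends[OF b(1)]
  have "\<Gamma> \<turnstile> ?P\<langle>Zero Pth\<rangle> \<doteq> D \<Ztypecolon> (id_loop_line A B)\<langle>Zero Pth\<rangle>"
    using P0[OF dim_zero D] be(1) lA(1) lB(1) by (simp add: sub_norm s id_loop_line_def)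
  moreover have "\<Gamma> \<turnstile> ?P\<langle>One Pth\<rangle> \<doteq> C \<Ztypecolon> (id_loop_line A B)\<langle>One Pth\<rangle>"
    using P0[OF dim_one C] be(2) lA(2) lB(2) by (simp add: sub_norm s id_loop_line_def)
  ultimately obtain w where w: "\<Gamma> \<turnstile> w
    \<Ztypecolon> PathC (id_loop_line A B)\<langle>One Pth\<rangle> (Coe (id_loop_line A B) (Zero Pth) (One Pth) D) C"
    by (rule coe_path[OF wf T P])
  have "\<Gamma> \<turnstile> TyEq Large (id_loop_line A B)\<langle>One Pth\<rangle> (BridgeC U A B)"
    unfolding id_loop_line_def BridgeC_def using lA(2) lB(2)
    by (simp add: sub_norm, intro bridge_form) (simp_all add: sub_norm univ_form)
  then have te: "DimVar Pth # \<Gamma> \<turnstile> TyEq Large (wk (id_loop_line A B)\<langle>One Pth\<rangle>) (wk (BridgeC U A B))"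
    using weaken_ty[OF wf _ extends_dim[OF extends_refl]] by (simp only: wk_shift)
  from path_ends(3,4)[OF w[unfolded PathC_def]] have
    "\<Gamma> \<turnstile> w \<Ztypecolon> PathC (BridgeC U A B) (Coe (id_loop_line A B) (Zero Pth) (One Pth) D) C"
    unfolding PathC_def by (rule path_conv[OF w[unfolded PathC_def] te])
  then show ?thesis by (rule that)
qed

section \<open>Relativity\<close>

lemma BridgeOver_GelLine:
  assumes R: "relation \<Gamma> A B R" and a: "\<Gamma> \<turnstile> a \<Ztypecolon> A" and b: "\<Gamma> \<turnstile> b \<Ztypecolon> B"
  shows "\<Gamma> \<turnstile> BridgeOver (GelLine A B R) a b \<doteq> BridgeGel A B R a b \<Ztypecolon> U"
proof -
  have "DimVar Brg # \<Gamma> \<turnstile> BApp (wk (GelLine A B R)) (Var 0) \<doteq> GelRel (Var 0) (wk A) (wk B) (wk R)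
    \<Ztypecolon> U"
    using GelLine_app[of "DimVar Brg # \<Gamma>" "Var 0" "wk A" "wk B" "wk R"] relation_wk(2)[OF R]
    by (simp add: dim_var sub_norm)
  from ty_of_univ[OF this] show ?thesis
    unfolding BridgeOver_def BridgeGel_def using BridgeC_conv(1)[OF GelLine[OF R] a]
      BridgeC_conv(2)[OF GelLine[OF R] b]
    by (intro univ_intro bridge_form) (simp_all add: sub_norm)
qed

text \<open>Identifies the relation inside the Gel-type of \<open>bridge_rel C\<close> with bridges
  over \<open>C\<close>; after the beta step the projections of the pair still have to be reduced
  under \<open>BridgeOver\<close>.\<close>

lemma bridge_rel_app:
  assumes C: "univ_bridge \<Gamma> A B C" and a: "\<Gamma> \<turnstile> a \<Ztypecolon> A" and b: "\<Gamma> \<turnstile> b \<Ztypecolon> B"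
  shows "\<Gamma> \<turnstile> App (bridge_rel C) (Pair a b) \<doteq> BridgeOver C a b \<Ztypecolon> U"
proof -
  have T: "\<Gamma> \<turnstile> Ty Large (Times A B)" by (rule Times_form[OF univ_bridgeD(1,5,6)[OF C]])
  have "TmVar (Times A B) # \<Gamma> \<turnstile> BridgeOver (wk C) (Fst (Var 0)) (Snd (Var 0)) \<Ztypecolon> U"
    by (rule BridgeOver_form[OF univ_bridgeD(1,4)[OF univ_bridge_wk(3)[OF C T]] times_var(1,2)])
  from lam_beta[OF T this Times_intro[OF univ_bridgeD(1,5,6)[OF C] a b]]
  have "\<Gamma> \<turnstile> App (bridge_rel C) (Pair a b) \<doteq> BridgeOver C (Fst (Pair a b)) (Snd (Pair a b)) \<Ztypecolon> U"
    by (simp add: sub_norm bridge_rel_def BridgeOver_def)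
  moreover have "\<Gamma> \<turnstile> BridgeOver C (Fst (Pair a b)) (Snd (Pair a b)) \<doteq> BridgeOver C a b \<Ztypecolon> U"
    by (rule BridgeOver_form[OF univ_bridgeD(1,4)[OF C] sig_beta_fst[OF a b] sig_beta_snd[OF a b]])
  ultimately show ?thesis by (rule tm_trans)
qed

lemma univ_bridge_relation:
  assumes C: "univ_bridge \<Gamma> A B C"
  shows "relation \<Gamma> A B (bridge_rel C)"
  unfolding relation_def using univ_bridgeD(1-4)[OF C] bridge_rel[OF univ_bridgeD(1-4)[OF C]]
  by simp

lemma univ_bridge_GelLine:
  assumes C: "univ_bridge \<Gamma> A B C"
  shows "univ_bridge \<Gamma> A B (GelLine A B (bridge_rel C))"
  unfolding univ_bridge_def using univ_bridgeD(1-4)[OF C] GelLine[OF univ_bridge_relation[OF C]]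
  by simp

abbreviation ungel_map :: bridge_term where "ungel_map a b c \<equiv> ungel_bridge c"

lemma ungel_map:
  assumes C: "univ_bridge \<Gamma> A B C" and a: "\<Gamma> \<turnstile> a \<doteq> a' \<Ztypecolon> A" and b: "\<Gamma> \<turnstile> b \<doteq> b' \<Ztypecolon> B"
    and c: "\<Gamma> \<turnstile> c \<doteq> c' \<Ztypecolon> BridgeOver (GelLine A B (bridge_rel C)) a b"
  shows "\<Gamma> \<turnstile> ungel_bridge c \<doteq> ungel_bridge c' \<Ztypecolon> BridgeOver C a b"
  by (rule tm_conv_univ[OF ungel_bridge[OF univ_bridge_relation[OF C]
    tm_conv_univ[OF c BridgeOver_GelLine[OF univ_bridge_relation[OF C] tm_refl_left[OF a]
    tm_refl_left[OF b]]]]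
        bridge_rel_app[OF C tm_refl_left[OF a] tm_refl_left[OF b]]])

lemma mkgel_map:
  assumes C: "univ_bridge \<Gamma> A B C" and a: "\<Gamma> \<turnstile> a \<doteq> a' \<Ztypecolon> A" and b: "\<Gamma> \<turnstile> b \<doteq> b' \<Ztypecolon> B"
    and c: "\<Gamma> \<turnstile> c \<doteq> c' \<Ztypecolon> BridgeOver C a b"
  shows "\<Gamma> \<turnstile> gel_bridge a b c \<doteq> gel_bridge a' b' c' \<Ztypecolon> BridgeOver (GelLine A B (bridge_rel C)) a b"
  by (rule tm_conv_univ[OF gel_bridge[OF univ_bridge_relation[OF C] a b
    tm_conv_univ[OF c tm_sym[OF bridge_rel_app[OF C tm_refl_left[OF a] tm_refl_left[OF b]]]]]
        tm_sym[OF BridgeOver_GelLine[OF univ_bridge_relation[OF C] tm_refl_left[OF a]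
          tm_refl_left[OF b]]]])

lemma gel_bridge_maps:
  assumes C: "univ_bridge \<Gamma> A B C"
  defines "D \<equiv> GelLine A B (bridge_rel C)"
  shows "bridge_map \<Gamma> A B D C ungel_map" "bridge_map \<Gamma> A B C D gel_bridge"
  unfolding bridge_map_def D_def
  using C univ_bridge_GelLine[OF C] ungel_map[OF univ_bridge_weaken[OF C]]
    mkgel_map[OF univ_bridge_weaken[OF C]] by simp_all

text \<open>Beta and eta for Gel-types, transported along the type equalities. Both equations are
  first shown in an arbitrary context, as the definition demands them in all extensions.\<close>

lemma gel_bridge_retraction:
  assumes C: "univ_bridge \<Gamma> A B C"
  defines "D \<equiv> GelLine A B (bridge_rel C)"
  shows "bridge_retraction \<Gamma> A B D C ungel_map gel_bridge"
    "bridge_retraction \<Gamma> A B C D gel_bridge ungel_map"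
proof -
  have 1: "\<Gamma> \<turnstile> gel_bridge a b (ungel_bridge c) \<doteq> c \<Ztypecolon> BridgeOver (GelLine A B (bridge_rel C)) a b"
    if C: "univ_bridge \<Gamma> A B C" and a: "\<Gamma> \<turnstile> a \<Ztypecolon> A" and b: "\<Gamma> \<turnstile> b \<Ztypecolon> B"
      and c: "\<Gamma> \<turnstile> c \<Ztypecolon> BridgeOver (GelLine A B (bridge_rel C)) a b"
    for \<Gamma> A B C a b c
    by (rule tm_conv_univ[OF gel_ungel_bridge[OF univ_bridge_relation[OF C]
      tm_conv_univ[OF c BridgeOver_GelLine[OF univ_bridge_relation[OF C] a b]]]
          tm_sym[OF BridgeOver_GelLine[OF univ_bridge_relation[OF C] a b]]])
  have 2: "\<Gamma> \<turnstile> ungel_bridge (gel_bridge a b c) \<doteq> c \<Ztypecolon> BridgeOver C a b"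
    if C: "univ_bridge \<Gamma> A B C" and a: "\<Gamma> \<turnstile> a \<Ztypecolon> A" and b: "\<Gamma> \<turnstile> b \<Ztypecolon> B"
      and c: "\<Gamma> \<turnstile> c \<Ztypecolon> BridgeOver C a b"
    for \<Gamma> A B C a b c
    by (rule tm_conv_univ[OF ungel_gel_bridge[OF univ_bridge_relation[OF C] a b
      tm_conv_univ[OF c tm_sym[OF bridge_rel_app[OF C a b]]]]
          bridge_rel_app[OF C a b]])
  show "bridge_retraction \<Gamma> A B D C ungel_map gel_bridge"
    "bridge_retraction \<Gamma> A B C D gel_bridge ungel_map"
    unfolding bridge_retraction_def
    using gel_bridge_maps[OF C, folded D_def] 1[OF univ_bridge_weaken[OF C]] 2[OF
      univ_bridge_weaken[OF C]]
    by (simp_all add: D_def)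
qed

lemma id_bridge_retraction:
  assumes "univ_bridge \<Gamma> A B C"
  shows "bridge_retraction \<Gamma> A B C C (\<lambda>a b c. c) (\<lambda>a b c. c)"
  unfolding bridge_retraction_def bridge_map_def using assms by simp

lemma GelLine_path:
  assumes C: "univ_bridge \<Gamma> A B C"
  obtains w where "\<Gamma> \<turnstile> w \<Ztypecolon> PathC (BridgeC U A B) (GelLine A B (bridge_rel C)) C"
proof -
  let ?D = "GelLine A B (bridge_rel C)"
  let ?X = "Coe (id_loop_line A B) (Zero Pth) (One Pth) ?D"
  note wf = univ_bridgeD(1)[OF C]
  note T = BridgeU_form[OF univ_bridgeD(2,3)[OF C]]
  note D = univ_bridge_GelLine[OF C]
  obtain u where u: "\<Gamma> \<turnstile> u \<Ztypecolon> PathC (BridgeC U A B) ?X C"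
    by (rule bridge_iso_path[OF gel_bridge_retraction[OF C]])
  \<comment> \<open>The source \<open>?D\<close> and the line \<open>id_loop_line A B\<close> are as
    for \<open>u\<close>, so the left end is the same \<open>?X\<close>, and the two paths can be
    joined there.\<close>
  obtain v where v: "\<Gamma> \<turnstile> v \<Ztypecolon> PathC (BridgeC U A B) ?X ?D"
    by (rule bridge_iso_path[OF id_bridge_retraction[OF D] id_bridge_retraction[OF D]])
  obtain v' where v': "\<Gamma> \<turnstile> v' \<Ztypecolon> PathC (BridgeC U A B) ?D ?X"
    by (rule path_trans_rev[OF wf T path_refl[OF wf univ_bridgeD(4)[OF D]] v])
  show ?thesis by (rule path_trans[OF wf T v' u that])
qed

lemma rel_bridge_RoundTrip:
  assumes wf: "\<Gamma> \<turnstile> Wf" and A: "\<Gamma> \<turnstile> A \<Ztypecolon> U" and B: "\<Gamma> \<turnstile> B \<Ztypecolon> U"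
  obtains w where "\<Gamma> \<turnstile> w \<Ztypecolon> RoundTrip (BridgeC U A B) (rel_bridge A B) bridgetorel"
proof -
  let ?T = "BridgeC U A B"
  note T = BridgeU_form[OF A B]
  note w = weaken_tm[OF wf _ extends_tm[OF extends_refl]]
  have "univ_bridge (TmVar ?T # \<Gamma>) (wk A) (wk B) (Var 0)"
    unfolding univ_bridge_def using wf_tm[OF wf T] w[OF A] w[OF B] by (simp add: sub_norm tm_var)
  from GelLine_path[OF this] obtain w where w: "TmVar ?T # \<Gamma> \<turnstile> w
    \<Ztypecolon> PathC (BridgeC U (wk A) (wk B)) (GelLine (wk A) (wk B) (bridge_rel (Var 0))) (Var 0)" .
  have "\<Gamma> \<turnstile> Lam w \<Ztypecolon> RoundTrip ?T (Lam (GelLine (wk A) (wk B) (Var 0))) (Lam (bridge_rel (Var 0)))"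
    using w by (intro lam_RoundTrip[OF wf rel_type_form[OF assms] T rel_bridge_body[OF assms]
      bridgetorel_body[OF assms]])
      (simp add: sub_norm)
  with that show ?thesis by (simp add: bridgetorel_eq rel_bridge_def)
qed

theorem theorem9p3:
  fixes \<Gamma> :: ctx and A B :: tm
  assumes "\<Gamma> \<turnstile> Wf" and "\<Gamma> \<turnstile> A \<Ztypecolon> U" and "\<Gamma> \<turnstile> B \<Ztypecolon> U"
  shows "(\<Gamma> \<turnstile> bridgetorel \<Ztypecolon> Arr (BridgeC U A B) (Arr (Times A B) U))
    \<and> (\<exists>E. \<Gamma> \<turnstile> E \<Ztypecolon> isEquiv (BridgeC U A B) (Arr (Times A B) U) bridgetorel)
    \<and> (\<exists>E. \<Gamma> \<turnstile> E \<Ztypecolon> Equiv (BridgeC U A B) (Arr (Times A B) U))"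
proof -
  note T = BridgeU_form[OF assms(2,3)] rel_type_form[OF assms]
  note f = bridgetorel_typ[OF assms]
  obtain s where s: "\<Gamma> \<turnstile> s \<Ztypecolon> RoundTrip (Arr (Times A B) U) bridgetorel (rel_bridge A B)"
    by (rule bridgetorel_RoundTrip[OF assms])
  obtain t where t: "\<Gamma> \<turnstile> t \<Ztypecolon> RoundTrip (BridgeC U A B) (rel_bridge A B) bridgetorel"
    by (rule rel_bridge_RoundTrip[OF assms])
  obtain E where E: "\<Gamma> \<turnstile> E \<Ztypecolon> isEquiv (BridgeC U A B) (Arr (Times A B) U) bridgetorel"
    by (rule qinv_isEquiv[OF assms(1) T f rel_bridge[OF assms] s t])
  from f E Equiv_intro[OF assms(1) T f E] show ?thesis by blast
qed

end
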